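(* Consider the linear panel data model with fixed effects described in the context, and let Assumptions A1–A3 hold. Suppose moreover that the limit $\Upsilon := \lim_{n,m\to\infty} \Upsilon_{n,m}$ exists, where $\Upsilon_{n,m} := \Sigma_{n,m}^{-1}\Omega_{n,m}\Sigma_{n,m}^{-1}$. Then $$ \sqrt{nm}\,\Big(\hat\beta - \beta - \tfrac{1}{m}\Sigma_{n,m}^{-1} b_{n,m}\Big) \xrightarrow{L} N(0,\Upsilon), $$ where $$ b_{n,m} := -\frac{1}{n}\sum_{i=1}^n \sum_{\tau=1}^{m-1}\frac{m-\tau}{m}\Big(\mathbb{E}(z_{it}\varepsilon_{i,t+\tau}) + \mathbb{E}(z_{i,t+\tau}\varepsilon_{it})\Big). $$
   Context: Panel data $(y_{it},x_{it})$, $i=1,\dots,n$, $t=1,\dots,m$, with $x_{it}\in\mathbb{R}^K$, generated by $y_{it}=\alpha_i + x_{it}'\beta+\varepsilon_{it}$ with $\mathbb{E}(\varepsilon_{it})=0$ and $\mathbb{E}(x_{it}\varepsilon_{it})=0$; the intercepts $\alpha_1,\dots,\alpha_n$ are unknown fixed parameters. Regressors need not be strictly exogenous: $\mathbb{E}(x_{it}\varepsilon_{i,t+\tau})$ and $\mathbb{E}(x_{i,t+\tau}\varepsilon_{it})$ may be nonzero for $\tau\neq 0$. Let $z_{it}:=x_{it}-\mathbb{E}(x_{it})$, $\bar y_i := \frac1m\sum_t y_{it}$, $\bar x_i:=\frac1m\sum_t x_{it}$. The within-group estimator is $\hat\beta := \big(\sum_{i,t}(x_{it}-\bar x_i)(x_{it}-\bar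 x_i)'\big)^{-1}\sum_{i,t}(x_{it}-\bar x_i)(y_{it}-\bar y_i)$. Define $\Sigma_{n,m}:=\frac{1}{nm}\sum_{i,t}\mathbb{E}(z_{it}z_{it}')$ and $\Omega_{n,m}:=\frac{1}{nm}\sum_{i=1}^n\sum_{t=1}^m\Big(\mathbb{E}(z_{it}z_{it}'\varepsilon_{it}^2)+\sum_{\tau=1}^{m-1}\frac{m-\tau}{m}\mathbb{E}\big((z_{it}z_{i,t+\tau}'+z_{i,t+\tau}z_{it}')\varepsilon_{it}\varepsilon_{i,t+\tau}\big)\Big)$ (the variance of $\frac{1}{\sqrt{nm}}\sum_{i,t}z_{it}\varepsilon_{it}$). Assumption A1: (i) $x_{it},\varepsilon_{it}$ have moments of order $2r$ bounded uniformly in $i,t$, for some $r>2$; (ii) $x_{it}\varepsilon_{it}$ has moments of order $3r$ bounded uniformly in $i,t$; (iii) the variables are independent across $i$; (iv) for each $i$ the process $\{(x_{it},\varepsilon_{it})\}_t$ is stationary and strong mixing with mixing coefficients $a_i(h):=\sup_t\sup_{A\in\mathcal{A}_{it},B\in\mathcal{B}_{i,t+h}}|\mathbb{P}(A\cap B)-\mathbb{P}(A)\mathbb{P}(B)|$ satisfying $\sup_{1\le i\le n}a_i(h)=O(h^{-s})$ for some $s>4r/(r-2)$, where $\mathcal{A}_{it}$ and $\mathcal{B}_{it}$ are the sigma-algebras generated by $(x_{it},\varepsilon_{it}),(x_{i,t-1},\varepsilon_{i,t-1}),\dots$ and $(x_{it},\varepsilon_{it}),(x_{i,t+1},\varepsilon_{i,t+1}),\dots$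 respectively. Assumption A2: $\Sigma_{n,m}$ and $\Omega_{n,m}$ are uniformly (in $n,m$) positive definite. Assumption A3: $n,m\to\infty$ with $n/m\to c\in[0,\infty)$. *)

theory Defs
  imports "HOL-Probability.Probability"
begin

definition outer :: "real^'k \<Rightarrow> real^'k \<Rightarrow> real^'k^'k" where
  "outer u v = (\<chi> a b. u$a * v$b)"

definition past_events :: "'a measure \<Rightarrow> (nat \<Rightarrow> 'a \<Rightarrow> 'b::topological_space) \<Rightarrow> nat \<Rightarrow> 'a set set" where
  "past_events M X t =
     {(\<lambda>\<omega>. restrict (\<lambda>s. X s \<omega>) {..t}) -` S \<inter> space M | S. S \<in> sets (PiM {..t} (\<lambda>_. borel))}"

definition future_events :: "'a measure \<Rightarrow> (nat \<Rightarrow> 'a \<Rightarrow> 'b::topological_space) \<Rightarrow> nat \<Rightarrow> 'a set set" where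
  "future_events M X t =
     {(\<lambda>\<omega>. restrict (\<lambda>s. X s \<omega>) {t..}) -` S \<inter> space M | S. S \<in> sets (PiM {t..} (\<lambda>_. borel))}"

definition alpha_mixing_coef :: "'a measure \<Rightarrow> (nat \<Rightarrow> 'a \<Rightarrow> 'b::topological_space) \<Rightarrow> nat \<Rightarrow> real" where
  "alpha_mixing_coef M X h =
     Sup {\<bar>measure M (A \<inter> B) - measure M A * measure M B\<bar> | t A B.
            A \<in> past_events M X t \<and> B \<in> future_events M X (t + h)}"

definition conv_in_distr :: "'i filter \<Rightarrow> 'a measure \<Rightarrow> ('i \<Rightarrow> 'a \<Rightarrow> 'b::topological_space) \<Rightarrow> 'b measure \<Rightarrow> bool" where
  "conv_in_distr F M S \<mu> \<longleftrightarrow>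
     (\<forall>f::'b \<Rightarrow> real. continuous_on UNIV f \<and> bounded (range f) \<longrightarrow>
        ((\<lambda>k. \<integral>\<omega>. f (S k \<omega>) \<partial>M) \<longlongrightarrow> (\<integral>u. f u \<partial>\<mu>)) F)"

text \<open>Multivariate normal law N(0,V) (V positive definite) on R^K, via its Lebesgue density.\<close>
definition mvnormal :: "real^'k^'k \<Rightarrow> (real^'k) measure" where
  "mvnormal V = density lborel (\<lambda>u. ennreal (exp (- (u \<bullet> (matrix_inv V *v u)) / 2)
                                       / sqrt ((2 * pi) ^ CARD('k) * det V)))"

definition panel_limit :: "real \<Rightarrow> (nat \<times> nat) filter" where
  "panel_limit c = inf (prod_filter at_top at_top) (filtercomap (\<lambda>(n, m). real n / real m) (nhds c))"

definition zc :: "'a measure \<Rightarrow> (nat \<Rightarrow> nat \<Rightarrow> 'a \<Rightarrow> real^'k) \<Rightarrow> nat \<Rightarrow> nat \<Rightarrow> 'a \<Rightarrow> real^'k" where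
  "zc M x i t \<omega> = x i t \<omega> - (\<integral>\<omega>'. x i t \<omega>' \<partial>M)"

definition SigmaNM :: "'a measure \<Rightarrow> (nat \<Rightarrow> nat \<Rightarrow> 'a \<Rightarrow> real^'k) \<Rightarrow> nat \<Rightarrow> nat \<Rightarrow> real^'k^'k" where
  "SigmaNM M x n m = (1 / real (n * m)) *\<^sub>R
     (\<Sum>i<n. \<Sum>t<m. \<integral>\<omega>. outer (zc M x i t \<omega>) (zc M x i t \<omega>) \<partial>M)"

definition OmegaNM :: "'a measure \<Rightarrow> (nat \<Rightarrow> nat \<Rightarrow> 'a \<Rightarrow> real^'k) \<Rightarrow> (nat \<Rightarrow> nat \<Rightarrow> 'a \<Rightarrow> real)
    \<Rightarrow> nat \<Rightarrow> nat \<Rightarrow> real^'k^'k" where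
  "OmegaNM M x eps n m = (1 / real (n * m)) *\<^sub>R
     (\<Sum>i<n. \<Sum>t<m.
        (\<integral>\<omega>. (eps i t \<omega>)\<^sup>2 *\<^sub>R outer (zc M x i t \<omega>) (zc M x i t \<omega>) \<partial>M)
      + (\<Sum>\<tau>\<in>{1..<m}. (real (m - \<tau>) / real m) *\<^sub>R
          (\<integral>\<omega>. (eps i t \<omega> * eps i (t + \<tau>) \<omega>) *\<^sub>R
               (outer (zc M x i t \<omega>) (zc M x i (t + \<tau>) \<omega>)
                + outer (zc M x i (t + \<tau>) \<omega>) (zc M x i t \<omega>)) \<partial>M)))"

text \<open>Bias term b_{n,m}; the free period t of the paper's formula is taken to be the first
  period (index 0); by stationarity the value does not depend on t.\<close>
definition bNM :: "'a measure \<Rightarrow> (nat \<Rightarrow> nat \<Rightarrow> 'a \<Rightarrow> real^'k) \<Rightarrow> (nat \<Rightarrow> nat \<Rightarrow> 'a \<Rightarrow> real)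
    \<Rightarrow> nat \<Rightarrow> nat \<Rightarrow> real^'k" where
  "bNM M x eps n m = - ((1 / real n) *\<^sub>R
     (\<Sum>i<n. \<Sum>\<tau>\<in>{1..<m}. (real (m - \<tau>) / real m) *\<^sub>R
        ((\<integral>\<omega>. eps i \<tau> \<omega> *\<^sub>R zc M x i 0 \<omega> \<partial>M) + (\<integral>\<omega>. eps i 0 \<omega> *\<^sub>R zc M x i \<tau> \<omega> \<partial>M))))"

definition UpsilonNM :: "'a measure \<Rightarrow> (nat \<Rightarrow> nat \<Rightarrow> 'a \<Rightarrow> real^'k) \<Rightarrow> (nat \<Rightarrow> nat \<Rightarrow> 'a \<Rightarrow> real)
    \<Rightarrow> nat \<Rightarrow> nat \<Rightarrow> real^'k^'k" where
  "UpsilonNM M x eps n m =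
     matrix_inv (SigmaNM M x n m) ** OmegaNM M x eps n m ** matrix_inv (SigmaNM M x n m)"

definition xbar :: "(nat \<Rightarrow> nat \<Rightarrow> 'a \<Rightarrow> real^'k) \<Rightarrow> nat \<Rightarrow> nat \<Rightarrow> 'a \<Rightarrow> real^'k" where
  "xbar x i m \<omega> = (1 / real m) *\<^sub>R (\<Sum>t<m. x i t \<omega>)"

definition ybar :: "(nat \<Rightarrow> nat \<Rightarrow> 'a \<Rightarrow> real) \<Rightarrow> nat \<Rightarrow> nat \<Rightarrow> 'a \<Rightarrow> real" where
  "ybar y i m \<omega> = (1 / real m) * (\<Sum>t<m. y i t \<omega>)"

definition within_est :: "(nat \<Rightarrow> nat \<Rightarrow> 'a \<Rightarrow> real^'k) \<Rightarrow> (nat \<Rightarrow> nat \<Rightarrow> 'a \<Rightarrow> real)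
    \<Rightarrow> nat \<Rightarrow> nat \<Rightarrow> 'a \<Rightarrow> real^'k" where
  "within_est x y n m \<omega> =
     matrix_inv (\<Sum>i<n. \<Sum>t<m. outer (x i t \<omega> - xbar x i m \<omega>) (x i t \<omega> - xbar x i m \<omega>))
     *v (\<Sum>i<n. \<Sum>t<m. (y i t \<omega> - ybar y i m \<omega>) *\<^sub>R (x i t \<omega> - xbar x i m \<omega>))"

end

theory Submission
  imports Defs
begin

text \<open>
  Within-group demeaning gives, with \<open>Z\<^sub>i, E\<^sub>i, U\<^sub>i\<close> the sums over \<open>t\<close> of \<open>z\<^sub>i\<^sub>t, \<epsilon>\<^sub>i\<^sub>t, \<epsilon>\<^sub>i\<^sub>t z\<^sub>i\<^sub>t\<close>, the normal equations
  \<open>S (\<beta>^ - \<beta>) = (1/(nm)) \<Sum>\<^sub>i (U\<^sub>i - E\<^sub>i Z\<^sub>i / m)\<close>, where \<open>S\<close> is the sample second moment matrix. The expectation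
  of the \<open>E\<^sub>i Z\<^sub>i\<close> terms is exactly the bias \<open>b / m\<close>. Davydov-type covariance bounds yield fourth moments
  of order \<open>m\<^sup>2\<close> for \<open>Z\<^sub>i, E\<^sub>i, U\<^sub>i\<close>; together with independence across \<open>i\<close> they make the centred \<open>E\<^sub>i Z\<^sub>i\<close> terms
  and \<open>S - \<Sigma>\<close> negligible and verify Lyapunov's condition for \<open>U\<^sub>i\<close>. Convergence in law then follows from
  pointwise convergence of characteristic functions and tightness, because compactly supported
  functions are approximated by trigonometric polynomials.
\<close>

subsection \<open>Convergence in law from characteristic functions\<close>

text \<open>The mixing condition is used through one exponent. Put p = 2r. A centred variable in L^p
  and a product of three such variables, at time distance g, have covariance of order \<alpha>^(1 -
  4/p). With \<alpha> = O(g^(-s)) the decay exponent is s(p - 4)/p = s(r - 2)/r, and s > 4r/(r - 2)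
  makes it at least 4. The bound g^(-4) splits into two summable inverse squares, which is the
  source of the order m^2. The limit runs along a filter in two indices, while \<Sigma>, \<Omega>
  and the direction \<Sigma>^(-1) u all move with (n, m). Hence every approximation, the Gaussian
  one included, is an explicit inequality in n, m and n/m with constants uniform over units and
  periods; limits are taken only at the very end. The ratio n/m matters because the estimator is
  recentred with \<Sigma>^(-1) b while the normal equations carry the sample matrix S: a term
  sqrt(n/m) (S - \<Sigma>) \<Sigma>^(-1) b is left over, and it vanishes since n/m stays
  bounded.\<close>

inductive trig_poly :: "(real^'k \<Rightarrow> real) \<Rightarrow> bool" where
  cos: "trig_poly (\<lambda>x. a * cos (u \<bullet> x + b))"
| add: "trig_poly f \<Longrightarrow> trig_poly g \<Longrightarrow> trig_poly (\<lambda>x. f x + g x)"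

lemma trig_poly_const: "trig_poly (\<lambda>x::real^'k. c)"
  using trig_poly.cos[of c 0 0] by simp

text \<open>The product-to-sum formula makes the class an algebra. The phase in the generators
  already supplies sines and constants, so Stone-Weierstrass can be applied to it.\<close>

lemma trig_poly_mult:
  assumes "trig_poly f" "trig_poly g"
  shows "trig_poly (\<lambda>x. f x * g x)"
  using assms
proof (induction arbitrary: g rule: trig_poly.induct)
  case (cos a u b)
  from cos show ?case
  proof (induction rule: trig_poly.induct)
    case (cos a' u' b')
    have "(\<lambda>x. a * cos (u \<bullet> x + b) * (a' * cos (u' \<bullet> x + b')))
        = (\<lambda>x. (a * a' / 2) * cos ((u - u') \<bullet> x + (b - b')) + (a * a' / 2) * cos ((u + u') \<bullet> x + (b + b')))"
    proof
      fix x
      have e: "(u - u') \<bullet> x + (b - b') = (u \<bullet> x + b) - (u' \<bullet> x + b')"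
        "(u + u') \<bullet> x + (b + b') = (u \<bullet> x + b) + (u' \<bullet> x + b')"
        by (simp_all add: inner_add_left inner_diff_left)
      show "a * cos (u \<bullet> x + b) * (a' * cos (u' \<bullet> x + b'))
        = (a * a' / 2) * cos ((u - u') \<bullet> x + (b - b')) + (a * a' / 2) * cos ((u + u') \<bullet> x + (b + b'))"
        unfolding e cos_diff cos_add by (simp add: field_simps)
    qed
    then show ?case by (simp only: trig_poly.intros)
  qed (simp add: distrib_left trig_poly.add)
qed (simp add: distrib_right trig_poly.add)

lemma continuous_on_trig_poly: "trig_poly f \<Longrightarrow> continuous_on S f"
  by (induction rule: trig_poly.induct) (auto intro!: continuous_intros)

lemma tendsto_integral_trig_poly:
  fixes S :: "'i \<Rightarrow> 'a \<Rightarrow> real^'k"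
  assumes M: "prob_space M" and \<mu>: "prob_space \<mu>" "sets \<mu> = sets borel"
    and S [measurable]: "\<And>k. S k \<in> borel_measurable M"
    and lim: "\<And>u b. ((\<lambda>k. \<integral>\<omega>. cos (u \<bullet> S k \<omega> + b) \<partial>M) \<longlongrightarrow> (\<integral>x. cos (u \<bullet> x + b) \<partial>\<mu>)) F"
    and g: "trig_poly g"
  shows "((\<lambda>k. \<integral>\<omega>. g (S k \<omega>) \<partial>M) \<longlongrightarrow> (\<integral>x. g x \<partial>\<mu>)) F \<and> integrable \<mu> g
    \<and> (\<forall>k. integrable M (\<lambda>\<omega>. g (S k \<omega>)))"
  using g
proof (induction rule: trig_poly.induct)
  case (cos a u b)
  interpret prob_space M by fact
  interpret \<mu>: prob_space \<mu> by fact
  have [measurable]: "(\<lambda>x. cos (u \<bullet> x + b)) \<in> borel_measurable \<mu>"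
    unfolding measurable_cong_sets[OF \<mu>(2) refl] by measurable
  show ?case
    using lim[of u b]
    by (auto intro!: tendsto_mult \<mu>.integrable_const_bound[where B=1]
        integrable_const_bound[where B=1])
next
  case (add f g)
  then show ?case by (auto intro!: tendsto_add)
qed

lemma Arg_cis_cube:
  fixes y :: real assumes "\<bar>y\<bar> < pi" shows "Arg (cis y) = y"
  using assms by (intro Arg_cis) (auto simp: abs_less_iff)

text \<open>A periodic extension of \<open>f\<close> factors through the torus, where Stone-Weierstrass applies;
  periodicity is what makes the uniform bound of the approximant global.\<close>
lemma trig_poly_approx:
  fixes f :: "real^'k \<Rightarrow> real"
  assumes f: "continuous_on UNIV f" and B: "\<And>x. \<bar>f x\<bar> \<le> B" and L: "L > 0" and e: "e > 0"
  obtains g where "trig_poly g" "\<And>x. \<bar>g x\<bar> \<le> B + e" "\<And>x. norm x \<le> L \<Longrightarrow> \<bar>g x - f x\<bar> \<le> e"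
proof -
  define T :: "(complex^'k) set" where "T = {w. \<forall>k. norm (w $ k) = 1}"
  \<comment> \<open>The cutoff is 0 where some real part is at most -1/2, which hides the jump of
    \<open>Arg\<close> at -1, and 1 where all real parts are nonnegative.\<close>
  define ct :: "complex^'k \<Rightarrow> real" where "ct w = (\<Prod>k\<in>UNIV. max 0 (min 1 (1 + 2 * Re (w $ k))))" for w
  define F where "F w = f (\<chi> k. L * Arg (w $ k)) * ct w" for w
  \<comment> \<open>Scaling by \<open>L\<close> sends the ball of radius \<open>L\<close> to angles
    in [-1, 1], where cosines are nonnegative, so the cutoff is 1 there and \<open>Arg\<close>
    recovers the coordinates.\<close>
  define p :: "real^'k \<Rightarrow> complex^'k" where "p x = (\<chi> k. cis (x $ k / L))" for x
  have "B \<ge> 0" using B[of 0] by linarith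
  have pT: "p x \<in> T" for x by (simp add: p_def T_def)
  have "compact T"
  proof -
    have "closed T" unfolding T_def Collect_all_eq
      by (intro closed_INT ballI closed_Collect_eq) (auto intro!: continuous_intros)
    moreover have "bounded T"
    proof (rule boundedI)
      fix w assume "w \<in> T"
      then have "(\<Sum>k\<in>UNIV. norm (w $ k)) = real CARD('k)" by (simp add: T_def)
      then show "norm w \<le> real CARD('k)" 
        using L2_set_le_sum[of UNIV "\<lambda>k. norm (w $ k)"] by (simp add: norm_vec_def)
    qed
    ultimately show ?thesis by (simp add: compact_eq_bounded_closed)
  qed
  have ct_cont: "continuous_on UNIV ct" unfolding ct_def by (intro continuous_intros)
  have F_cont: "continuous_on T F"
  proof -
    \<comment> \<open>Two open sets cover the torus: on \<open>U\<close> every \<open>Arg\<close> is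
      continuous, and on \<open>W\<close> the cutoff makes \<open>F\<close> vanish
      identically.\<close>
    define U where "U = {w::complex^'k. \<forall>k. w $ k \<notin> \<real>\<^sub>\<le>\<^sub>0}"
    define W where "W = {w::complex^'k. \<exists>k. Re (w $ k) < -1/2}"
    have "open U" unfolding U_def Collect_all_eq
    proof (intro open_INT finite ballI)
      fix k :: 'k
      have "{w::complex^'k. w $ k \<notin> \<real>\<^sub>\<le>\<^sub>0} = (\<lambda>w. w $ k) -` (- \<real>\<^sub>\<le>\<^sub>0)" by auto
      then show "open {w::complex^'k. w $ k \<notin> \<real>\<^sub>\<le>\<^sub>0}"
        by (simp add: open_vimage open_Compl continuous_on_component)
    qed
    have "open W" unfolding W_def Collect_ex_eq
      by (intro open_UN ballI open_Collect_less) (auto intro!: continuous_intros)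
    have "continuous_on U F" unfolding F_def
    proof (intro continuous_on_mult continuous_on_subset[OF ct_cont] continuous_on_compose2[OF f])
      have "continuous_on U (\<lambda>w. Arg (w $ k))" for k
        by (intro continuous_on_compose2[OF continuous_on_Arg] continuous_intros) (auto simp: U_def)
      then show "continuous_on U (\<lambda>w. \<chi> k. L * Arg (w $ k))"
        by (intro continuous_on_vec_lambda continuous_on_mult continuous_on_const)
    qed auto
    moreover have "continuous_on W F"
    proof -
      have "F w = 0" if "w \<in> W" for w
      proof -
        obtain k where "Re (w $ k) < -1/2" using \<open>w \<in> W\<close> W_def by auto
        then have "ct w = 0" unfolding ct_def by (intro prod_zero bexI[of _ k]) auto
        then show ?thesis by (simp add: F_def)
      qed
      then show ?thesis by (simp add: continuous_on_eq[OF continuous_on_const[of _ 0]])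
    qed
    ultimately have "continuous_on (U \<union> W) F"
      using \<open>open U\<close> \<open>open W\<close> by (intro continuous_on_open_Un)
    moreover have "T \<subseteq> U \<union> W"
    proof
      fix w assume "w \<in> T"
      show "w \<in> U \<union> W"
      proof (cases "w \<in> U")
        case False
        then obtain k where "w $ k \<in> \<real>\<^sub>\<le>\<^sub>0" unfolding U_def by auto
        then obtain t where t: "w $ k = of_real t" "t \<le> 0" by (auto elim: nonpos_Reals_cases)
        moreover have "norm (w $ k) = 1" using \<open>w \<in> T\<close> by (simp add: T_def)
        ultimately have "t = -1" by auto
        then show ?thesis using t unfolding W_def by (auto intro!: exI[of _ k])
      qed auto
    qed
    ultimately show ?thesis by (rule continuous_on_subset)
  qed
  \<comment> \<open>The algebra for Stone-Weierstrass consists of functions on the torus whose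
    pullback along \<open>p\<close> is a trigonometric polynomial; real and imaginary parts of the
    coordinates separate points.\<close>
  define P where "P g \<longleftrightarrow> continuous_on T g \<and> trig_poly (\<lambda>x. g (p x))" for g
  have "\<exists>g. P g \<and> (\<forall>w\<in>T. \<bar>F w - g w\<bar> < e)"
  proof (rule Stone_Weierstrass_HOL[OF \<open>compact T\<close>])
    fix v w assume vw: "v \<in> T \<and> w \<in> T \<and> v \<noteq> w"
    then obtain k where "v $ k \<noteq> w $ k" by (auto simp: vec_eq_iff)
    have e1: "(\<lambda>x. Re (p x $ k)) = (\<lambda>x. 1 * cos ((axis k (1/L)) \<bullet> x + 0))"
      by (auto simp: p_def inner_axis')
    have e2: "(\<lambda>x. Im (p x $ k)) = (\<lambda>x. 1 * cos ((axis k (1/L)) \<bullet> x + (- pi / 2)))"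
      by (auto simp: p_def inner_axis' cos_diff)
    have "P (\<lambda>w. Re (w $ k))" unfolding P_def e1
      by (intro conjI trig_poly.cos continuous_intros)
    moreover have "P (\<lambda>w. Im (w $ k))" unfolding P_def e2
      by (intro conjI trig_poly.cos continuous_intros)
    ultimately show "\<exists>f. P f \<and> f v \<noteq> f w"
      using \<open>v $ k \<noteq> w $ k\<close> complex_eq_iff by blast
  qed (auto simp: P_def F_cont e trig_poly_const trig_poly.add trig_poly_mult intro!: continuous_intros)
  then obtain g where g: "P g" "\<And>w. w \<in> T \<Longrightarrow> \<bar>F w - g w\<bar> < e" by blast
  have ct01: "0 \<le> ct w" "ct w \<le> 1" for w unfolding ct_def by (auto intro!: prod_nonneg prod_le_1)
  have FB: "\<bar>F w\<bar> \<le> B" for w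
    using mult_mono[OF B[of "\<chi> k. L * Arg (w $ k)"] ct01(2)[of w]] ct01(1)[of w] \<open>B \<ge> 0\<close>
    by (simp add: F_def abs_mult)
  have Fp: "F (p x) = f x" if "norm x \<le> L" for x
  proof -
    have xk: "\<bar>x $ k / L\<bar> \<le> 1" for k
      using component_le_norm_cart[of x k] that L by (auto simp: divide_simps)
    have "Arg (cis (x $ k / L)) = x $ k / L" for k
      using xk[of k] pi_gt3 by (intro Arg_cis_cube) linarith
    moreover have "cos (x $ k / L) \<ge> 0" for k
      using xk[of k] pi_gt3 by (intro cos_ge_zero) linarith+
    ultimately show ?thesis using L by (simp add: F_def ct_def p_def)
  qed
  show ?thesis
  proof
    show "trig_poly (\<lambda>x. g (p x))" using g by (simp add: P_def)
    show "\<bar>g (p x)\<bar> \<le> B + e" for x using g(2)[OF pT[of x]] FB[of "p x"] by linarith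
    show "\<bar>g (p x) - f x\<bar> \<le> e" if "norm x \<le> L" for x
      using g(2)[OF pT[of x]] Fp[OF that] by linarith
  qed
qed

text \<open>Tightness confines all but a small mass to a ball, on which \<open>f\<close> is close to
  a trigonometric polynomial; the global bound on the polynomial controls the rest. Its integrals
  converge as finite sums of the assumed cosine limits.\<close>

lemma conv_in_distr_charI:
  fixes S :: "'i \<Rightarrow> 'a \<Rightarrow> real^'k"
  assumes M: "prob_space M" and \<mu>: "prob_space \<mu>" "sets \<mu> = sets borel"
    and S [measurable]: "\<And>k. S k \<in> borel_measurable M"
    and lim: "\<And>u b. ((\<lambda>k. \<integral>\<omega>. cos (u \<bullet> S k \<omega> + b) \<partial>M) \<longlongrightarrow> (\<integral>x. cos (u \<bullet> x + b) \<partial>\<mu>)) F"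
    and tight: "\<And>\<eta>. \<eta> > 0 \<Longrightarrow> \<exists>L. \<forall>\<^sub>F k in F. measure M {\<omega>\<in>space M. norm (S k \<omega>) > L} \<le> \<eta>"
  shows "conv_in_distr F M S \<mu>"
  unfolding conv_in_distr_def
proof (intro allI impI)
  fix f :: "real^'k \<Rightarrow> real"
  assume "continuous_on UNIV f \<and> bounded (range f)"
  then have f: "continuous_on UNIV f" and "bounded (range f)" by auto
  then obtain B where B: "\<And>x. \<bar>f x\<bar> \<le> B" by (auto simp: bounded_iff)
  have B0: "B \<ge> 0" using B[of 0] by linarith
  have fm [measurable]: "f \<in> borel_measurable borel" using f by (rule borel_measurable_continuous_onI)
  \<comment> \<open>Stated for an arbitrary probability space because it serves twice: for
    \<open>S k\<close> under \<open>M\<close> and for the identity under the limit law.\<close>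
  have key: "\<bar>(\<integral>\<omega>. f (X \<omega>) \<partial>N) - (\<integral>\<omega>. g (X \<omega>) \<partial>N)\<bar> \<le> e + (2 * B + e) * \<eta>"
    if N: "prob_space N" and X [measurable]: "X \<in> borel_measurable N" and "e > 0"
      and g: "trig_poly g" "\<And>x. \<bar>g x\<bar> \<le> B + e" "\<And>x. norm x \<le> L \<Longrightarrow> \<bar>g x - f x\<bar> \<le> e"
      and \<eta>: "measure N {\<omega>\<in>space N. norm (X \<omega>) > L} \<le> \<eta>"
    for N :: "'b measure" and X e g L \<eta>
  proof -
    interpret N: prob_space N by fact
    have [measurable]: "g \<in> borel_measurable borel"
      using continuous_on_trig_poly[OF g(1)] by (rule borel_measurable_continuous_onI)
    have i: "integrable N (\<lambda>\<omega>. f (X \<omega>))" "integrable N (\<lambda>\<omega>. g (X \<omega>))"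
      using B g(2) by (auto intro!: N.integrable_const_bound[where B="B + e"] add_increasing2 less_imp_le[OF \<open>e > 0\<close>])
    let ?A = "{\<omega>\<in>space N. norm (X \<omega>) > L}"
    have [measurable]: "?A \<in> sets N" by measurable
    have "\<bar>(\<integral>\<omega>. f (X \<omega>) \<partial>N) - (\<integral>\<omega>. g (X \<omega>) \<partial>N)\<bar> = \<bar>\<integral>\<omega>. f (X \<omega>) - g (X \<omega>) \<partial>N\<bar>"
      using i by simp
    also have "\<dots> \<le> (\<integral>\<omega>. \<bar>f (X \<omega>) - g (X \<omega>)\<bar> \<partial>N)" by (rule integral_abs_bound)
    also have "\<dots> \<le> (\<integral>\<omega>. e + (2 * B + e) * indicator ?A \<omega> \<partial>N)"
    proof (rule integral_mono)
      fix \<omega> assume "\<omega> \<in> space N"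
      then show "\<bar>f (X \<omega>) - g (X \<omega>)\<bar> \<le> e + (2 * B + e) * indicator ?A \<omega>"
        using B[of "X \<omega>"] g(2)[of "X \<omega>"] g(3)[of "X \<omega>"] \<open>e > 0\<close>
        by (cases "norm (X \<omega>) > L") (auto split: split_indicator)
    qed (use i in \<open>auto simp: N.emeasure_eq_measure\<close>)
    also have "\<dots> = e + (2 * B + e) * measure N ?A" by (simp add: N.prob_space N.emeasure_eq_measure)
    also have "\<dots> \<le> e + (2 * B + e) * \<eta>" using \<eta> B0 \<open>e > 0\<close> by (auto intro!: mult_left_mono)
    finally show ?thesis .
  qed
  interpret M: prob_space M by fact
  interpret \<mu>: prob_space \<mu> by fact
  have id: "(\<lambda>x. x) \<in> borel_measurable \<mu>" unfolding measurable_cong_sets[OF \<mu>(2) refl] by measurable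
  show "((\<lambda>k. \<integral>\<omega>. f (S k \<omega>) \<partial>M) \<longlongrightarrow> (\<integral>x. f x \<partial>\<mu>)) F"
  proof (rule tendstoI)
    fix \<epsilon> :: real assume "\<epsilon> > 0"
    \<comment> \<open>Replacing \<open>f\<close> by \<open>g\<close> costs 2e on either side and the
      convergence for \<open>g\<close> costs e, in all 5e < 8e. The choice of \<eta> turns the tail
      term \<open>(2 * B + e) * \<eta>\<close> into e.\<close>
    define e where "e = \<epsilon> / 8"
    define \<eta> where "\<eta> = e / (2 * B + e)"
    have e: "e > 0" "\<eta> > 0" using \<open>\<epsilon> > 0\<close> B0 by (auto simp: e_def \<eta>_def add_nonneg_pos)
    have e\<eta>: "(2 * B + e) * \<eta> = e" using e B0 by (simp add: \<eta>_def field_simps add_nonneg_eq_0_iff)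
    obtain L1 where L1: "\<forall>\<^sub>F k in F. measure M {\<omega>\<in>space M. norm (S k \<omega>) > L1} \<le> \<eta>"
      using tight[OF e(2)] by auto
    obtain L2 :: nat where L2: "measure \<mu> {x. norm x > real L2} < \<eta>"
    proof -
      have "(\<lambda>n. measure \<mu> {x. norm x > real n}) \<longlonglongrightarrow> measure \<mu> (\<Inter>n. {x. norm x > real n})"
        by (rule \<mu>.finite_Lim_measure_decseq) (auto simp: \<mu>(2) decseq_def intro: order.strict_trans1)
      moreover have "(\<Inter>n. {x::real^'k. norm x > real n}) = {}"
        using reals_Archimedean2 less_asym by fastforce
      ultimately have "(\<lambda>n. measure \<mu> {x. norm x > real n}) \<longlonglongrightarrow> 0" by simp
      from order_tendstoD(2)[OF this e(2)] that show ?thesis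
        by (auto simp: eventually_sequentially)
    qed
    define L where "L = max 1 (max L1 (real L2))"
    have "L > 0" by (simp add: L_def)
    obtain g where g: "trig_poly g" "\<And>x. \<bar>g x\<bar> \<le> B + e" "\<And>x. norm x \<le> L \<Longrightarrow> \<bar>g x - f x\<bar> \<le> e"
      using trig_poly_approx[OF f B \<open>L > 0\<close> e(1)] by blast
    have "measure \<mu> {x\<in>space \<mu>. norm x > L} \<le> measure \<mu> {x. norm x > real L2}"
      by (rule \<mu>.finite_measure_mono) (auto simp: L_def \<mu>(2))
    then have "measure \<mu> {x\<in>space \<mu>. norm x > L} \<le> \<eta>" using L2 by linarith
    then have "\<bar>(\<integral>x. f x \<partial>\<mu>) - (\<integral>x. g x \<partial>\<mu>)\<bar> \<le> e + (2 * B + e) * \<eta>"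
      using g(3) by (intro key[OF \<mu>(1) id e(1) g(1,2), of L]) auto
    then have 1: "\<bar>(\<integral>x. f x \<partial>\<mu>) - (\<integral>x. g x \<partial>\<mu>)\<bar> \<le> 2 * e" unfolding e\<eta> by simp
    have 2: "\<forall>\<^sub>F k in F. \<bar>(\<integral>\<omega>. f (S k \<omega>) \<partial>M) - (\<integral>\<omega>. g (S k \<omega>) \<partial>M)\<bar> \<le> 2 * e"
      using L1
    proof eventually_elim
      case (elim k)
      have "measure M {\<omega>\<in>space M. norm (S k \<omega>) > L} \<le> measure M {\<omega>\<in>space M. norm (S k \<omega>) > L1}"
        by (rule M.finite_measure_mono) (auto simp: L_def)
      then have "measure M {\<omega>\<in>space M. norm (S k \<omega>) > L} \<le> \<eta>" using elim by linarith
      then have "\<bar>(\<integral>\<omega>. f (S k \<omega>) \<partial>M) - (\<integral>\<omega>. g (S k \<omega>) \<partial>M)\<bar> \<le> e + (2 * B + e) * \<eta>"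
        using g(3) by (intro key[OF M S e(1) g(1,2), of L]) auto
      then show ?case unfolding e\<eta> by simp
    qed
    have "((\<lambda>k. \<integral>\<omega>. g (S k \<omega>) \<partial>M) \<longlongrightarrow> (\<integral>x. g x \<partial>\<mu>)) F"
      using tendsto_integral_trig_poly[OF M \<mu> S lim g(1)] by blast
    from tendstoD[OF this e(1)] 2
    show "\<forall>\<^sub>F k in F. dist (\<integral>\<omega>. f (S k \<omega>) \<partial>M) (\<integral>x. f x \<partial>\<mu>) < \<epsilon>"
    proof eventually_elim
      case (elim k)
      then show ?case using 1 e(1) unfolding dist_real_def e_def by linarith
    qed
  qed
qed

subsection \<open>Multivariate normal laws\<close>

lemma inner_matrix_sum: "(u::real^'k) \<bullet> (V *v w) = (\<Sum>a\<in>UNIV. \<Sum>b\<in>UNIV. V$a$b * (u$a * w$b))"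
  by (simp add: inner_vec_def matrix_vector_mult_def sum_distrib_left mult_ac)

lemma symmetric_inner: "transpose V = V \<Longrightarrow> u \<bullet> (V *v w) = w \<bullet> (V *v (u::real^'k))"
  by (metis dot_lmul_matrix inner_commute matrix_transpose_mul transpose_matrix_vector)

lemma posdef_invertible:
  fixes V :: "real^'k^'k"
  assumes "\<And>v. v \<noteq> 0 \<Longrightarrow> v \<bullet> (V *v v) > 0"
  shows "invertible V"
proof -
  have "\<forall>x. V *v x = 0 \<longrightarrow> x = 0" using assms by (metis inner_zero_right less_irrefl)
  then show ?thesis using invertible_left_inverse matrix_left_invertible_ker by blast
qed

lemma matrix_inv_mul:
  fixes V :: "real^'k^'k" assumes "invertible V"
  shows "V ** matrix_inv V = mat 1" "matrix_inv V ** V = mat 1"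
  using assms unfolding invertible_def matrix_inv_def by (metis (mono_tags, lifting) someI_ex)+

text \<open>A \<open>V\<close>-orthonormal family of maximal size is a basis; its matrix inverts to the square root.\<close>
lemma posdef_factor:
  fixes V :: "real^'k^'k"
  assumes sym: "transpose V = V" and pos: "\<And>v. v \<noteq> 0 \<Longrightarrow> v \<bullet> (V *v v) > 0"
  obtains A :: "real^'k^'k" where "invertible A" "V = A ** transpose A"
proof -
  let ?i = "\<lambda>u v. u \<bullet> (V *v v)"
  define ON where "ON B \<longleftrightarrow> finite B \<and> (\<forall>b\<in>B. \<forall>c\<in>B. ?i b c = (if b = c then 1 else 0))" for B
  have expand: "?i c (\<Sum>b\<in>B. f b *\<^sub>R b) = f c" if "ON B" "c \<in> B" for B c f
  proof -
    have "?i c (\<Sum>b\<in>B. f b *\<^sub>R b) = (\<Sum>b\<in>B. f b * ?i c b)"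
      by (simp add: linear_sum[OF matrix_vector_mul_linear] inner_sum_right matrix_vector_mult_scaleR)
    also have "\<dots> = (\<Sum>b\<in>B. if c = b then f b else 0)"
      using that by (intro sum.cong) (auto simp: ON_def)
    finally show ?thesis using that by (simp add: ON_def)
  qed
  have indep: "independent B" if "ON B" for B
    unfolding independent_explicit
  proof (intro conjI allI impI ballI)
    show "finite B" using that by (simp add: ON_def)
    fix f b assume "(\<Sum>v\<in>B. f v *\<^sub>R v) = 0" "b \<in> B"
    then show "f b = 0" using expand[OF that, of b f] by simp
  qed
  have card_le: "card B \<le> CARD('k)" if "ON B" for B
    using independent_bound[OF indep[OF that]] by simp
  have "\<exists>B. ON B \<and> (\<forall>B'. ON B' \<longrightarrow> card B' \<le> card B)"
    by (rule ex_has_greatest_nat[of ON "{}" card "CARD('k) + 1"]) (auto simp: less_Suc_eq_le card_le, simp add: ON_def)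
  then obtain B where B: "ON B" and max: "\<And>B'. ON B' \<Longrightarrow> card B' \<le> card B" by blast
  have finB: "finite B" using B by (simp add: ON_def)
  have "span B = UNIV"
  proof (rule ccontr)
    assume "span B \<noteq> UNIV"
    then obtain w where w: "w \<notin> span B" by auto
    \<comment> \<open>One Gram-Schmidt step: a vector outside the span would enlarge the
      \<open>V\<close>-orthonormal family, against maximality.\<close>
    define w' where "w' = w - (\<Sum>b\<in>B. ?i b w *\<^sub>R b)"
    have "w' \<noteq> 0"
    proof
      assume "w' = 0"
      then have "w = (\<Sum>b\<in>B. ?i b w *\<^sub>R b)" by (simp add: w'_def)
      moreover have "(\<Sum>b\<in>B. ?i b w *\<^sub>R b) \<in> span B" by (intro span_sum span_scale span_base)
      ultimately show False using w by simp
    qed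
    define q where "q = sqrt (?i w' w')"
    have q: "q > 0" "q * q = ?i w' w'" using pos[OF \<open>w' \<noteq> 0\<close>] by (auto simp: q_def)
    define v where "v = (1/q) *\<^sub>R w'"
    have ow: "?i b w' = 0" if "b \<in> B" for b
      using expand[OF B that, of "\<lambda>b. ?i b w"]
      by (simp add: w'_def matrix_vector_mult_diff_distrib inner_diff_right)
    have ov: "?i b v = 0" "?i v b = 0" if "b \<in> B" for b
      using ow[OF that] symmetric_inner[OF sym, of v b] by (simp_all add: v_def matrix_vector_mult_scaleR)
    have "?i v v = ?i w' w' / (q * q)" by (simp add: v_def matrix_vector_mult_scaleR)
    then have vv: "?i v v = 1" using q pos[OF \<open>w' \<noteq> 0\<close>] by simp
    have "v \<notin> B" using ov(1)[of v] vv by auto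
    moreover have "ON (insert v B)" using B ov vv by (auto simp: ON_def)
    ultimately show False using max[of "insert v B"] finB by simp
  qed
  then have "card B = CARD('k)"
    using dim_unique[of B UNIV "card B"] indep[OF B] by simp
  then obtain p where p: "bij_betw p (UNIV::'k set) B" using finB finite_same_card_bij by (metis finite)
  define P :: "real^'k^'k" where "P = (\<chi> i j. p j $ i)"
  have ent: "(transpose P ** (V ** P)) $ i $ j = ?i (p i) (p j)" for i j
    by (simp add: P_def matrix_matrix_mult_def transpose_def inner_vec_def matrix_vector_mult_def)
  have "p i \<in> B" for i using p by (auto simp: bij_betw_def)
  moreover have "p i = p j \<longleftrightarrow> i = j" for i j using p by (auto simp: bij_betw_def inj_on_def)
  ultimately have PVP: "transpose P ** (V ** P) = mat 1"
    using B by (auto simp: vec_eq_iff ent ON_def mat_def)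
  \<comment> \<open>\<open>Q\<close> is the two-sided inverse of A = V P, where the basis vectors
    are the columns of \<open>P\<close>. So A A^T = (V P) Q V = V.\<close>
  define Q where "Q = transpose P"
  have QVP: "Q ** (V ** P) = mat 1" "(V ** P) ** Q = mat 1"
    using PVP matrix_left_right_inverse Q_def by auto
  define A where "A = V ** P"
  have "invertible A" using QVP unfolding invertible_def A_def by blast
  moreover have "A ** transpose A = V"
  proof -
    have "transpose A = Q ** V" by (simp add: A_def Q_def matrix_transpose_mul sym)
    then have "A ** transpose A = ((V ** P) ** Q) ** V" by (simp add: A_def matrix_mul_assoc)
    then show ?thesis using QVP by simp
  qed
  ultimately show ?thesis using that by metis
qed

section \<open>Linear change of variables for Lebesgue measure\<close>

lemma borel_measurable_matrix_vector_mult [measurable]: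
  "(*v) (A::real^'k^'k) \<in> borel_measurable borel"
  by (intro borel_measurable_continuous_onI matrix_vector_mult_linear_continuous_on)

text \<open>The library proves this only for well-ordered index types.\<close>
lemma measure_lebesgue_linear_image:
  fixes f :: "real^'k \<Rightarrow> real^'k"
  assumes f: "linear f" and S: "S \<in> lmeasurable"
  shows "f ` S \<in> lmeasurable \<and> measure lebesgue (f ` S) = \<bar>det (matrix f)\<bar> * measure lebesgue S"
proof -
  define Q where "Q f \<longleftrightarrow> (\<forall>S\<in>lmeasurable. f ` S \<in> lmeasurable
    \<and> measure lebesgue (f ` S) = \<bar>det (matrix f)\<bar> * measure lebesgue S)" for f :: "real^'k \<Rightarrow> real^'k"
  \<comment> \<open>Swaps and shears have determinant of modulus 1, so it is enough that they
    preserve the volume of boxes.\<close>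
  have unimodular: "Q h" if "linear h" "\<bar>det (matrix h)\<bar> = 1"
    "\<And>a b. cbox a b \<noteq> {} \<Longrightarrow> measure lebesgue (h ` cbox a b) = measure lebesgue (cbox a b)" for h
    unfolding Q_def
  proof
    fix S :: "(real^'k) set" assume S: "S \<in> lmeasurable"
    have "measure lebesgue (h ` cbox a b) = 1 * measure lebesgue (cbox a b)" for a b
      using that(3)[of a b] by (cases "cbox a b = {}") auto
    from measure_linear_sufficient[OF that(1) S this]
    show "h ` S \<in> lmeasurable \<and> measure lebesgue (h ` S) = \<bar>det (matrix h)\<bar> * measure lebesgue S"
      using that(2) by simp
  qed
  have "Q f"
    using f
  proof (rule induct_linear_elementary)
    fix f g :: "real^'k \<Rightarrow> real^'k" assume "linear f" "linear g" "Q f" "Q g"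
    moreover have "(f \<circ> g) ` S = f ` (g ` S)" for S by (simp add: image_comp)
    ultimately show "Q (f \<circ> g)"
      unfolding Q_def by (simp add: matrix_compose det_mul abs_mult)
  next
    fix f :: "real^'k \<Rightarrow> real^'k" and i assume f: "linear f" "\<And>x. f x $ i = 0"
    have "\<not> inj f"
      using f linear_injective_imp_surjective by (metis one_neq_zero surjE vec_component)
    then have "det (matrix f) = 0" "\<And>S. negligible (f ` S)"
      using det_nz_iff_inj[OF f(1)] negligible_linear_singular_image[OF f(1)] by auto
    then show "Q f" by (auto simp: Q_def negligible_iff_measure)
  next
    fix c :: "'k \<Rightarrow> real"
    have "matrix (\<lambda>x. \<chi> i. c i * x $ i) = (\<chi> i j. if i = j then c i else 0)"
      by (auto simp: matrix_def axis_def vec_eq_iff)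
    then have "det (matrix (\<lambda>x. \<chi> i. c i * x $ i)) = (\<Prod>i\<in>UNIV. c i)"
      by (simp add: det_diagonal)
    then show "Q (\<lambda>x. \<chi> i. c i * x $ i)"
      by (simp add: Q_def measurable_stretch measure_stretch)
  next
    fix m n :: 'k assume "m \<noteq> n"
    let ?t = "Transposition.transpose m n"
    let ?h = "\<lambda>x::real^'k. \<chi> i. x $ ?t i"
    have t: "?t (?t i) = i" for i by simp
    show "Q ?h"
    proof (rule unimodular)
      show "linear ?h" by (rule linearI) (simp_all add: vec_eq_iff)
      have "matrix ?h = (\<chi> i. mat 1 $ ?t i)"
        by (auto simp: matrix_def axis_def vec_eq_iff mat_def)
      then show "\<bar>det (matrix ?h)\<bar> = 1"
        by (simp add: det_permute_rows permutes_swap_id sign_swap_id abs_mult)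
      fix a b :: "real^'k" assume "cbox a b \<noteq> {}"
      then have ab: "\<not> b $ i < a $ i" for i by (simp add: interval_ne_empty_cart not_less)
      have "?h ` cbox a b = cbox (?h a) (?h b)"
      proof (intro equalityI subsetI)
        fix y assume "y \<in> cbox (?h a) (?h b)"
        then have y: "a $ ?t i \<le> y $ i \<and> y $ i \<le> b $ ?t i" for i by (simp add: mem_box_cart)
        have "?h y \<in> cbox a b" using y[of "?t i" for i] by (simp add: mem_box_cart)
        moreover have "y = ?h (?h y)" by (simp add: vec_eq_iff)
        ultimately show "y \<in> ?h ` cbox a b" by blast
      qed (auto simp: mem_box_cart)
      moreover have "(\<Prod>i\<in>UNIV. b $ ?t i - a $ ?t i) = (\<Prod>i\<in>UNIV. b $ i - a $ i)"
        by (rule prod.reindex_bij_betw) simp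
      ultimately show "measure lebesgue (?h ` cbox a b) = measure lebesgue (cbox a b)"
        using ab by (simp add: content_cbox_if_cart interval_eq_empty_cart)
    qed
  next
    fix m n :: 'k assume mn: "m \<noteq> n"
    let ?h = "\<lambda>x::real^'k. \<chi> i. if i = m then x $ m + x $ n else x $ i"
    have lin: "linear ?h" by (rule linearI) (simp_all add: vec_eq_iff algebra_simps)
    show "Q ?h"
    proof (rule unimodular)
      have "matrix ?h = (\<chi> k. if k = m then row m (mat 1) + 1 *s row n (mat 1) else row k (mat 1))"
        by (auto simp: matrix_def axis_def vec_eq_iff mat_def row_def)
      then show "\<bar>det (matrix ?h)\<bar> = 1"
        by (simp add: det_row_operation[OF mn] del: mult_1 vector_smult_lid)
      fix a b :: "real^'k" assume ab: "cbox a b \<noteq> {}"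
      \<comment> \<open>The shear formula wants a box whose lower edge in coordinate
        \<open>n\<close> is nonnegative. Translating that edge to 0 changes neither volume.\<close>
      define v :: "real^'k" where "v = axis n (- a $ n)"
      have ne: "cbox (v + a) (v + b) \<noteq> {}" "(v + a) $ n = 0"
        using ab by (auto simp: interval_ne_empty_cart v_def axis_def)
      have "?h ` (+) v ` cbox a b = (+) (?h v) ` ?h ` cbox a b"
        unfolding image_image using linear_add[OF lin] by (intro image_cong) auto
      then have "measure lebesgue (?h ` cbox a b) = measure lebesgue (?h ` (+) v ` cbox a b)"
        by (simp only: measure_translation)
      also have "\<dots> = measure lebesgue ((+) v ` cbox a b)"
        using measure_shear_interval[OF mn ne(1)] ne(2) by (simp add: cbox_translation)
      also have "\<dots> = measure lebesgue (cbox a b)" by (rule measure_translation)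
      finally show "measure lebesgue (?h ` cbox a b) = measure lebesgue (cbox a b)" .
    qed (fact lin)
  qed
  then show ?thesis using S by (simp add: Q_def)
qed

text \<open>It suffices to compare boxes: the preimage of a box under \<open>A\<close> is its image
  under the inverse matrix, whose determinant cancels the density.\<close>

lemma lborel_linear_image:
  fixes A :: "real^'k^'k"
  assumes A: "invertible A"
  shows "lborel = density (distr lborel borel ((*v) A)) (\<lambda>_. ennreal \<bar>det A\<bar>)"
proof (rule lborel_eqI)
  fix l u :: "real^'k" assume lu: "\<And>b. b \<in> Basis \<Longrightarrow> l \<bullet> b \<le> u \<bullet> b"
  obtain A' where A': "A ** A' = mat 1" "A' ** A = mat 1" using A unfolding invertible_def by auto
  have inv: "A *v (A' *v x) = x" "A' *v (A *v x) = x" for x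
    by (simp_all add: matrix_vector_mul_assoc A')
  have dd: "\<bar>det A\<bar> * \<bar>det A'\<bar> = 1" using A'(1) by (metis abs_1 abs_mult det_I det_mul)
  have vi: "(*v) A -` box l u = (*v) A' ` box l u"
    using inv by (auto simp: image_iff) metis+
  have meas: "(*v) A' ` box l u \<in> lmeasurable" "measure lebesgue ((*v) A' ` box l u) = \<bar>det A'\<bar> * measure lebesgue (box l u)"
    using measure_lebesgue_linear_image[of "(*v) A'" "box l u"] by auto
  have b: "(*v) A -` box l u \<in> sets borel"
    using measurable_sets[OF borel_measurable_matrix_vector_mult[of A], of "box l u"] by simp
  have "emeasure (density (distr lborel borel ((*v) A)) (\<lambda>_. ennreal \<bar>det A\<bar>)) (box l u)
      = ennreal \<bar>det A\<bar> * emeasure lborel ((*v) A -` box l u)"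
    by (subst emeasure_density) (auto simp: nn_integral_cmult emeasure_distr)
  also have "emeasure lborel ((*v) A -` box l u) = emeasure lebesgue ((*v) A' ` box l u)"
    using b vi by simp
  also have "\<dots> = ennreal (\<bar>det A'\<bar> * measure lborel (box l u))"
    using meas by (simp add: emeasure_eq_measure2)
  also have "ennreal \<bar>det A\<bar> * \<dots> = ennreal (measure lborel (box l u))"
    using dd by (simp add: ennreal_mult'[symmetric] mult.assoc[symmetric])
  finally show "emeasure (density (distr lborel borel ((*v) A)) (\<lambda>_. ennreal \<bar>det A\<bar>)) (box l u)
     = ennreal (\<Prod>b\<in>Basis. (u - l) \<bullet> b)"
    using lu by (simp add: measure_lborel_box_eq)
qed simp

text \<open>By construction \<open>lborel\<close> is the image of a product of real Lebesgue
  measures indexed by \<open>Basis\<close>, so functions that factor over coordinates reduce to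
  Fubini for finite products.\<close>

lemma integral_lborel_prod:
  fixes f :: "'a::euclidean_space \<Rightarrow> real \<Rightarrow> complex"
  assumes f: "\<And>b. b \<in> Basis \<Longrightarrow> integrable lborel (f b)"
  shows "(\<integral>x. (\<Prod>b\<in>Basis. f b (x \<bullet> b)) \<partial>lborel) = (\<Prod>b\<in>Basis. \<integral>t. f b t \<partial>lborel)"
    and "integrable lborel (\<lambda>x::'a. \<Prod>b\<in>Basis. f b (x \<bullet> b))"
proof -
  interpret product_sigma_finite "\<lambda>b::'a. lborel::real measure"
    by (simp add: lborel.sigma_finite_measure_axioms product_sigma_finite_def)
  have m: "(\<lambda>x::'a. \<Prod>b\<in>Basis. f b (x \<bullet> b)) \<in> borel_measurable borel"
    using f by (intro borel_measurable_prod) (auto dest!: borel_measurable_integrable)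
  have lb: "(lborel::'a measure) = distr (\<Pi>\<^sub>M b\<in>Basis. lborel) borel (\<lambda>f. \<Sum>b\<in>Basis. f b *\<^sub>R b)"
    unfolding lborel_eq_real by (rule lborel_def)
  have m2: "(\<lambda>x::'a\<Rightarrow>real. \<Sum>b\<in>Basis. x b *\<^sub>R b) \<in> measurable (\<Pi>\<^sub>M b\<in>Basis. lborel) borel"
    by measurable
  have e: "(\<Prod>b\<in>Basis. f b ((\<Sum>c\<in>Basis. x c *\<^sub>R c) \<bullet> b)) = (\<Prod>b\<in>Basis. f b (x b))" for x
    by (intro prod.cong) (auto simp: inner_sum_left inner_Basis if_distrib sum.delta cong: if_cong)
  show "(\<integral>x. (\<Prod>b\<in>Basis. f b (x \<bullet> b)) \<partial>lborel) = (\<Prod>b\<in>Basis. \<integral>t. f b t \<partial>lborel)"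
    unfolding lb
    by (subst integral_distr[OF m2 m]) (simp add: e product_integral_prod[OF finite_Basis f])
  show "integrable lborel (\<lambda>x::'a. \<Prod>b\<in>Basis. f b (x \<bullet> b))"
    unfolding lb
    by (subst integrable_distr_eq[OF m2 m]) (simp add: e product_integrable_prod[OF finite_Basis f])
qed

text \<open>Both the Gaussian density and the character factor over coordinates, which leaves the
  one-dimensional characteristic function of the standard normal.\<close>

lemma std_normal_cf_real_vec:
  fixes w :: "real^'k"
  shows "(\<integral>y. of_real (exp (- (y \<bullet> y) / 2) / sqrt ((2 * pi) ^ CARD('k))) * iexp (w \<bullet> y) \<partial>lborel)
      = of_real (exp (- (w \<bullet> w) / 2))" (is ?eq)
    and "integrable lborel (\<lambda>y. of_real (exp (- (y \<bullet> y) / 2) / sqrt ((2 * pi) ^ CARD('k))) * iexp (w \<bullet> y))" (is ?int)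
proof -
  define f where "f b t = complex_of_real (std_normal_density t) * iexp ((w \<bullet> b) * t)" for b t
  have f: "integrable lborel (f b)" for b
  proof -
    have "integrable lborel (\<lambda>t. std_normal_density t)"
      by (simp add: integrable_normal_density)
    then show ?thesis unfolding f_def
      by (rule Bochner_Integration.integrable_bound) (auto simp: norm_mult)
  qed
  have If: "(\<integral>t. f b t \<partial>lborel) = of_real (exp (- (w \<bullet> b)\<^sup>2 / 2))" for b
  proof -
    have "char std_normal_distribution (w \<bullet> b) = (\<integral>t. f b t \<partial>lborel)"
      unfolding char_def f_def by (subst integral_density) (auto simp: scaleR_conv_of_real normal_density_nonneg)
    then show ?thesis by (simp add: char_std_normal_distribution)
  qed
  have prod: "(\<Prod>b\<in>Basis. f b (y \<bullet> b))
     = of_real (exp (- (y \<bullet> y) / 2) / sqrt ((2 * pi) ^ CARD('k))) * iexp (w \<bullet> y)" for y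
  proof -
    have "(\<Prod>b\<in>(Basis::(real^'k) set). std_normal_density (y \<bullet> b)) = (\<Prod>b\<in>(Basis::(real^'k) set). 1 / sqrt (2 * pi)) * exp (\<Sum>b\<in>Basis. - (y \<bullet> b)\<^sup>2 / 2)"
      by (simp add: std_normal_density_def exp_sum prod.distrib prod_dividef power_one_over)
    also have "(\<Sum>b\<in>Basis. - (y \<bullet> b)\<^sup>2 / 2) = - (y \<bullet> y) / 2"
      by (subst euclidean_inner[of y y]) (simp add: power2_eq_square sum_negf sum_divide_distrib)
    also have "(\<Prod>b\<in>(Basis::(real^'k) set). 1 / sqrt (2 * pi)) = (1 / sqrt (2 * pi)) ^ CARD('k)"
      by simp
    also have "\<dots> = 1 / sqrt ((2 * pi) ^ CARD('k))"
      by (simp only: power_one_over real_sqrt_power)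
    finally have 1: "(\<Prod>b\<in>(Basis::(real^'k) set). std_normal_density (y \<bullet> b)) = exp (- (y \<bullet> y) / 2) / sqrt ((2 * pi) ^ CARD('k))" by simp
    have 2: "(\<Prod>b\<in>Basis. iexp ((w \<bullet> b) * (y \<bullet> b))) = iexp (w \<bullet> y)"
      by (subst euclidean_inner[of w y]) (simp add: exp_sum sum_distrib_left flip: of_real_mult)
    show ?thesis unfolding f_def prod.distrib 2 of_real_prod[symmetric] 1 ..
  qed
  show ?int using integral_lborel_prod(2)[of f] f by (simp only: prod)
  have "(\<Prod>b\<in>Basis. complex_of_real (exp (- (w \<bullet> b)\<^sup>2 / 2))) = of_real (exp (\<Sum>b\<in>Basis. - (w \<bullet> b)\<^sup>2 / 2))"
    by (simp add: exp_sum flip: of_real_prod)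
  also have "(\<Sum>b\<in>Basis. - (w \<bullet> b)\<^sup>2 / 2) = - (w \<bullet> w) / 2"
    by (subst euclidean_inner[of w w]) (simp add: power2_eq_square sum_negf sum_divide_distrib)
  finally show ?eq using integral_lborel_prod(1)[of f] f by (simp only: prod If)
qed

text \<open>Substituting x = A y with V = A A^T turns the exponent into y . y and cancels
  \<open>det V\<close> against the Jacobian. A cosine with phase \<open>b\<close> is the real part
  of e^(ib) times the character.\<close>

lemma mvnormal_cos:
  fixes V :: "real^'k^'k"
  assumes sym: "transpose V = V" and pos: "\<And>v. v \<noteq> 0 \<Longrightarrow> v \<bullet> (V *v v) > 0"
  shows "(\<integral>x. cos (u \<bullet> x + b) \<partial>mvnormal V) = cos b * exp (- (u \<bullet> (V *v u)) / 2)"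
proof -
  obtain A :: "real^'k^'k" where A: "invertible A" and VA: "V = A ** transpose A"
    by (rule posdef_factor[OF sym]) (blast intro: pos)+
  have dA: "det A \<noteq> 0" using A by (simp add: invertible_det_nz)
  have dV: "det V = (det A)\<^sup>2" by (simp add: VA det_mul det_transpose power2_eq_square)
  have q: "(A *v y) \<bullet> (matrix_inv V *v (A *v y)) = y \<bullet> y" for y
  proof -
    have V: "invertible V" using pos by (rule posdef_invertible)
    obtain A' where A': "A ** A' = mat 1" "A' ** A = mat 1" using A unfolding invertible_def by auto
    define w where "w = transpose A' *v y"
    have At: "transpose A *v w = y"
      unfolding w_def matrix_vector_mul_assoc matrix_transpose_mul[symmetric] A'(2)
      by (simp add: transpose_mat)
    have "V *v w = A *v y" unfolding VA matrix_vector_mul_assoc[symmetric] At ..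
    then have "matrix_inv V *v (A *v y) = w"
      by (metis V matrix_inv_mul(2) matrix_vector_mul_assoc matrix_vector_mul_lid)
    then have "(A *v y) \<bullet> (matrix_inv V *v (A *v y)) = y \<bullet> (transpose A *v w)"
      by (simp add: dot_lmul_matrix[symmetric] transpose_matrix_vector inner_commute)
    then show ?thesis by (simp only: At)
  qed
  define d where "d x = exp (- (x \<bullet> (matrix_inv V *v x)) / 2) / sqrt ((2 * pi) ^ CARD('k) * det V)" for x
  define sd where "sd y = exp (- (y \<bullet> y) / 2) / sqrt ((2 * pi) ^ CARD('k))" for y :: "real^'k"
  have dm [measurable]: "d \<in> borel_measurable borel" unfolding d_def
    by measurable
  have d0: "d x \<ge> 0" for x by (simp add: d_def dV)
  have dsd: "\<bar>det A\<bar> * d (A *v y) = sd y" for y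
    using dA by (simp add: d_def sd_def q dV real_sqrt_mult)
  define w where "w = transpose A *v u"
  have uw: "u \<bullet> (A *v y) = w \<bullet> y" for y
    by (simp add: w_def dot_lmul_matrix transpose_matrix_vector)
  have ww: "w \<bullet> w = u \<bullet> (V *v u)" 
    unfolding VA by (simp add: uw w_def flip: matrix_vector_mul_assoc)
  have sdi: "integrable lborel (\<lambda>y. of_real (sd y) * iexp (w \<bullet> y))"
    unfolding sd_def by (rule std_normal_cf_real_vec(2))
  have "(\<integral>x. cos (u \<bullet> x + b) \<partial>mvnormal V) = (\<integral>x. d x * cos (u \<bullet> x + b) \<partial>lborel)"
    unfolding mvnormal_def d_def[symmetric] by (subst integral_density) (auto simp: d0)
  also have "\<dots> = (\<integral>y. \<bar>det A\<bar> * (d (A *v y) * cos (u \<bullet> (A *v y) + b)) \<partial>lborel)"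
    by (subst lborel_linear_image[OF A]) (simp add: integral_density integral_distr)
  also have "\<dots> = (\<integral>y. sd y * cos (w \<bullet> y + b) \<partial>lborel)"
    by (simp add: dsd uw flip: mult.assoc)
  also have "\<dots> = (\<integral>y. Re (iexp b * (of_real (sd y) * iexp (w \<bullet> y))) \<partial>lborel)"
    by (intro Bochner_Integration.integral_cong) (auto simp: Re_exp Im_exp cos_add algebra_simps)
  also have "\<dots> = Re (iexp b * (\<integral>y. of_real (sd y) * iexp (w \<bullet> y) \<partial>lborel))"
    using sdi by (subst integral_Re) simp_all
  also have "\<dots> = cos b * exp (- (w \<bullet> w) / 2)"
    unfolding sd_def std_normal_cf_real_vec(1) by (simp add: Re_exp)
  finally show ?thesis by (simp add: ww)
qed

text \<open>The total mass is the cosine integral at zero frequency and zero phase.\<close>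

lemma prob_space_mvnormal:
  fixes V :: "real^'k^'k"
  assumes sym: "transpose V = V" and pos: "\<And>v. v \<noteq> 0 \<Longrightarrow> v \<bullet> (V *v v) > 0"
  shows "prob_space (mvnormal V)"
proof
  have "measure (mvnormal V) (space (mvnormal V)) = 1"
    using mvnormal_cos[OF assms, of 0 0] by simp
  \<comment> \<open>\<open>measure\<close> returns 0 for infinite mass, so the value 1 also shows
    finiteness.\<close>
  then show "emeasure (mvnormal V) (space (mvnormal V)) = 1"
    by (metis emeasure_eq_ennreal_measure ennreal_1 measure_def enn2real_top zero_neq_one)
qed

subsection \<open>Covariances of strongly mixing variables\<close>

text \<open>The strong mixing coefficient between the sigma-algebras generated by two real variables
  is at most \<alpha>. Working with preimages of Borel sets lets truncations pass through by
  composition.\<close>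

definition mix_bound :: "'a measure \<Rightarrow> real \<Rightarrow> ('a \<Rightarrow> real) \<Rightarrow> ('a \<Rightarrow> real) \<Rightarrow> bool" where
  "mix_bound M \<alpha> X Y \<longleftrightarrow> (\<forall>A\<in>sets borel. \<forall>B\<in>sets borel.
     \<bar>measure M ((X -` A \<inter> space M) \<inter> (Y -` B \<inter> space M))
       - measure M (X -` A \<inter> space M) * measure M (Y -` B \<inter> space M)\<bar> \<le> \<alpha>)"

lemma mix_bound_compose:
  assumes "mix_bound M \<alpha> X Y" and f: "f \<in> borel_measurable borel" and g: "g \<in> borel_measurable borel"
  shows "mix_bound M \<alpha> (\<lambda>\<omega>. f (X \<omega>)) (\<lambda>\<omega>. g (Y \<omega>))"
  unfolding mix_bound_def
proof (intro ballI)
  fix A B :: "real set" assume AB: "A \<in> sets borel" "B \<in> sets borel"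
  have e: "(\<lambda>\<omega>. f (X \<omega>)) -` A = X -` (f -` A)" "(\<lambda>\<omega>. g (Y \<omega>)) -` B = Y -` (g -` B)" by auto
  have "f -` A \<in> sets borel" "g -` B \<in> sets borel"
    using measurable_sets[OF f AB(1)] measurable_sets[OF g AB(2)] by auto
  then show "\<bar>measure M (((\<lambda>\<omega>. f (X \<omega>)) -` A \<inter> space M) \<inter> ((\<lambda>\<omega>. g (Y \<omega>)) -` B \<inter> space M))
       - measure M ((\<lambda>\<omega>. f (X \<omega>)) -` A \<inter> space M) * measure M ((\<lambda>\<omega>. g (Y \<omega>)) -` B \<inter> space M)\<bar> \<le> \<alpha>"
    using assms(1) unfolding e mix_bound_def by blast
qed

context prob_space
begin

text \<open>A variable with values in [0, 1] is within 1/N of the average of \<open>N\<close>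
  indicators of its level sets. The covariance of two such averages is the mean of N^2 differences
  of the kind bounded by the mixing hypothesis. Then N tends to infinity.\<close>

lemma cov_le_mix_unit:
  assumes [measurable]: "X \<in> borel_measurable M" "Y \<in> borel_measurable M"
    and X: "\<And>\<omega>. 0 \<le> X \<omega> \<and> X \<omega> \<le> 1" and Y: "\<And>\<omega>. 0 \<le> Y \<omega> \<and> Y \<omega> \<le> 1"
    and mix: "mix_bound M \<alpha> X Y"
  shows "\<bar>expectation (\<lambda>\<omega>. X \<omega> * Y \<omega>) - expectation X * expectation Y\<bar> \<le> \<alpha>"
proof -
  define U where "U N Z \<omega> = (\<Sum>j\<in>{1..N}. indicator ({real j / real N..}) (Z \<omega>)) / real N"
    for N :: nat and Z :: "'a \<Rightarrow> real" and \<omega>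
  have U: "0 \<le> U N Z \<omega> \<and> U N Z \<omega> \<le> 1 \<and> \<bar>Z \<omega> - U N Z \<omega>\<bar> \<le> 1 / real N"
    if "N \<ge> 1" "0 \<le> Z \<omega> \<and> Z \<omega> \<le> 1" for N Z \<omega>
  proof -
    define k where "k = nat \<lfloor>real N * Z \<omega>\<rfloor>"
    have Nz: "0 \<le> real N * Z \<omega>" "real N * Z \<omega> \<le> real N"
      using that by (auto simp: mult_left_le)
    have "(\<Sum>j\<in>{1..N}. indicator {real j / real N..} (Z \<omega>)) = real (card {j\<in>{1..N}. real j / real N \<le> Z \<omega>})"
      by (simp add: indicator_def sum.If_cases Int_def)
    also have "{j\<in>{1..N}. real j / real N \<le> Z \<omega>} = {1..k}"
    proof -
      have iff: "real j / real N \<le> Z \<omega> \<longleftrightarrow> j \<le> k" for j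
      proof -
        have "real j / real N \<le> Z \<omega> \<longleftrightarrow> real j \<le> real N * Z \<omega>"
          using that by (simp add: divide_simps mult.commute)
        also have "\<dots> \<longleftrightarrow> j \<le> k" using Nz unfolding k_def by (simp add: le_nat_floor le_floor_iff nat_le_iff le_nat_iff)
        finally show ?thesis .
      qed
      have "k \<le> N" using Nz unfolding k_def by (simp add: nat_le_iff floor_le_iff)
      then have "{1..k} = {j\<in>{1..N}. j \<le> k}" by auto
      then show ?thesis by (simp only: iff)
    qed
    finally have u: "U N Z \<omega> = real k / real N" by (simp add: U_def)
    have kk: "real k \<le> real N * Z \<omega>" "real N * Z \<omega> < real k + 1"
      using Nz unfolding k_def by linarith+
    have "\<bar>Z \<omega> - real k / real N\<bar> = \<bar>real N * Z \<omega> - real k\<bar> / real N"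
      using that by (simp add: field_simps)
    also have "\<dots> \<le> 1 / real N" using kk by (intro divide_right_mono) auto
    finally have "\<bar>Z \<omega> - real k / real N\<bar> \<le> 1 / real N" .
    moreover have "real k \<le> real N" using kk Nz by linarith
    ultimately show ?thesis unfolding u using that(1) by simp
  qed
  have main: "\<bar>expectation (\<lambda>\<omega>. X \<omega> * Y \<omega>) - expectation X * expectation Y\<bar> \<le> \<alpha> + 4 / real N"
    if N: "N \<ge> 1" for N
  proof -
    have [measurable]: "U N X \<in> borel_measurable M" "U N Y \<in> borel_measurable M"
      unfolding U_def by measurable
    have UX: "0 \<le> U N X \<omega> \<and> U N X \<omega> \<le> 1 \<and> \<bar>X \<omega> - U N X \<omega>\<bar> \<le> 1 / real N" for \<omega>
      using N X by (rule U)
    have UY: "0 \<le> U N Y \<omega> \<and> U N Y \<omega> \<le> 1 \<and> \<bar>Y \<omega> - U N Y \<omega>\<bar> \<le> 1 / real N" for \<omega>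
      using N Y by (rule U)
    have int01: "integrable M f" if "f \<in> borel_measurable M" "\<And>\<omega>. 0 \<le> f \<omega> \<and> f \<omega> \<le> 1" for f :: "'a \<Rightarrow> real"
      by (rule integrable_const_bound[where B=1]) (use that in auto)
    have i: "integrable M X" "integrable M Y" "integrable M (U N X)" "integrable M (U N Y)"
      "integrable M (\<lambda>\<omega>. X \<omega> * Y \<omega>)" "integrable M (\<lambda>\<omega>. U N X \<omega> * U N Y \<omega>)"
    proof -
      show "integrable M X" "integrable M Y" using X Y by (auto intro: int01)
      show "integrable M (U N X)" "integrable M (U N Y)" using UX UY by (auto intro: int01)
      show "integrable M (\<lambda>\<omega>. X \<omega> * Y \<omega>)"
        by (rule int01) (use X Y in \<open>auto intro: mult_le_one\<close>)
      show "integrable M (\<lambda>\<omega>. U N X \<omega> * U N Y \<omega>)"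
        by (rule int01) (use UX UY in \<open>auto intro: mult_le_one\<close>)
    qed
    define P where "P j l = measure M ((X -` {real j / real N..} \<inter> space M) \<inter> (Y -` {real l / real N..} \<inter> space M))
       - measure M (X -` {real j / real N..} \<inter> space M) * measure M (Y -` {real l / real N..} \<inter> space M)" for j l
    have ind: "indicator A (Z \<omega>) = (indicator (Z -` A \<inter> space M) \<omega>::real)"
      if "\<omega> \<in> space M" for A \<omega> and Z :: "'a \<Rightarrow> real"
      using that by (simp add: indicator_def)
    have ind2: "indicator A (X \<omega>) * indicator B (Y \<omega>)
      = (indicator ((X -` A \<inter> space M) \<inter> (Y -` B \<inter> space M)) \<omega>::real)"
      if "\<omega> \<in> space M" for A B \<omega>
      using that by (simp add: indicator_def)
    have EU: "expectation (U N Z) = (\<Sum>j\<in>{1..N}. measure M (Z -` {real j / real N..} \<inter> space M)) / real N"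
      if [measurable]: "Z \<in> borel_measurable M" for Z
    proof -
      have "expectation (U N Z) = expectation (\<lambda>\<omega>. (\<Sum>j\<in>{1..N}. indicator (Z -` {real j / real N..} \<inter> space M) \<omega>) / real N)"
        unfolding U_def
        by (intro Bochner_Integration.integral_cong arg_cong2[where f="(/)"] sum.cong refl ind)
      also have "\<dots> = (\<Sum>j\<in>{1..N}. measure M (Z -` {real j / real N..} \<inter> space M)) / real N"
        by (simp add: Bochner_Integration.integral_sum emeasure_eq_measure)
      finally show ?thesis .
    qed
    have EUU: "expectation (\<lambda>\<omega>. U N X \<omega> * U N Y \<omega>) = (\<Sum>j\<in>{1..N}. \<Sum>l\<in>{1..N}.
        measure M ((X -` {real j / real N..} \<inter> space M) \<inter> (Y -` {real l / real N..} \<inter> space M))) / (real N * real N)"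
    proof -
      have "expectation (\<lambda>\<omega>. U N X \<omega> * U N Y \<omega>) = expectation (\<lambda>\<omega>. (\<Sum>j\<in>{1..N}. \<Sum>l\<in>{1..N}.
         indicator ((X -` {real j / real N..} \<inter> space M) \<inter> (Y -` {real l / real N..} \<inter> space M)) \<omega>) / (real N * real N))"
        unfolding U_def times_divide_times_eq sum_product
        by (intro Bochner_Integration.integral_cong arg_cong2[where f="(/)"] sum.cong refl ind2)
      also have "\<dots> = (\<Sum>j\<in>{1..N}. \<Sum>l\<in>{1..N}.
        measure M ((X -` {real j / real N..} \<inter> space M) \<inter> (Y -` {real l / real N..} \<inter> space M))) / (real N * real N)"
        by (simp add: Bochner_Integration.integral_sum emeasure_eq_measure)
      finally show ?thesis .
    qed
    have "expectation (\<lambda>\<omega>. U N X \<omega> * U N Y \<omega>) - expectation (U N X) * expectation (U N Y)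
        = (\<Sum>j\<in>{1..N}. \<Sum>l\<in>{1..N}. P j l) / (real N * real N)"
      by (simp add: EU EUU P_def sum_subtractf sum_product diff_divide_distrib)
    also have "\<bar>\<dots>\<bar> \<le> (\<Sum>j\<in>{1..N}. \<Sum>l\<in>{1..N}. \<alpha>) / (real N * real N)"
    proof -
      have "\<bar>P j l\<bar> \<le> \<alpha>" for j l
        using mix unfolding mix_bound_def P_def by (auto simp del: vimage_Int)
      then have "\<bar>\<Sum>j\<in>{1..N}. \<Sum>l\<in>{1..N}. P j l\<bar> \<le> (\<Sum>j\<in>{1..N}. \<Sum>l\<in>{1..N}. \<alpha>)"
        by (intro order_trans[OF sum_abs] sum_mono)
      then show ?thesis unfolding abs_divide abs_mult abs_of_nat by (rule divide_right_mono) simp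
    qed
    also have "\<dots> = \<alpha>" using N by simp
    finally have 1: "\<bar>expectation (\<lambda>\<omega>. U N X \<omega> * U N Y \<omega>) - expectation (U N X) * expectation (U N Y)\<bar> \<le> \<alpha>" .
    \<comment> \<open>Used both pointwise for the products and for the product of the expectations;
      each use contributes 2/N.\<close>
    have pd: "\<bar>x * y - u * v\<bar> \<le> 2 / real N"
      if "\<bar>x - u\<bar> \<le> 1 / real N" "\<bar>y - v\<bar> \<le> 1 / real N" "0 \<le> y" "y \<le> 1" "0 \<le> u" "u \<le> 1" for x y u v :: real
    proof -
      have "x * y - u * v = (x - u) * y + u * (y - v)" by (simp add: algebra_simps)
      also have "\<bar>\<dots>\<bar> \<le> \<bar>x - u\<bar> * y + u * \<bar>y - v\<bar>"
        using that by (intro order_trans[OF abs_triangle_ineq]) (simp add: abs_mult)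
      also have "\<dots> \<le> 1 / real N * 1 + 1 * (1 / real N)"
        using that by (intro add_mono mult_mono) auto
      finally show ?thesis by simp
    qed
    have "\<bar>expectation (\<lambda>\<omega>. X \<omega> * Y \<omega>) - expectation (\<lambda>\<omega>. U N X \<omega> * U N Y \<omega>)\<bar>
       = \<bar>expectation (\<lambda>\<omega>. X \<omega> * Y \<omega> - U N X \<omega> * U N Y \<omega>)\<bar>" using i by simp
    also have "\<dots> \<le> expectation (\<lambda>\<omega>. 2 / real N)"
      using X Y UX UY i by (intro order_trans[OF integral_abs_bound] integral_mono) (auto intro!: pd)
    finally have 2: "\<bar>expectation (\<lambda>\<omega>. X \<omega> * Y \<omega>) - expectation (\<lambda>\<omega>. U N X \<omega> * U N Y \<omega>)\<bar> \<le> 2 / real N"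
      by (simp add: prob_space)
    have d: "\<bar>expectation Z - expectation (U N Z)\<bar> \<le> 1 / real N"
      if "integrable M Z" "integrable M (U N Z)" "\<And>\<omega>. \<bar>Z \<omega> - U N Z \<omega>\<bar> \<le> 1 / real N" for Z
    proof -
      have "\<bar>expectation Z - expectation (U N Z)\<bar> = \<bar>expectation (\<lambda>\<omega>. Z \<omega> - U N Z \<omega>)\<bar>" using that by simp
      also have "\<dots> \<le> expectation (\<lambda>\<omega>. 1 / real N)"
        using that by (intro order_trans[OF integral_abs_bound] integral_mono) auto
      finally show ?thesis by (simp add: prob_space)
    qed
    have "\<bar>expectation X * expectation Y - expectation (U N X) * expectation (U N Y)\<bar> \<le> 2 / real N"
    proof (rule pd)
      show "0 \<le> expectation Y" "0 \<le> expectation (U N X)" using Y UX by (auto intro!: integral_nonneg)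
      show "expectation Y \<le> 1" "expectation (U N X) \<le> 1"
        using integral_mono[OF i(2), of "\<lambda>_. 1"] integral_mono[OF i(3), of "\<lambda>_. 1"] Y UX by (auto simp: prob_space)
    qed (use UX UY i in \<open>auto intro!: d\<close>)
    then show ?thesis using 1 2 by (simp add: field_simps abs_le_iff)
  qed
  have "(\<lambda>N. \<alpha> + 4 / real N) \<longlonglongrightarrow> \<alpha> + 0" by (intro tendsto_intros lim_const_over_n)
  then have "(\<lambda>N. \<alpha> + 4 / real N) \<longlonglongrightarrow> \<alpha>" by simp
  then show ?thesis
    by (rule LIMSEQ_le_const) (use main in auto)
qed

text \<open>Affine rescaling to [0, 1] divides the covariance by (2a)(2b), whence the factor
  4.\<close>

lemma cov_le_mix:
  assumes [measurable]: "X \<in> borel_measurable M" "Y \<in> borel_measurable M"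
    and ab: "a > 0" "b > 0"
    and X: "\<And>\<omega>. \<bar>X \<omega>\<bar> \<le> a" and Y: "\<And>\<omega>. \<bar>Y \<omega>\<bar> \<le> b"
    and mix: "mix_bound M \<alpha> X Y"
  shows "\<bar>expectation (\<lambda>\<omega>. X \<omega> * Y \<omega>) - expectation X * expectation Y\<bar> \<le> 4 * a * b * \<alpha>"
proof -
  define X' where "X' \<omega> = (X \<omega> + a) / (2 * a)" for \<omega>
  define Y' where "Y' \<omega> = (Y \<omega> + b) / (2 * b)" for \<omega>
  have i: "integrable M X" "integrable M Y" "integrable M (\<lambda>\<omega>. X \<omega> * Y \<omega>)"
    using X Y ab by (auto intro: integrable_const_bound[where B=a] integrable_const_bound[where B=b])
      (auto intro!: integrable_const_bound[where B="a * b"] AE_I2 mult_mono simp: abs_mult)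
  have "0 \<le> X' \<omega> \<and> X' \<omega> \<le> 1" "0 \<le> Y' \<omega> \<and> Y' \<omega> \<le> 1" for \<omega>
    using X[of \<omega>] Y[of \<omega>] ab by (auto simp: X'_def Y'_def field_simps abs_le_iff)
  moreover have "mix_bound M \<alpha> X' Y'" unfolding X'_def Y'_def
    by (rule mix_bound_compose[OF mix]) measurable
  ultimately have "\<bar>expectation (\<lambda>\<omega>. X' \<omega> * Y' \<omega>) - expectation X' * expectation Y'\<bar> \<le> \<alpha>"
    by (intro cov_le_mix_unit) (simp_all add: X'_def[abs_def] Y'_def[abs_def])
  also have "expectation (\<lambda>\<omega>. X' \<omega> * Y' \<omega>) = (expectation (\<lambda>\<omega>. X \<omega> * Y \<omega>) + b * expectation X + a * expectation Y + a * b) / (4 * a * b)"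
  proof -
    have "X' \<omega> * Y' \<omega> = (X \<omega> * Y \<omega> + b * X \<omega> + a * Y \<omega> + a * b) / (4 * a * b)" for \<omega>
      using ab by (simp add: X'_def Y'_def field_simps)
    then show ?thesis using i by (simp add: prob_space)
  qed
  also have "expectation X' = (expectation X + a) / (2 * a)" unfolding X'_def using i by (simp add: prob_space)
  also have "expectation Y' = (expectation Y + b) / (2 * b)" unfolding Y'_def using i by (simp add: prob_space)
  also have "(expectation (\<lambda>\<omega>. X \<omega> * Y \<omega>) + b * expectation X + a * expectation Y + a * b) / (4 * a * b)
     - (expectation X + a) / (2 * a) * ((expectation Y + b) / (2 * b))
     = (expectation (\<lambda>\<omega>. X \<omega> * Y \<omega>) - expectation X * expectation Y) / (4 * a * b)"
    using ab by (simp add: field_simps)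
  finally show ?thesis using ab by (simp add: abs_mult field_simps)
qed

end

section \<open>Truncation and Davydov-type covariance bounds\<close>

definition clamp_at :: "real \<Rightarrow> real \<Rightarrow> real" where
  "clamp_at a x = max (- a) (min a x)"

lemma clamp_at:
  assumes "a > 0"
  shows "\<bar>clamp_at a x\<bar> \<le> a" "\<bar>clamp_at a x\<bar> \<le> \<bar>x\<bar>" "\<bar>x - clamp_at a x\<bar> \<le> \<bar>x\<bar>" "\<bar>x\<bar> \<le> a \<Longrightarrow> clamp_at a x = x"
  using assms by (auto simp: clamp_at_def max_def min_def abs_if split: if_splits)

lemma borel_measurable_clamp_at [measurable]: "clamp_at a \<in> borel_measurable borel"
  unfolding clamp_at_def by measurable

text \<open>Only |x| > a contributes, and there |x|^(1 - p) is at most a^(1 - p). The factor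
  \<open>a ^ 3\<close> is the bound of the partner variable, clamped at that level.\<close>

lemma clamp_at_diff_bound:
  fixes a p x :: real
  assumes "a > 0" "p > 4"
  shows "\<bar>x - clamp_at a x\<bar> * a ^ 3 \<le> a powr (4 - p) * \<bar>x\<bar> powr p"
proof (cases "\<bar>x\<bar> \<le> a")
  case True then show ?thesis using assms by (simp add: clamp_at(4))
next
  case False
  then have x: "\<bar>x\<bar> > a" "\<bar>x\<bar> > 0" using assms by auto
  have "\<bar>x - clamp_at a x\<bar> * a ^ 3 \<le> \<bar>x\<bar> * a ^ 3"
    using assms by (intro mult_right_mono clamp_at) auto
  also have "\<dots> = \<bar>x\<bar> powr p * \<bar>x\<bar> powr (1 - p) * a powr 3"
    using x assms by (simp add: powr_add[symmetric] powr_numeral)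
  also have "\<dots> \<le> \<bar>x\<bar> powr p * a powr (1 - p) * a powr 3"
    using x assms by (intro mult_right_mono mult_left_mono powr_mono2') auto
  also have "\<dots> = a powr (4 - p) * \<bar>x\<bar> powr p" by (simp add: powr_add[symmetric])
  finally show ?thesis .
qed

text \<open>\<open>y\<close> stands for a product of three variables of the size of
  \<open>x\<close>; hence the level \<open>a ^ 3\<close> and the exponent \<open>p / 3\<close>. With
  m = max(|x|, |y|^(1/3)) the product is at most m^4, and m > a whenever one of the clamps is
  active.\<close>

lemma clamp_at_prod_bound:
  fixes a p x y :: real
  assumes a: "a > 0" and p: "p > 4"
  shows "\<bar>x * y - clamp_at a x * clamp_at (a ^ 3) y\<bar> \<le> 2 * (a powr (4 - p) * (\<bar>x\<bar> powr p + \<bar>y\<bar> powr (p / 3)))"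
proof (cases "\<bar>x\<bar> \<le> a \<and> \<bar>y\<bar> \<le> a ^ 3")
  case True then show ?thesis using assms by (simp add: clamp_at(4))
next
  case False
  define m where "m = max \<bar>x\<bar> (\<bar>y\<bar> powr (1/3))"
  have y3: "(\<bar>y\<bar> powr (1/3)) ^ 3 = \<bar>y\<bar>"
  proof -
    have "(\<bar>y\<bar> powr (1/3)) ^ 3 = (\<bar>y\<bar> powr (1/3)) powr 3" by (simp add: powr_numeral)
    then show ?thesis by (simp only: powr_powr) simp
  qed
  have "m > a"
  proof (cases "\<bar>x\<bar> \<le> a")
    case True
    with False have "a ^ 3 < (\<bar>y\<bar> powr (1/3)) ^ 3" unfolding y3 by auto
    then have "a < \<bar>y\<bar> powr (1/3)" by (rule power_less_imp_less_base) simp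
    then show ?thesis by (simp add: m_def)
  qed (simp add: m_def)
  then have m: "m > 0" using a by linarith
  have "\<bar>x * y - clamp_at a x * clamp_at (a ^ 3) y\<bar> \<le> \<bar>x\<bar> * \<bar>y\<bar> + \<bar>clamp_at a x\<bar> * \<bar>clamp_at (a ^ 3) y\<bar>"
    by (simp add: abs_mult[symmetric])
  also have "\<dots> \<le> \<bar>x\<bar> * \<bar>y\<bar> + \<bar>x\<bar> * \<bar>y\<bar>"
    using a by (intro add_mono mult_mono clamp_at) auto
  finally have 1: "\<bar>x * y - clamp_at a x * clamp_at (a ^ 3) y\<bar> \<le> 2 * (\<bar>x\<bar> * \<bar>y\<bar>)" by simp
  have "\<bar>x\<bar> * \<bar>y\<bar> \<le> m * m ^ 3"
  proof (intro mult_mono)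
    have "(\<bar>y\<bar> powr (1/3)) ^ 3 \<le> m ^ 3" by (intro power_mono) (auto simp: m_def)
    then show "\<bar>y\<bar> \<le> m ^ 3" unfolding y3 .
  qed (use m in \<open>auto simp: m_def\<close>)
  also have "m * m ^ 3 = m powr p * m powr (4 - p)"
    using m by (simp add: powr_add[symmetric] powr_numeral power_numeral_reduce)
  also have "\<dots> \<le> m powr p * a powr (4 - p)"
    using m a p \<open>m > a\<close> by (intro mult_left_mono powr_mono2') auto
  also have "\<dots> \<le> (\<bar>x\<bar> powr p + \<bar>y\<bar> powr (p / 3)) * a powr (4 - p)"
    by (intro mult_right_mono) (auto simp: m_def max_def powr_powr)
  finally show ?thesis using 1 by (simp add: mult.commute)
qed

text \<open>After clamping, the bounded pair falls under \<open>cov_le_mix\<close>, and every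
  truncation error is of order a^(4 - p). Of the constant 3, two parts come from the product and one
  from the product of the means. The level \<open>a\<close> stays free so that it can be tuned to
  the mixing rate.\<close>

lemma (in prob_space) cov_le_mix_moments:
  assumes [measurable]: "X \<in> borel_measurable M" "Y \<in> borel_measurable M"
    and a: "a > 0" and p: "p > 4"
    and iX: "integrable M (\<lambda>\<omega>. \<bar>X \<omega>\<bar> powr p)" and iY: "integrable M (\<lambda>\<omega>. \<bar>Y \<omega>\<bar> powr (p / 3))"
    and i1: "integrable M X" and iXY: "integrable M (\<lambda>\<omega>. X \<omega> * Y \<omega>)" and EX: "expectation X = 0"
    and mix: "mix_bound M \<alpha> X Y"
  shows "\<bar>expectation (\<lambda>\<omega>. X \<omega> * Y \<omega>)\<bar> \<le> 4 * a ^ 4 * \<alpha>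
     + 3 * a powr (4 - p) * (expectation (\<lambda>\<omega>. \<bar>X \<omega>\<bar> powr p) + expectation (\<lambda>\<omega>. \<bar>Y \<omega>\<bar> powr (p / 3)))"
proof -
  define X1 where "X1 \<omega> = clamp_at a (X \<omega>)" for \<omega>
  define Y1 where "Y1 \<omega> = clamp_at (a ^ 3) (Y \<omega>)" for \<omega>
  have [measurable]: "X1 \<in> borel_measurable M" "Y1 \<in> borel_measurable M" unfolding X1_def Y1_def by measurable
  have b: "\<bar>X1 \<omega>\<bar> \<le> a" "\<bar>Y1 \<omega>\<bar> \<le> a ^ 3" for \<omega> using a by (auto simp: X1_def Y1_def clamp_at)
  have i: "integrable M X1" "integrable M Y1" "integrable M (\<lambda>\<omega>. X1 \<omega> * Y1 \<omega>)"
    using b a by (auto intro: integrable_const_bound[where B=a] integrable_const_bound[where B="a^3"])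
      (auto intro!: integrable_const_bound[where B="a * a ^ 3"] AE_I2 mult_mono simp: abs_mult)
  let ?A = "expectation (\<lambda>\<omega>. \<bar>X \<omega>\<bar> powr p)" and ?B = "expectation (\<lambda>\<omega>. \<bar>Y \<omega>\<bar> powr (p / 3))"
  let ?c = "a powr (4 - p)"
  have 1: "\<bar>expectation (\<lambda>\<omega>. X1 \<omega> * Y1 \<omega>) - expectation X1 * expectation Y1\<bar> \<le> 4 * a * a ^ 3 * \<alpha>"
  proof (rule cov_le_mix)
    show "mix_bound M \<alpha> X1 Y1" unfolding X1_def Y1_def by (rule mix_bound_compose[OF mix]) measurable
  qed (use a b in auto)
  have 2: "\<bar>expectation (\<lambda>\<omega>. X \<omega> * Y \<omega>) - expectation (\<lambda>\<omega>. X1 \<omega> * Y1 \<omega>)\<bar> \<le> 2 * (?c * (?A + ?B))"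
  proof -
    have "\<bar>expectation (\<lambda>\<omega>. X \<omega> * Y \<omega>) - expectation (\<lambda>\<omega>. X1 \<omega> * Y1 \<omega>)\<bar> = \<bar>expectation (\<lambda>\<omega>. X \<omega> * Y \<omega> - X1 \<omega> * Y1 \<omega>)\<bar>"
      using i iXY by simp
    also have "\<dots> \<le> expectation (\<lambda>\<omega>. 2 * (?c * (\<bar>X \<omega>\<bar> powr p + \<bar>Y \<omega>\<bar> powr (p / 3))))"
      using i iXY iX iY clamp_at_prod_bound[OF a p]
      by (intro order_trans[OF integral_abs_bound] integral_mono) (auto simp: X1_def Y1_def)
    also have "\<dots> = 2 * (?c * (?A + ?B))" using iX iY by simp
    finally show ?thesis .
  qed
  \<comment> \<open>Since \<open>X\<close> has mean 0, the mean of its truncation is at most the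
    mean of |X - X1|; the clamped \<open>Y\<close> contributes \<open>a ^ 3\<close>.\<close>
  have 3: "\<bar>expectation X1 * expectation Y1\<bar> \<le> ?c * ?A"
  proof -
    have "\<bar>expectation Y1\<bar> \<le> a ^ 3"
      using integral_mono[OF integrable_abs[OF i(2)], of "\<lambda>_. a ^ 3"] b order_trans[OF integral_abs_bound[of M Y1]]
      by (simp add: prob_space)
    then have "\<bar>expectation X1 * expectation Y1\<bar> \<le> \<bar>expectation X1\<bar> * a ^ 3"
      by (simp add: abs_mult mult_left_mono)
    also have "\<bar>expectation X1\<bar> = \<bar>expectation (\<lambda>\<omega>. X \<omega> - X1 \<omega>)\<bar>" using i i1 EX by simp
    also have "\<dots> * a ^ 3 \<le> expectation (\<lambda>\<omega>. \<bar>X \<omega> - X1 \<omega>\<bar>) * a ^ 3"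
      using a by (intro mult_right_mono integral_abs_bound) auto
    also have "\<dots> = expectation (\<lambda>\<omega>. \<bar>X \<omega> - X1 \<omega>\<bar> * a ^ 3)" by simp
    also have "\<dots> \<le> expectation (\<lambda>\<omega>. ?c * \<bar>X \<omega>\<bar> powr p)"
      using clamp_at_diff_bound[OF a p, of "X _", folded X1_def] i i1 iX
      by (intro integral_mono integrable_mult_left integrable_mult_right integrable_abs Bochner_Integration.integrable_diff)
        auto
    also have "\<dots> = ?c * ?A" by simp
    finally show ?thesis .
  qed
  have 4: "0 \<le> ?c * ?B" by (intro mult_nonneg_nonneg integral_nonneg) auto
  have 5: "4 * a * a ^ 3 * \<alpha> = 4 * a ^ 4 * \<alpha>" by (simp add: power_numeral_reduce)
  have 6: "2 * (?c * (?A + ?B)) = 2 * (?c * ?A) + 2 * (?c * ?B)" "3 * ?c * (?A + ?B) = 3 * (?c * ?A) + 3 * (?c * ?B)"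
    by (simp_all add: algebra_simps)
  show ?thesis using 1 2 3 4 unfolding 5 6 by linarith
qed

lemma mix_bound_sym: "mix_bound M \<alpha> X Y \<Longrightarrow> mix_bound M \<alpha> Y X"
  unfolding mix_bound_def by (metis Int_commute mult.commute)

lemma mix_bound_mono: "mix_bound M \<alpha> X Y \<Longrightarrow> \<alpha> \<le> \<alpha>' \<Longrightarrow> mix_bound M \<alpha>' X Y"
  unfolding mix_bound_def by force

text \<open>The preimage of a Borel set under a measurable functional of the trajectory up to
  \<open>t\<close>, or from \<open>t + h\<close> on, is a past or future event. This turns the
  supremum over events into a bound for concrete variables.\<close>

lemma (in prob_space) alpha_mixing_coef_mix_bound:
  fixes X :: "nat \<Rightarrow> 'a \<Rightarrow> 'b::topological_space"
  assumes f: "f \<in> borel_measurable (PiM {..t} (\<lambda>_. borel))"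
    and g: "g \<in> borel_measurable (PiM {t + h..} (\<lambda>_. borel))"
  shows "mix_bound M (alpha_mixing_coef M X h) (\<lambda>\<omega>. f (restrict (\<lambda>s. X s \<omega>) {..t}))
     (\<lambda>\<omega>. g (restrict (\<lambda>s. X s \<omega>) {t + h..}))"
  unfolding mix_bound_def
proof (intro ballI)
  fix A B :: "real set" assume AB: "A \<in> sets borel" "B \<in> sets borel"
  let ?U = "\<lambda>\<omega>. restrict (\<lambda>s. X s \<omega>) {..t}" and ?V = "\<lambda>\<omega>. restrict (\<lambda>s. X s \<omega>) {t + h..}"
  let ?S = "{\<bar>measure M (A \<inter> B) - measure M A * measure M B\<bar> | t A B.
            A \<in> past_events M X t \<and> B \<in> future_events M X (t + h)}"
  let ?A = "(\<lambda>\<omega>. f (?U \<omega>)) -` A \<inter> space M" and ?B = "(\<lambda>\<omega>. g (?V \<omega>)) -` B \<inter> space M"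
  have "?A = ?U -` (f -` A \<inter> space (PiM {..t} (\<lambda>_. borel))) \<inter> space M"
    by (auto simp: space_PiM)
  then have 1: "?A \<in> past_events M X t"
    unfolding past_events_def using measurable_sets[OF f AB(1)] by blast
  have "?B = ?V -` (g -` B \<inter> space (PiM {t + h..} (\<lambda>_. borel))) \<inter> space M"
    by (auto simp: space_PiM)
  then have 2: "?B \<in> future_events M X (t + h)"
    unfolding future_events_def using measurable_sets[OF g AB(2)] by blast
  \<comment> \<open>A real \<open>Sup\<close> is an upper bound only for a set that is bounded
    above; differences of probabilities are at most 1.\<close>
  have "bdd_above ?S"
  proof (rule bdd_aboveI)
    fix z assume "z \<in> ?S"
    then obtain A B where z: "z = \<bar>measure M (A \<inter> B) - measure M A * measure M B\<bar>" by blast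
    have "0 \<le> measure M A * measure M B" "measure M A * measure M B \<le> 1"
      by (auto intro: mult_le_one)
    then show "z \<le> 1" unfolding z
      using prob_le_1[of "A \<inter> B"] measure_nonneg[of M "A \<inter> B"] by (intro abs_leI) linarith+
  qed
  then have "\<bar>measure M (?A \<inter> ?B) - measure M ?A * measure M ?B\<bar> \<le> Sup ?S"
    by (rule cSup_upper[rotated]) (use 1 2 in blast)
  then show "\<bar>measure M (?A \<inter> ?B) - measure M ?A * measure M ?B\<bar> \<le> alpha_mixing_coef M X h"
    unfolding alpha_mixing_coef_def .
qed

subsection \<open>Fourth moments of partial sums\<close>

text \<open>Adjacent transpositions generate all permutations of four indices.\<close>

lemma sorted4_wlog:
  fixes P :: "nat \<Rightarrow> nat \<Rightarrow> nat \<Rightarrow> nat \<Rightarrow> bool"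
  assumes srt: "\<And>a b c d. a \<le> b \<Longrightarrow> b \<le> c \<Longrightarrow> c \<le> d \<Longrightarrow> P a b c d"
    and s12: "\<And>a b c d. P a b c d \<Longrightarrow> P b a c d"
    and s23: "\<And>a b c d. P a b c d \<Longrightarrow> P a c b d"
    and s34: "\<And>a b c d. P a b c d \<Longrightarrow> P a b d c"
  shows "P a b c d"
proof -
  have 1: "P a b c d" if "b \<le> c" "c \<le> d" for a b c d
    using that srt s12 s23 s34 by (metis nat_le_linear)
  have 2: "P a b c d" if "c \<le> d" for a b c d
    using that 1 s23 s34 by (metis nat_le_linear)
  show ?thesis using 2 s34 by (metis nat_le_linear)
qed

lemma pow4_le_powr: "p > 4 \<Longrightarrow> (x::real) ^ 4 \<le> 1 + \<bar>x\<bar> powr p"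
proof (cases "\<bar>x\<bar> \<le> 1")
  case True
  then have "x ^ 4 \<le> 1" using power_le_one[of "\<bar>x\<bar>" 4] by simp
  moreover have "0 \<le> \<bar>x\<bar> powr p" by simp
  ultimately show ?thesis by linarith
next
  case False
  assume "p > 4"
  then have "\<bar>x\<bar> powr 4 \<le> \<bar>x\<bar> powr p" using False by (intro powr_mono) auto
  then show ?thesis using False by (simp add: powr_numeral)
qed

lemma abs_le_pow4: "\<bar>x::real\<bar> \<le> 1 + x ^ 4"
proof -
  have "\<bar>x\<bar> \<le> 1 + \<bar>x\<bar> ^ 4" 
  proof (cases "\<bar>x\<bar> \<le> 1")
    case False
    then have "\<bar>x\<bar> ^ 1 \<le> \<bar>x\<bar> ^ 4" by (intro power_increasing) auto
    then show ?thesis by simp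
  qed (simp add: add_increasing2)
  then show ?thesis by simp
qed

lemma prod4_le:
  fixes a b c d :: real
  shows "\<bar>a * b * c * d\<bar> \<le> a ^ 4 + b ^ 4 + c ^ 4 + d ^ 4"
proof -
  define m where "m = max (max \<bar>a\<bar> \<bar>b\<bar>) (max \<bar>c\<bar> \<bar>d\<bar>)"
  have "\<bar>a * b * c * d\<bar> \<le> m * m * m * m"
    unfolding abs_mult by (intro mult_mono) (auto simp: m_def le_max_iff_disj)
  also have "\<dots> = m ^ 4" by (simp add: power4_eq_xxxx)
  also have "\<dots> \<le> \<bar>a\<bar> ^ 4 + \<bar>b\<bar> ^ 4 + \<bar>c\<bar> ^ 4 + \<bar>d\<bar> ^ 4"
    unfolding m_def max_def by (auto simp del: power_even_abs_numeral)
  finally show ?thesis by simp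
qed

lemma prod3_powr_le:
  fixes b c d p :: real
  assumes "p > 0"
  shows "\<bar>b * c * d\<bar> powr (p / 3) \<le> \<bar>b\<bar> powr p + \<bar>c\<bar> powr p + \<bar>d\<bar> powr p"
proof -
  define m where "m = max \<bar>b\<bar> (max \<bar>c\<bar> \<bar>d\<bar>)"
  have m: "m \<ge> 0" by (simp add: m_def)
  have "\<bar>b * c * d\<bar> \<le> m * m * m"
    unfolding abs_mult by (intro mult_mono) (auto simp: m_def le_max_iff_disj)
  also have "\<dots> = m powr 3" using m by (simp add: powr_numeral power3_eq_cube)
  finally have "\<bar>b * c * d\<bar> powr (p / 3) \<le> (m powr 3) powr (p / 3)"
    using assms by (intro powr_mono2) auto
  also have "\<dots> = m powr p" by (simp add: powr_powr)
  also have "\<dots> \<le> \<bar>b\<bar> powr p + \<bar>c\<bar> powr p + \<bar>d\<bar> powr p"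
    unfolding m_def max_def by auto
  finally show ?thesis .
qed

lemma sum_inverse_squares_le: "(\<Sum>k<n. 1 / (1 + real k)\<^sup>2) \<le> 2"
proof -
  \<comment> \<open>The subtracted term strengthens the claim so that the induction telescopes:
    1/(2+n)^2 is at most 1/(1+n) - 1/(2+n).\<close>
  have "(\<Sum>k<Suc n. 1 / (1 + real k)\<^sup>2) \<le> 2 - 1 / (1 + real n)"
  proof (induction n)
    case (Suc n)
    have "1 / (2 + real n)\<^sup>2 \<le> 1 / ((1 + real n) * (2 + real n))"
      unfolding power2_eq_square by (intro divide_left_mono mult_right_mono mult_pos_pos) auto
    also have "\<dots> = 1 / (1 + real n) - 1 / (2 + real n)" by (simp add: field_simps)
    finally show ?case using Suc by simp
  qed simp
  moreover have "(\<Sum>k<n. 1 / (1 + real k)\<^sup>2) \<le> (\<Sum>k<Suc n. 1 / (1 + real k)\<^sup>2)" by simp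
  moreover have "0 \<le> 1 / (1 + real n)" by simp
  ultimately show ?thesis by linarith
qed

text \<open>Half of the available decay: a bound of order g^(-4) is shared between two gaps, each
  receiving an inverse square, which is summable. The 1 in the denominator covers coinciding
  times.\<close>

definition dist_weight :: "nat \<Rightarrow> nat \<Rightarrow> real" where
  "dist_weight a b = 1 / (1 + \<bar>real a - real b\<bar>)\<^sup>2"

lemma sum_dist_weight_le: "(\<Sum>a<m. \<Sum>b<m. dist_weight a b) \<le> 4 * real m"
proof -
  have "(\<Sum>b<m. dist_weight a b) \<le> 4" for a
  proof -
    have "(\<Sum>b<m. dist_weight a b) \<le> (\<Sum>b<a. dist_weight a b) + (\<Sum>b\<in>{a..<m}. dist_weight a b)"
    proof -
      have "(\<Sum>b<m. dist_weight a b) \<le> (\<Sum>b\<in>{..<a} \<union> {a..<m}. dist_weight a b)"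
        by (rule sum_mono2) (auto simp: dist_weight_def)
      then show ?thesis by (subst (asm) sum.union_disjoint) auto
    qed
    also have "(\<Sum>b<a. dist_weight a b) \<le> (\<Sum>b<a. 1 / (1 + real (a - Suc b))\<^sup>2)"
      unfolding dist_weight_def by (intro sum_mono divide_left_mono power_mono) (auto simp: of_nat_diff)
    also have "\<dots> = (\<Sum>k<a. 1 / (1 + real k)\<^sup>2)" by (rule sum.nat_diff_reindex)
    also have "\<dots> \<le> 2" by (rule sum_inverse_squares_le)
    also have "(\<Sum>b\<in>{a..<m}. dist_weight a b) = (\<Sum>k<m - a. 1 / (1 + real k)\<^sup>2)"
      unfolding dist_weight_def
      by (rule sum.reindex_bij_witness[of _ "\<lambda>k. k + a" "\<lambda>b. b - a"]) (auto simp: of_nat_diff)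
    also have "\<dots> \<le> 2" by (rule sum_inverse_squares_le)
    finally show ?thesis by simp
  qed
  then have "(\<Sum>a<m. \<Sum>b<m. dist_weight a b) \<le> (\<Sum>a<m. 4)" by (intro sum_mono)
  then show ?thesis by simp
qed

text \<open>For each of the three ways to pair four indices the sum factors into the square of a
  double sum of size at most 4m; and 3 * 16 = 48.\<close>

lemma sum_pair_weights_le:
  "(\<Sum>a<m. \<Sum>b<m. \<Sum>c<m. \<Sum>d<m. dist_weight a b * dist_weight c d
      + dist_weight a c * dist_weight b d + dist_weight a d * dist_weight b c) \<le> 48 * (real m)\<^sup>2"
proof -
  let ?S = "\<Sum>a<m. \<Sum>b<m. dist_weight a b"
  have 1: "(\<Sum>a<m. \<Sum>b<m. \<Sum>c<m. \<Sum>d<m. dist_weight a b * dist_weight c d) = ?S * ?S"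
    by (simp only: sum_distrib_right) (simp only: sum_distrib_left)
  have 2: "(\<Sum>a<m. \<Sum>b<m. \<Sum>c<m. \<Sum>d<m. dist_weight a c * dist_weight b d) = ?S * ?S"
    unfolding 1[symmetric] by (intro sum.cong refl sum.swap)
  have "(\<Sum>a<m. \<Sum>b<m. \<Sum>c<m. \<Sum>d<m. dist_weight a d * dist_weight b c)
      = (\<Sum>a<m. \<Sum>b<m. \<Sum>c<m. \<Sum>d<m. dist_weight a c * dist_weight b d)"
    by (intro sum.cong refl sum.swap)
  then have 3: "(\<Sum>a<m. \<Sum>b<m. \<Sum>c<m. \<Sum>d<m. dist_weight a d * dist_weight b c) = ?S * ?S"
    using 2 by simp
  have "0 \<le> ?S" by (intro sum_nonneg) (auto simp: dist_weight_def)
  then have "?S * ?S \<le> (4 * real m) * (4 * real m)"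
    using sum_dist_weight_le[of m] by (intro mult_mono) auto
  then show ?thesis by (simp add: sum.distrib 1 2 3 power2_eq_square)
qed

text \<open>The part 4 + 4B is the bound without decay, used for gap 0. For gaps g >= 1, 4C + 12B is
  the constant of the covariance bound and 16 pays for replacing g^4 by (1 + g)^4.\<close>

definition moment4_const :: "real \<Rightarrow> real \<Rightarrow> real" where
  "moment4_const B C = 4 + 4 * B + 16 * (4 * C + 12 * B)"

text \<open>For sorted times only the outer gaps are used: decoupling the first or the last factor from
  the other three already gives summable decay in both gaps, which leaves two free indices.\<close>
lemma (in prob_space) fourth_moment_sum:
  fixes w :: "nat \<Rightarrow> 'a \<Rightarrow> real"
  assumes w [measurable]: "\<And>t. w t \<in> borel_measurable M"
    and p: "p > 4" and s: "s * (p - 4) / p \<ge> 4" and B: "B \<ge> 0" and C: "C \<ge> 0"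
    and int: "\<And>t. integrable M (\<lambda>\<omega>. \<bar>w t \<omega>\<bar> powr p)"
    and mom: "\<And>t. expectation (\<lambda>\<omega>. \<bar>w t \<omega>\<bar> powr p) \<le> B"
    and mean: "\<And>t. expectation (w t) = 0"
    and mixF: "\<And>t g a b c. g \<ge> 1 \<Longrightarrow> t + g \<le> a \<Longrightarrow> t + g \<le> b \<Longrightarrow> t + g \<le> c \<Longrightarrow>
       mix_bound M (C * real g powr (- s)) (w t) (\<lambda>\<omega>. w a \<omega> * w b \<omega> * w c \<omega>)"
    and mixP: "\<And>t g a b c. g \<ge> 1 \<Longrightarrow> a \<le> t \<Longrightarrow> b \<le> t \<Longrightarrow> c \<le> t \<Longrightarrow>
       mix_bound M (C * real g powr (- s)) (w (t + g)) (\<lambda>\<omega>. w a \<omega> * w b \<omega> * w c \<omega>)"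
  shows "integrable M (\<lambda>\<omega>. (\<Sum>t<m. w t \<omega>) ^ 4)"
    and "expectation (\<lambda>\<omega>. (\<Sum>t<m. w t \<omega>) ^ 4) \<le> 48 * moment4_const B C * (real m)\<^sup>2"
proof -
  let ?K = "moment4_const B C"
  have K: "?K \<ge> 0" using B C by (simp add: moment4_const_def)
  have int4: "integrable M (\<lambda>\<omega>. w t \<omega> ^ 4)" for t
    by (rule Bochner_Integration.integrable_bound[where f="\<lambda>\<omega>. 1 + \<bar>w t \<omega>\<bar> powr p"])
      (use int pow4_le_powr[OF p] in \<open>auto intro!: order_trans[OF pow4_le_powr[OF p]]\<close>)
  have int1: "integrable M (w t)" for t
    by (rule Bochner_Integration.integrable_bound[where f="\<lambda>\<omega>. 1 + w t \<omega> ^ 4"])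
      (use int4 in \<open>auto intro!: order_trans[OF abs_le_pow4]\<close>)
  have E4: "expectation (\<lambda>\<omega>. w t \<omega> ^ 4) \<le> 1 + B" for t
  proof -
    have "expectation (\<lambda>\<omega>. w t \<omega> ^ 4) \<le> expectation (\<lambda>\<omega>. 1 + \<bar>w t \<omega>\<bar> powr p)"
      using int int4 pow4_le_powr[OF p] by (intro integral_mono) auto
    then show ?thesis using int mom[of t] by (simp add: prob_space)
  qed
  have intp: "integrable M (\<lambda>\<omega>. w a \<omega> * w b \<omega> * w c \<omega> * w d \<omega>)" for a b c d
    by (rule Bochner_Integration.integrable_bound[where f="\<lambda>\<omega>. w a \<omega> ^ 4 + w b \<omega> ^ 4 + w c \<omega> ^ 4 + w d \<omega> ^ 4"])
      (use int4 prod4_le in \<open>auto intro!: AE_I2 order_trans[OF prod4_le]\<close>)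
  define Q where "Q a b c d = \<bar>expectation (\<lambda>\<omega>. w a \<omega> * w b \<omega> * w c \<omega> * w d \<omega>)\<bar>" for a b c d
  have triv: "Q a b c d \<le> 4 + 4 * B" for a b c d
  proof -
    have "Q a b c d \<le> expectation (\<lambda>\<omega>. w a \<omega> ^ 4 + w b \<omega> ^ 4 + w c \<omega> ^ 4 + w d \<omega> ^ 4)"
      unfolding Q_def
      by (intro order_trans[OF integral_abs_bound] integral_mono integrable_abs intp prod4_le Bochner_Integration.integrable_add int4)
    then show ?thesis using int4 E4[of a] E4[of b] E4[of c] E4[of d] by simp
  qed
  have dec: "\<bar>expectation (\<lambda>\<omega>. w u \<omega> * (w a \<omega> * w b \<omega> * w c \<omega>))\<bar> \<le> (4 * C + 12 * B) * (1 / real g ^ 4)"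
    if g: "g \<ge> 1" and mix: "mix_bound M (C * real g powr (- s)) (w u) (\<lambda>\<omega>. w a \<omega> * w b \<omega> * w c \<omega>)"
    for u a b c g
  proof -
    let ?Y = "\<lambda>\<omega>. w a \<omega> * w b \<omega> * w c \<omega>"
    \<comment> \<open>This level balances the two error terms: A^4 g^(-s) and A^(4 - p) both equal
      g^(s(4 - p)/p), at most g^(-4) by \<open>s\<close>.\<close>
    define A where "A = real g powr (s / p)"
    have A: "A > 0" using g by (simp add: A_def)
    have iY: "integrable M (\<lambda>\<omega>. \<bar>?Y \<omega>\<bar> powr (p / 3))"
      by (rule Bochner_Integration.integrable_bound[where f="\<lambda>\<omega>. \<bar>w a \<omega>\<bar> powr p + \<bar>w b \<omega>\<bar> powr p + \<bar>w c \<omega>\<bar> powr p"])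
        (use int p in \<open>auto intro!: AE_I2 order_trans[OF prod3_powr_le]\<close>)
    have EY: "expectation (\<lambda>\<omega>. \<bar>?Y \<omega>\<bar> powr (p / 3)) \<le> 3 * B"
    proof -
      have "expectation (\<lambda>\<omega>. \<bar>?Y \<omega>\<bar> powr (p / 3)) \<le> expectation (\<lambda>\<omega>. \<bar>w a \<omega>\<bar> powr p + \<bar>w b \<omega>\<bar> powr p + \<bar>w c \<omega>\<bar> powr p)"
        using iY int p by (intro integral_mono prod3_powr_le) auto
      then show ?thesis using int mom[of a] mom[of b] mom[of c] by simp
    qed
    have iXY: "integrable M (\<lambda>\<omega>. w u \<omega> * ?Y \<omega>)" using intp[of u a b c] by (simp add: mult.assoc)
    have e4: "s * (4 - p) / p \<le> - 4" using s p by (simp add: field_simps)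
    have ex: "4 * s / p - s = s * (4 - p) / p" using p by (simp add: field_simps)
    have A4: "A ^ 4 * real g powr (- s) = real g powr (s * (4 - p) / p)"
      using g ex by (simp add: A_def powr_power powr_add[symmetric] algebra_simps)
    have Ap: "A powr (4 - p) = real g powr (s * (4 - p) / p)"
      by (simp add: A_def powr_powr)
    have gb: "real g powr (s * (4 - p) / p) \<le> 1 / real g ^ 4"
    proof -
      have "real g powr (s * (4 - p) / p) \<le> real g powr (- 4)"
        using g e4 by (intro powr_mono) auto
      then show ?thesis using g by (simp add: powr_minus powr_numeral divide_inverse)
    qed
    have "\<bar>expectation (\<lambda>\<omega>. w u \<omega> * ?Y \<omega>)\<bar> \<le> 4 * A ^ 4 * (C * real g powr (- s))
       + 3 * A powr (4 - p) * (expectation (\<lambda>\<omega>. \<bar>w u \<omega>\<bar> powr p) + expectation (\<lambda>\<omega>. \<bar>?Y \<omega>\<bar> powr (p / 3)))"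
      by (rule cov_le_mix_moments[OF w _ A p int iY int1 iXY mean mix]) measurable
    also have "\<dots> \<le> 4 * A ^ 4 * (C * real g powr (- s)) + 3 * A powr (4 - p) * (B + 3 * B)"
      using mom[of u] EY C by (intro add_mono mult_left_mono) auto
    also have "\<dots> = (4 * C + 12 * B) * real g powr (s * (4 - p) / p)"
      unfolding Ap A4[symmetric] by (simp add: Ap[symmetric] A4 algebra_simps)
    also have "\<dots> \<le> (4 * C + 12 * B) * (1 / real g ^ 4)"
      using gb B C by (intro mult_left_mono) auto
    finally show ?thesis .
  qed
  have sorted: "Q a b c d \<le> ?K * (dist_weight a b * dist_weight c d)"
    if "a \<le> b" "b \<le> c" "c \<le> d" for a b c d
  proof -
    \<comment> \<open>The larger outer gap is decoupled. Its fourth power dominates the product of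
      the squares of both outer gaps, all shifted by 1.\<close>
    define g where "g = max (b - a) (d - c)"
    have gw: "1 / (1 + real g) ^ 4 \<le> dist_weight a b * dist_weight c d"
    proof -
      have e: "\<bar>real a - real b\<bar> = real (b - a)" "\<bar>real c - real d\<bar> = real (d - c)"
        using that by (simp_all add: of_nat_diff)
      have "(1 + real (b - a))\<^sup>2 * (1 + real (d - c))\<^sup>2 \<le> (1 + real g)\<^sup>2 * (1 + real g)\<^sup>2"
        by (intro mult_mono power_mono) (auto simp: g_def)
      also have "\<dots> = (1 + real g) ^ 4" by (simp flip: power_add)
      finally have "1 / (1 + real g) ^ 4 \<le> 1 / ((1 + real (b - a))\<^sup>2 * (1 + real (d - c))\<^sup>2)"
        by (intro divide_left_mono) auto
      then show ?thesis unfolding dist_weight_def e by simp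
    qed
    have "Q a b c d \<le> ?K * (1 / (1 + real g) ^ 4)"
    proof (cases "g = 0")
      case True
      then show ?thesis using triv[of a b c d] B C by (simp add: moment4_const_def)
    next
      case False
      then have g: "g \<ge> 1" by simp
      have "Q a b c d \<le> (4 * C + 12 * B) * (1 / real g ^ 4)"
      proof (cases "d - c \<le> b - a")
        case True
        then have "g = b - a" by (simp add: g_def)
        then have "mix_bound M (C * real g powr (- s)) (w a) (\<lambda>\<omega>. w b \<omega> * w c \<omega> * w d \<omega>)"
          using that g by (intro mixF) auto
        from dec[OF g this] show ?thesis by (simp add: Q_def mult.assoc)
      next
        case F: False
        then have "g = d - c" by (simp add: g_def)
        then have "mix_bound M (C * real g powr (- s)) (w (c + g)) (\<lambda>\<omega>. w a \<omega> * w b \<omega> * w c \<omega>)"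
          using that g by (intro mixP) auto
        moreover have "c + g = d" using \<open>g = d - c\<close> that by simp
        ultimately show ?thesis using dec[OF g, of d a b c] by (simp add: Q_def mult_ac)
      qed
      also have "1 / real g ^ 4 \<le> 16 / (1 + real g) ^ 4"
      proof -
        have "(1 + real g) ^ 4 \<le> (2 * real g) ^ 4" using g by (intro power_mono) auto
        then show ?thesis using g by (simp add: divide_simps power_mult_distrib)
      qed
      finally have "Q a b c d \<le> (4 * C + 12 * B) * (16 / (1 + real g) ^ 4)"
        using B C by (simp add: mult_left_mono)
      also have "\<dots> = 16 * (4 * C + 12 * B) * (1 / (1 + real g) ^ 4)" by simp
      also have "\<dots> \<le> ?K * (1 / (1 + real g) ^ 4)"
        using B C by (intro mult_right_mono) (auto simp: moment4_const_def)
      finally show ?thesis .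
    qed
    also have "\<dots> \<le> ?K * (dist_weight a b * dist_weight c d)"
      using gw K by (intro mult_left_mono) auto
    finally show ?thesis .
  qed
  have dw: "dist_weight a b \<ge> 0" "dist_weight a b = dist_weight b a" for a b
    by (auto simp: dist_weight_def abs_minus_commute)
  \<comment> \<open>Adding all three pairings makes the right-hand side symmetric in the four times,
    so the sorted case is enough.\<close>
  have Qle: "Q a b c d \<le> ?K * (dist_weight a b * dist_weight c d
      + dist_weight a c * dist_weight b d + dist_weight a d * dist_weight b c)" for a b c d
  proof (rule sorted4_wlog[where P="\<lambda>a b c d. Q a b c d \<le> ?K * (dist_weight a b * dist_weight c d
      + dist_weight a c * dist_weight b d + dist_weight a d * dist_weight b c)"])
    fix a b c d :: nat assume "a \<le> b" "b \<le> c" "c \<le> d"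
    then have "Q a b c d \<le> ?K * (dist_weight a b * dist_weight c d)" by (rule sorted)
    also have "\<dots> \<le> ?K * (dist_weight a b * dist_weight c d
      + dist_weight a c * dist_weight b d + dist_weight a d * dist_weight b c)"
      using K dw by (intro mult_left_mono) auto
    finally show "Q a b c d \<le> \<dots>" .
  qed (simp_all add: Q_def dw(2) mult_ac add_ac)
  have pow4: "(\<Sum>t<m. w t \<omega>) ^ 4 = (\<Sum>a<m. \<Sum>b<m. \<Sum>c<m. \<Sum>d<m. w a \<omega> * w b \<omega> * w c \<omega> * w d \<omega>)" for \<omega>
  proof -
    have "x ^ 4 = (x * x) * (x * x)" for x :: real by (simp add: power4_eq_xxxx mult.assoc)
    then have "(\<Sum>t<m. w t \<omega>) ^ 4 = (\<Sum>a<m. \<Sum>b<m. w a \<omega> * w b \<omega>) * (\<Sum>c<m. \<Sum>d<m. w c \<omega> * w d \<omega>)"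
      by (simp only: sum_product)
    also have "\<dots> = (\<Sum>a<m. \<Sum>b<m. \<Sum>c<m. \<Sum>d<m. (w a \<omega> * w b \<omega>) * (w c \<omega> * w d \<omega>))"
      by (simp only: sum_distrib_right) (simp only: sum_distrib_left)
    finally show ?thesis by (simp only: mult.assoc)
  qed
  have Ele: "expectation (\<lambda>\<omega>. w a \<omega> * w b \<omega> * w c \<omega> * w d \<omega>) \<le> ?K * (dist_weight a b * dist_weight c d
      + dist_weight a c * dist_weight b d + dist_weight a d * dist_weight b c)" for a b c d
    using Qle[of a b c d] unfolding Q_def by linarith
  show "integrable M (\<lambda>\<omega>. (\<Sum>t<m. w t \<omega>) ^ 4)"
    unfolding pow4 by (intro Bochner_Integration.integrable_sum intp)
  have "expectation (\<lambda>\<omega>. (\<Sum>t<m. w t \<omega>) ^ 4)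
      = (\<Sum>a<m. \<Sum>b<m. \<Sum>c<m. \<Sum>d<m. expectation (\<lambda>\<omega>. w a \<omega> * w b \<omega> * w c \<omega> * w d \<omega>))"
    unfolding pow4 using intp by (simp add: Bochner_Integration.integral_sum)
  also have "\<dots> \<le> (\<Sum>a<m. \<Sum>b<m. \<Sum>c<m. \<Sum>d<m. ?K * (dist_weight a b * dist_weight c d
      + dist_weight a c * dist_weight b d + dist_weight a d * dist_weight b c))"
    by (intro sum_mono Ele)
  also have "\<dots> = ?K * (\<Sum>a<m. \<Sum>b<m. \<Sum>c<m. \<Sum>d<m. dist_weight a b * dist_weight c d
      + dist_weight a c * dist_weight b d + dist_weight a d * dist_weight b c)"
    by (simp only: sum_distrib_left)
  also have "\<dots> \<le> ?K * (48 * (real m)\<^sup>2)"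
    using K sum_pair_weights_le[of m] by (intro mult_left_mono)
  finally show "expectation (\<lambda>\<omega>. (\<Sum>t<m. w t \<omega>) ^ 4) \<le> 48 * ?K * (real m)\<^sup>2" by (simp add: mult_ac)
qed

subsection \<open>Lyapunov bound for characteristic functions\<close>

lemma exp_minus_approx:
  fixes x :: real assumes "x \<ge> 0"
  shows "\<bar>exp (- x) - (1 - x)\<bar> \<le> x\<^sup>2"
proof -
  have "exp (- x) \<ge> 1 - x" using exp_ge_add_one_self[of "- x"] by simp
  moreover have "exp (- x) \<le> 1 - x + x\<^sup>2"
  proof -
    have "exp (- x) \<le> 1 / (1 + x)"
      using exp_ge_add_one_self[of x] assms by (simp add: exp_minus field_simps)
    also have "\<dots> \<le> 1 - x + x\<^sup>2"
    proof -
      have "(1 - x + x\<^sup>2) * (1 + x) = 1 + x ^ 3" by (simp add: algebra_simps power2_eq_square power3_eq_cube)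
      then show ?thesis using assms by (simp add: divide_le_eq)
    qed
    finally show ?thesis .
  qed
  ultimately show ?thesis by linarith
qed

lemma (in prob_space) indep_vars_pair:
  assumes "indep_vars (\<lambda>_. borel) X I" "i \<in> I" "j \<in> I" "i \<noteq> j"
  shows "indep_var borel (X i) borel (X j)"
proof -
  have "indep_var (PiM {i} (\<lambda>_. borel)) (\<lambda>\<omega>. restrict (\<lambda>i. X i \<omega>) {i}) (PiM {j} (\<lambda>_. borel)) (\<lambda>\<omega>. restrict (\<lambda>i. X i \<omega>) {j})"
    by (rule indep_var_restrict[OF assms(1)]) (use assms in auto)
  from indep_var_compose[OF this, of "\<lambda>f. f i" borel "\<lambda>f. f j" borel]
  show ?thesis by (simp add: comp_def)
qed

lemma (in prob_space) square_sum_indep: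
  fixes X :: "nat \<Rightarrow> 'a \<Rightarrow> real"
  assumes ind: "indep_vars (\<lambda>_. borel) X {..<n}"
    and i2: "\<And>i. i < n \<Longrightarrow> integrable M (\<lambda>\<omega>. (X i \<omega>)\<^sup>2)" and mean: "\<And>i. i < n \<Longrightarrow> expectation (X i) = 0"
  shows "integrable M (\<lambda>\<omega>. (\<Sum>i<n. X i \<omega>)\<^sup>2)"
    and "expectation (\<lambda>\<omega>. (\<Sum>i<n. X i \<omega>)\<^sup>2) = (\<Sum>i<n. expectation (\<lambda>\<omega>. (X i \<omega>)\<^sup>2))"
proof -
  have rv: "X i \<in> borel_measurable M" if "i < n" for i
    using ind that unfolding indep_vars_def2 by auto
  have i1: "integrable M (X i)" if "i < n" for i
    using square_integrable_imp_integrable[OF rv[OF that] i2[OF that]] .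
  have off: "integrable M (\<lambda>\<omega>. X i \<omega> * X j \<omega>) \<and> expectation (\<lambda>\<omega>. X i \<omega> * X j \<omega>) = (if i = j then expectation (\<lambda>\<omega>. (X i \<omega>)\<^sup>2) else 0)"
    if "i < n" "j < n" for i j
  proof (cases "i = j")
    case True then show ?thesis using i2 that by (simp add: power2_eq_square)
  next
    case False
    have iv: "indep_var borel (X i) borel (X j)" using indep_vars_pair[OF ind] that False by auto
    show ?thesis
      using indep_var_lebesgue_integral[OF iv i1 i1] indep_var_integrable[OF iv i1 i1] that mean False by auto
  qed
  have offi: "integrable M (\<lambda>\<omega>. X i \<omega> * X j \<omega>)" if "i < n" "j < n" for i j
    using off that by blast
  have sq: "(\<Sum>i<n. X i \<omega>)\<^sup>2 = (\<Sum>i<n. \<Sum>j<n. X i \<omega> * X j \<omega>)" for \<omega>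
    by (simp add: power2_eq_square sum_product)
  show "integrable M (\<lambda>\<omega>. (\<Sum>i<n. X i \<omega>)\<^sup>2)"
    unfolding sq by (intro Bochner_Integration.integrable_sum offi) auto
  have "expectation (\<lambda>\<omega>. (\<Sum>i<n. X i \<omega>)\<^sup>2) = (\<Sum>i<n. expectation (\<lambda>\<omega>. \<Sum>j<n. X i \<omega> * X j \<omega>))"
    unfolding sq by (intro Bochner_Integration.integral_sum Bochner_Integration.integrable_sum offi) auto
  also have "\<dots> = (\<Sum>i<n. \<Sum>j<n. expectation (\<lambda>\<omega>. X i \<omega> * X j \<omega>))"
    by (intro sum.cong refl Bochner_Integration.integral_sum offi) auto
  also have "\<dots> = (\<Sum>i<n. \<Sum>j<n. if i = j then expectation (\<lambda>\<omega>. (X i \<omega>)\<^sup>2) else 0)"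
    using off by (intro sum.cong) auto
  also have "\<dots> = (\<Sum>i<n. expectation (\<lambda>\<omega>. (X i \<omega>)\<^sup>2))" by (simp add: sum.delta)
  finally show "expectation (\<lambda>\<omega>. (\<Sum>i<n. X i \<omega>)\<^sup>2) = (\<Sum>i<n. expectation (\<lambda>\<omega>. (X i \<omega>)\<^sup>2))" .
qed

lemma square_le_pow4: "(x::real)\<^sup>2 \<le> 1 + x ^ 4"
proof -
  have "0 \<le> (x\<^sup>2 - 1)\<^sup>2" "0 \<le> x\<^sup>2" by auto
  moreover have "(x\<^sup>2 - 1)\<^sup>2 = x ^ 4 - 2 * x\<^sup>2 + 1" by (simp add: power2_diff flip: power_mult)
  ultimately show ?thesis by linarith
qed

lemma abs_cube_le_pow4: "\<bar>x::real\<bar> ^ 3 \<le> 1 + x ^ 4"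
proof (cases "\<bar>x\<bar> \<le> 1")
  case True
  then have "\<bar>x\<bar> ^ 3 \<le> 1" by (simp add: power_le_one)
  moreover have "0 \<le> x ^ 4" by simp
  ultimately show ?thesis by linarith
next
  case False
  then have "\<bar>x\<bar> ^ 3 \<le> \<bar>x\<bar> ^ 4" by (intro power_increasing) auto
  then show ?thesis by simp
qed

text \<open>The summands form an array that changes with both indices, so a rate is needed instead
  of a limit along a sequence. Each scaled characteristic function and its Gaussian counterpart lie
  within order n^(-3/2) of 1 - v/(2n).\<close>

lemma (in prob_space) lyapunov_char_bound:
  fixes X :: "nat \<Rightarrow> 'a \<Rightarrow> real"
  assumes ind: "indep_vars (\<lambda>_. borel) X {..<n}" and n: "n \<ge> 1"
    and i4: "\<And>i. i < n \<Longrightarrow> integrable M (\<lambda>\<omega>. X i \<omega> ^ 4)" and mean: "\<And>i. i < n \<Longrightarrow> expectation (X i) = 0"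
    and K: "\<And>i. i < n \<Longrightarrow> expectation (\<lambda>\<omega>. X i \<omega> ^ 4) \<le> K"
  defines "V \<equiv> (\<Sum>i<n. expectation (\<lambda>\<omega>. (X i \<omega>)\<^sup>2)) / real n"
  shows "\<bar>expectation (\<lambda>\<omega>. cos ((\<Sum>i<n. X i \<omega>) / sqrt (real n) + b)) - cos b * exp (- V / 2)\<bar> \<le> (1 + K)\<^sup>2 / sqrt (real n)"
proof -
  let ?t = "1 / sqrt (real n)"
  have K0: "K \<ge> 0"
  proof -
    have "0 \<le> expectation (\<lambda>\<omega>. X 0 \<omega> ^ 4)" by (intro Bochner_Integration.integral_nonneg) simp
    moreover have "expectation (\<lambda>\<omega>. X 0 \<omega> ^ 4) \<le> K" using K[of 0] n by simp
    ultimately show ?thesis by (rule order_trans)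
  qed
  have t: "?t > 0" "?t\<^sup>2 = 1 / real n" using n by (simp_all add: power_divide)
  have rv: "X i \<in> borel_measurable M" if "i < n" for i
    using ind that unfolding indep_vars_def2 by auto
  have i2: "integrable M (\<lambda>\<omega>. (X i \<omega>)\<^sup>2)" if "i < n" for i
    by (rule Bochner_Integration.integrable_bound[where f="\<lambda>\<omega>. 1 + X i \<omega> ^ 4"])
      (use i4 rv that square_le_pow4 in auto)
  have i1: "integrable M (X i)" if "i < n" for i
    using square_integrable_imp_integrable[OF rv[OF that] i2[OF that]] .
  define v where "v i = expectation (\<lambda>\<omega>. (X i \<omega>)\<^sup>2)" for i
  have v0: "v i \<ge> 0" for i unfolding v_def by (intro Bochner_Integration.integral_nonneg) simp
  have v1: "v i \<le> 1 + K" if "i < n" for i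
  proof -
    have "v i \<le> expectation (\<lambda>\<omega>. 1 + X i \<omega> ^ 4)"
      unfolding v_def using i2 i4 that square_le_pow4 by (intro integral_mono) auto
    then show ?thesis using i4 K that by (simp add: prob_space) (metis add_left_mono order_trans)
  qed
  define \<phi> where "\<phi> i = char (distr M borel (X i)) ?t" for i
  define \<psi> where "\<psi> i = complex_of_real (exp (- (v i / (2 * real n))))" for i
  have phi1: "cmod (\<phi> i) \<le> 1" if "i < n" for i
    unfolding \<phi>_def
    by (rule real_distribution.cmod_char_le_1[OF real_distribution_distr[OF rv[OF that]]])
  have psi1: "cmod (\<psi> i) \<le> 1" for i using v0[of i] n by (simp add: \<psi>_def)
  have d: "cmod (\<phi> i - \<psi> i) \<le> (1 + K)\<^sup>2 / (real n * sqrt (real n))" if "i < n" for i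
  proof -
    have a: "cmod (\<phi> i - (1 - ?t\<^sup>2 * v i / 2)) \<le> (?t\<^sup>2 / 6) * expectation (\<lambda>x. min (6 * (X i x)\<^sup>2) (\<bar>?t\<bar> * \<bar>X i x\<bar>^3))"
      unfolding \<phi>_def
      by (rule char_approx3') (use rv i1 i2 mean that in \<open>auto simp: v_def\<close>)
    \<comment> \<open>The cubic entry of the minimum is kept because it carries the extra factor
      n^(-1/2); |x|^3 is absorbed by 1 + x^4.\<close>
    have "expectation (\<lambda>x. min (6 * (X i x)\<^sup>2) (\<bar>?t\<bar> * \<bar>X i x\<bar>^3)) \<le> expectation (\<lambda>x. ?t * (1 + X i x ^ 4))"
    proof (rule integral_mono)
      show "integrable M (\<lambda>x. min (6 * (X i x)\<^sup>2) (\<bar>?t\<bar> * \<bar>X i x\<bar>^3))"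
        by (rule Bochner_Integration.integrable_bound[where f="\<lambda>x. 6 * (X i x)\<^sup>2"])
          (use i2 rv that in auto)
      show "integrable M (\<lambda>x. ?t * (1 + X i x ^ 4))" using i4 that by auto
      fix x
      have "?t * \<bar>X i x\<bar> ^ 3 \<le> ?t * (1 + X i x ^ 4)"
        using t(1) by (intro mult_left_mono abs_cube_le_pow4) auto
      then show "min (6 * (X i x)\<^sup>2) (\<bar>?t\<bar> * \<bar>X i x\<bar>^3) \<le> ?t * (1 + X i x ^ 4)"
        using t(1) by (simp add: min.coboundedI2)
    qed
    also have "\<dots> = ?t * (1 + expectation (\<lambda>x. X i x ^ 4))" using i4 that by (simp add: prob_space)
    also have "\<dots> \<le> ?t * (1 + K)" using K that t by (intro mult_left_mono) auto
    finally have "(?t\<^sup>2 / 6) * expectation (\<lambda>x. min (6 * (X i x)\<^sup>2) (\<bar>?t\<bar> * \<bar>X i x\<bar>^3)) \<le> (?t\<^sup>2 / 6) * (?t * (1 + K))"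
      by (intro mult_left_mono) auto
    with a have a': "cmod (\<phi> i - (1 - ?t\<^sup>2 * v i / 2)) \<le> (1 + K) / (6 * (real n * sqrt (real n)))"
      unfolding t(2) by (simp add: field_simps)
    have "cmod (\<psi> i - (1 - ?t\<^sup>2 * v i / 2)) = \<bar>exp (- (v i / (2 * real n))) - (1 - v i / (2 * real n))\<bar>"
      unfolding \<psi>_def t(2) by (simp add: mult.commute flip: norm_of_real[where 'a=complex])
    also have "\<dots> \<le> (v i / (2 * real n))\<^sup>2" using v0[of i] by (intro exp_minus_approx) simp
    also have "\<dots> \<le> ((1 + K) / (2 * real n))\<^sup>2"
      using v0[of i] v1[OF that] by (intro power_mono divide_right_mono) auto
    also have "\<dots> = (1 + K)\<^sup>2 / 4 / (real n * real n)" by (simp add: power2_eq_square)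
    also have "\<dots> \<le> (1 + K)\<^sup>2 / 4 / (real n * sqrt (real n))"
      using n by (intro divide_left_mono mult_left_mono mult_pos_pos) (auto simp: sqrt_le_D real_le_lsqrt power2_eq_square)
    finally have b': "cmod (\<psi> i - (1 - ?t\<^sup>2 * v i / 2)) \<le> (1 + K)\<^sup>2 / 4 / (real n * sqrt (real n))" .
    have "(1 + K) * 1 \<le> (1 + K) * (1 + K)" using K0 by (intro mult_left_mono) auto
    then have K2: "1 + K \<le> (1 + K)\<^sup>2" by (simp add: power2_eq_square)
    have "cmod (\<phi> i - \<psi> i) \<le> (1 + K) / (6 * (real n * sqrt (real n))) + (1 + K)\<^sup>2 / 4 / (real n * sqrt (real n))"
      using norm_triangle_ineq4[of "\<phi> i - (1 - ?t\<^sup>2 * v i / 2)" "\<psi> i - (1 - ?t\<^sup>2 * v i / 2)"] a' b' by simp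
    also have "\<dots> = ((1 + K) / 6 + (1 + K)\<^sup>2 / 4) / (real n * sqrt (real n))" using n by (simp add: field_simps)
    also have "\<dots> \<le> (1 + K)\<^sup>2 / (real n * sqrt (real n))"
    proof (intro divide_right_mono)
      show "(1 + K) / 6 + (1 + K)\<^sup>2 / 4 \<le> (1 + K)\<^sup>2"
      proof -
        have "(1 + K) / 6 + q / 4 \<le> q" if "1 + K \<le> q" "0 \<le> q" for q :: real
          using that by (simp add: field_simps)
        then show ?thesis using K2 by simp
      qed
    qed simp
    finally show ?thesis .
  qed
  have phi: "expectation (\<lambda>\<omega>. iexp ((\<Sum>i<n. X i \<omega>) / sqrt (real n))) = (\<Prod>i<n. \<phi> i)"
  proof -
    have m: "(\<lambda>\<omega>. \<Sum>i<n. X i \<omega>) \<in> borel_measurable M" using rv by (intro borel_measurable_sum) auto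
    have "expectation (\<lambda>\<omega>. iexp ((\<Sum>i<n. X i \<omega>) / sqrt (real n))) = char (distr M borel (\<lambda>\<omega>. \<Sum>i<n. X i \<omega>)) ?t"
      unfolding char_def by (subst integral_distr[OF m]) auto
    then show ?thesis unfolding \<phi>_def using char_distr_sum[OF ind] by simp
  qed
  have psi: "(\<Prod>i<n. \<psi> i) = complex_of_real (exp (- V / 2))"
    unfolding \<psi>_def V_def v_def[symmetric] of_real_prod[symmetric]
    by (simp add: exp_sum[symmetric] sum_negf sum_divide_distrib field_simps)
  \<comment> \<open>All factors have modulus at most 1, so the difference of the products is at most
    the sum of \<open>n\<close> differences of order n^(-3/2).\<close>
  have "cmod (expectation (\<lambda>\<omega>. iexp ((\<Sum>i<n. X i \<omega>) / sqrt (real n))) - complex_of_real (exp (- V / 2)))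
      \<le> (\<Sum>i<n. cmod (\<phi> i - \<psi> i))"
    unfolding phi psi[symmetric] using phi1 psi1 by (intro norm_prod_diff) auto
  also have "\<dots> \<le> (\<Sum>i<n. (1 + K)\<^sup>2 / (real n * sqrt (real n)))" by (intro sum_mono d) auto
  also have "\<dots> = (1 + K)\<^sup>2 / sqrt (real n)" using n by simp
  finally have main: "cmod (expectation (\<lambda>\<omega>. iexp ((\<Sum>i<n. X i \<omega>) / sqrt (real n))) - complex_of_real (exp (- V / 2))) \<le> (1 + K)\<^sup>2 / sqrt (real n)" .
  have m: "(\<lambda>\<omega>. (\<Sum>i<n. X i \<omega>) / sqrt (real n)) \<in> borel_measurable M" using rv by (intro borel_measurable_divide borel_measurable_sum) auto
  have ii: "integrable M (\<lambda>\<omega>. iexp ((\<Sum>i<n. X i \<omega>) / sqrt (real n)))"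
    by (rule integrable_const_bound[where B=1]) (use m in \<open>auto simp del: of_real_divide of_real_sum\<close>)
  have "expectation (\<lambda>\<omega>. cos ((\<Sum>i<n. X i \<omega>) / sqrt (real n) + b)) = expectation (\<lambda>\<omega>. Re (iexp b * iexp ((\<Sum>i<n. X i \<omega>) / sqrt (real n))))"
    by (intro Bochner_Integration.integral_cong) (auto simp: Re_exp Im_exp cos_add)
  also have "\<dots> = Re (iexp b * expectation (\<lambda>\<omega>. iexp ((\<Sum>i<n. X i \<omega>) / sqrt (real n))))"
    using ii by (subst integral_Re) auto
  finally have "expectation (\<lambda>\<omega>. cos ((\<Sum>i<n. X i \<omega>) / sqrt (real n) + b)) - cos b * exp (- V / 2)
    = Re (iexp b * (expectation (\<lambda>\<omega>. iexp ((\<Sum>i<n. X i \<omega>) / sqrt (real n))) - complex_of_real (exp (- V / 2))))"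
    by (simp add: Re_exp Im_exp algebra_simps)
  then have "\<bar>expectation (\<lambda>\<omega>. cos ((\<Sum>i<n. X i \<omega>) / sqrt (real n) + b)) - cos b * exp (- V / 2)\<bar>
    \<le> cmod (iexp b * (expectation (\<lambda>\<omega>. iexp ((\<Sum>i<n. X i \<omega>) / sqrt (real n))) - complex_of_real (exp (- V / 2))))"
    by (metis abs_Re_le_cmod)
  also have "\<dots> \<le> (1 + K)\<^sup>2 / sqrt (real n)" using main by (simp add: norm_mult)
  finally show ?thesis .
qed

subsection \<open>Unit-level partial sums of the panel\<close>

lemma powr_add_le:
  fixes a b p :: real
  assumes "a \<ge> 0" "b \<ge> 0" "p > 0"
  shows "(a + b) powr p \<le> 2 powr p * (a powr p + b powr p)"
proof -
  have "(a + b) powr p \<le> (2 * max a b) powr p" using assms by (intro powr_mono2) auto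
  also have "\<dots> = 2 powr p * max a b powr p" using assms by (simp add: powr_mult)
  also have "\<dots> \<le> 2 powr p * (a powr p + b powr p)" by (intro mult_left_mono) (auto simp: max_def)
  finally show ?thesis .
qed

text \<open>Independence removes the cross terms, and centring can only lower a second moment, so
  bounds on raw second moments suffice.\<close>

lemma (in prob_space) square_sum_centered_le:
  fixes Y :: "nat \<Rightarrow> 'a \<Rightarrow> real"
  assumes ind: "indep_vars (\<lambda>_. borel) Y {..<n}"
    and i2: "\<And>i. i < n \<Longrightarrow> integrable M (\<lambda>\<omega>. (Y i \<omega>)\<^sup>2)" and K: "\<And>i. i < n \<Longrightarrow> expectation (\<lambda>\<omega>. (Y i \<omega>)\<^sup>2) \<le> K"
  shows "integrable M (\<lambda>\<omega>. (\<Sum>i<n. Y i \<omega> - expectation (Y i))\<^sup>2)"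
    and "expectation (\<lambda>\<omega>. (\<Sum>i<n. Y i \<omega> - expectation (Y i))\<^sup>2) \<le> real n * K"
proof -
  let ?Y = "\<lambda>i \<omega>. Y i \<omega> - expectation (Y i)"
  have rv: "Y i \<in> borel_measurable M" if "i < n" for i
    using ind that unfolding indep_vars_def2 by auto
  have i1: "integrable M (Y i)" if "i < n" for i
    using square_integrable_imp_integrable[OF rv[OF that] i2[OF that]] .
  have ind': "indep_vars (\<lambda>_. borel) ?Y {..<n}"
    by (rule indep_vars_compose2[OF ind]) auto
  have sq: "(?Y i \<omega>)\<^sup>2 = (Y i \<omega>)\<^sup>2 - 2 * expectation (Y i) * Y i \<omega> + (expectation (Y i))\<^sup>2" for i \<omega>
    by (simp add: power2_diff)
  have i2': "integrable M (\<lambda>\<omega>. (?Y i \<omega>)\<^sup>2)" if "i < n" for i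
    unfolding sq using i1 i2 that by auto
  have E0: "expectation (?Y i) = 0" if "i < n" for i using i1 that by (simp add: prob_space)
  have E2: "expectation (\<lambda>\<omega>. (?Y i \<omega>)\<^sup>2) \<le> K" if "i < n" for i
  proof -
    have "expectation (\<lambda>\<omega>. (?Y i \<omega>)\<^sup>2) = expectation (\<lambda>\<omega>. (Y i \<omega>)\<^sup>2) - (expectation (Y i))\<^sup>2"
      unfolding sq using i1 i2 that by (simp add: prob_space power2_eq_square)
    then show ?thesis using K[OF that] zero_le_power2[of "expectation (Y i)"] by linarith
  qed
  show "integrable M (\<lambda>\<omega>. (\<Sum>i<n. ?Y i \<omega>)\<^sup>2)"
    by (rule square_sum_indep(1)[OF ind']) (use i2' E0 in auto)
  have "expectation (\<lambda>\<omega>. (\<Sum>i<n. ?Y i \<omega>)\<^sup>2) = (\<Sum>i<n. expectation (\<lambda>\<omega>. (?Y i \<omega>)\<^sup>2))"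
    by (rule square_sum_indep(2)[OF ind']) (use i2' E0 in auto)
  also have "\<dots> \<le> (\<Sum>i<n. K)" using E2 by (intro sum_mono) auto
  finally show "expectation (\<lambda>\<omega>. (\<Sum>i<n. ?Y i \<omega>)\<^sup>2) \<le> real n * K" by simp
qed

lemma square_mult_le_pow4: "((x::real) * y)\<^sup>2 \<le> (x ^ 4 + y ^ 4) / 2"
proof -
  have "0 \<le> (x\<^sup>2 - y\<^sup>2)\<^sup>2" by simp
  then show ?thesis by (simp add: power2_diff power_mult_distrib flip: power_mult)
qed

lemma (in prob_space) product_second_moment:
  fixes X Y :: "'a \<Rightarrow> real"
  assumes [measurable]: "X \<in> borel_measurable M" "Y \<in> borel_measurable M"
    and i: "integrable M (\<lambda>\<omega>. X \<omega> ^ 4)" "integrable M (\<lambda>\<omega>. Y \<omega> ^ 4)"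
    and K: "expectation (\<lambda>\<omega>. X \<omega> ^ 4) \<le> K" "expectation (\<lambda>\<omega>. Y \<omega> ^ 4) \<le> K"
  shows "integrable M (\<lambda>\<omega>. (X \<omega> * Y \<omega>)\<^sup>2)" and "expectation (\<lambda>\<omega>. (X \<omega> * Y \<omega>)\<^sup>2) \<le> K"
proof -
  show 1: "integrable M (\<lambda>\<omega>. (X \<omega> * Y \<omega>)\<^sup>2)"
    by (rule Bochner_Integration.integrable_bound[where f="\<lambda>\<omega>. (X \<omega> ^ 4 + Y \<omega> ^ 4) / 2"])
      (use i square_mult_le_pow4 in auto)
  have "expectation (\<lambda>\<omega>. (X \<omega> * Y \<omega>)\<^sup>2) \<le> expectation (\<lambda>\<omega>. (X \<omega> ^ 4 + Y \<omega> ^ 4) / 2)"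
    using i 1 square_mult_le_pow4 by (intro integral_mono) auto
  also have "\<dots> \<le> K" using i K by simp
  finally show "expectation (\<lambda>\<omega>. (X \<omega> * Y \<omega>)\<^sup>2) \<le> K" .
qed

lemma borel_measurable_fst_borel [measurable]: "fst \<in> borel_measurable (borel :: ('a::topological_space \<times> 'b::topological_space) measure)"
  by (intro borel_measurable_continuous_onI continuous_intros)

lemma borel_measurable_snd_borel [measurable]: "snd \<in> borel_measurable (borel :: ('a::topological_space \<times> 'b::topological_space) measure)"
  by (intro borel_measurable_continuous_onI continuous_intros)

lemma borel_measurable_vec_nth' [measurable (raw)]:
  fixes f :: "'a \<Rightarrow> real^'k"
  assumes "f \<in> borel_measurable M"
  shows "(\<lambda>\<omega>. f \<omega> $ a) \<in> borel_measurable M"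
  by (rule borel_measurable_continuous_on[OF _ assms]) (intro continuous_intros)

text \<open>Here \<open>p\<close> is 2r, and the condition on \<open>s\<close> is the mixing rate
  rewritten as a decay exponent of at least 4. One constant \<open>B\<close> serves all p-th
  moments, including those of the product of error and regressor; nothing depends on the unit or
  period.\<close>

locale panel = prob_space M for M :: "'a measure" +
  fixes x :: "nat \<Rightarrow> nat \<Rightarrow> 'a \<Rightarrow> real^'k" and eps :: "nat \<Rightarrow> nat \<Rightarrow> 'a \<Rightarrow> real" and p s B C :: real
  assumes x_meas [measurable]: "\<And>i t. x i t \<in> borel_measurable M"
    and eps_meas [measurable]: "\<And>i t. eps i t \<in> borel_measurable M"
    and mean_eps: "\<And>i t. expectation (eps i t) = 0"
    and orth: "\<And>i t. (\<integral>\<omega>. eps i t \<omega> *\<^sub>R x i t \<omega> \<partial>M) = 0"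
    and p: "p > 4" and s: "s * (p - 4) / p \<ge> 4" and B: "B \<ge> 0" and C: "C \<ge> 0"
    and x_mom: "\<And>i t. integrable M (\<lambda>\<omega>. norm (x i t \<omega>) powr p) \<and> expectation (\<lambda>\<omega>. norm (x i t \<omega>) powr p) \<le> B"
    and eps_mom: "\<And>i t. integrable M (\<lambda>\<omega>. \<bar>eps i t \<omega>\<bar> powr p) \<and> expectation (\<lambda>\<omega>. \<bar>eps i t \<omega>\<bar> powr p) \<le> B"
    and ex_mom: "\<And>i t. integrable M (\<lambda>\<omega>. norm (eps i t \<omega> *\<^sub>R x i t \<omega>) powr p)
       \<and> expectation (\<lambda>\<omega>. norm (eps i t \<omega> *\<^sub>R x i t \<omega>) powr p) \<le> B"
    and indep: "indep_vars (\<lambda>_. PiM UNIV (\<lambda>_. borel)) (\<lambda>i \<omega> t. (x i t \<omega>, eps i t \<omega>)) UNIV"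
    and stationary: "\<And>i h. distr M (PiM UNIV (\<lambda>_. borel)) (\<lambda>\<omega> t. (x i (t + h) \<omega>, eps i (t + h) \<omega>))
                          = distr M (PiM UNIV (\<lambda>_. borel)) (\<lambda>\<omega> t. (x i t \<omega>, eps i t \<omega>))"
    and mixing: "\<And>i h. h \<ge> 1 \<Longrightarrow>
                   alpha_mixing_coef M (\<lambda>t \<omega>. (x i t \<omega>, eps i t \<omega>)) h \<le> C * real h powr (- s)"
begin

abbreviation z :: "nat \<Rightarrow> nat \<Rightarrow> 'a \<Rightarrow> real^'k" where "z \<equiv> zc M x"

text \<open>The trajectory of a unit as a single random element of sequence space: independence
  across units and stationarity are both statements about the laws of these elements, and pass to
  measurable functionals.\<close>

definition path :: "nat \<Rightarrow> 'a \<Rightarrow> nat \<Rightarrow> (real^'k) \<times> real" where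
  "path i \<omega> t = (x i t \<omega>, eps i t \<omega>)"

lemma path_measurable [measurable]: "path i \<in> measurable M (PiM UNIV (\<lambda>_. borel))"
  by (rule measurable_PiM_single') (auto simp: path_def)

lemma expectation_shift:
  fixes F :: "(nat \<Rightarrow> (real^'k) \<times> real) \<Rightarrow> 'c::{banach, second_countable_topology}"
  assumes F: "F \<in> borel_measurable (PiM UNIV (\<lambda>_. borel))"
  shows "(\<integral>\<omega>. F (\<lambda>t. path i \<omega> (t + h)) \<partial>M) = (\<integral>\<omega>. F (path i \<omega>) \<partial>M)"
proof -
  have m: "(\<lambda>\<omega> t. path i \<omega> (t + h)) \<in> measurable M (PiM UNIV (\<lambda>_. borel))"
    by (rule measurable_PiM_single') (auto simp: path_def)
  have e: "distr M (PiM UNIV (\<lambda>_. borel)) (\<lambda>\<omega> t. path i \<omega> (t + h)) = distr M (PiM UNIV (\<lambda>_. borel)) (path i)"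
    using stationary[of i h] unfolding path_def[abs_def] .
  show ?thesis
    using integral_distr[OF m F] integral_distr[OF path_measurable F, of i] unfolding e by simp
qed

lemma path_indep:
  assumes "\<And>i. G i \<in> borel_measurable (PiM UNIV (\<lambda>_. borel))"
  shows "indep_vars (\<lambda>_. borel) (\<lambda>i \<omega>. G i (path i \<omega>)) I"
proof -
  have "indep_vars (\<lambda>_. PiM UNIV (\<lambda>_. borel)) path I"
    using indep_vars_subset[OF indep, of I] unfolding path_def[abs_def] by auto
  from indep_vars_compose2[OF this, of G "\<lambda>_. borel"] assms show ?thesis by auto
qed

lemma x_integrable: "integrable M (x i t)" and norm_mean_x: "norm (expectation (x i t)) \<le> 1 + B"
proof -
  have n: "integrable M (\<lambda>\<omega>. norm (x i t \<omega>))"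
    by (rule Bochner_Integration.integrable_bound[where f="\<lambda>\<omega>. 2 + norm (x i t \<omega>) powr p"])
      (use x_mom p in \<open>auto intro!: AE_I2 order_trans[OF abs_le_pow4[of "norm _", simplified]] order_trans[OF add_left_mono[OF pow4_le_powr[OF p]]]\<close>)
  show "integrable M (x i t)" by (rule integrable_norm_cancel) (use n in auto)
  have le: "norm (x i t \<omega>) \<le> 1 + norm (x i t \<omega>) powr p" for \<omega>
  proof (cases "norm (x i t \<omega>) \<le> 1")
    case False
    then have "norm (x i t \<omega>) powr 1 \<le> norm (x i t \<omega>) powr p" using p by (intro powr_mono) auto
    then show ?thesis using False by simp
  qed (simp add: add_increasing2)
  have "norm (expectation (x i t)) \<le> expectation (\<lambda>\<omega>. norm (x i t \<omega>))" by (rule integral_norm_bound)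
  also have "\<dots> \<le> expectation (\<lambda>\<omega>. 1 + norm (x i t \<omega>) powr p)"
    using n x_mom le by (intro integral_mono) auto
  also have "\<dots> \<le> 1 + B" using x_mom[of i t] by (simp add: prob_space)
  finally show "norm (expectation (x i t)) \<le> 1 + B" .
qed

lemma mean_x_const: "expectation (x i t) = expectation (x i 0)"
  using expectation_shift[of "\<lambda>h. fst (h 0)" i t] by (simp add: path_def)

lemma zc_path: "z i t \<omega> = fst (path i \<omega> t) - expectation (x i 0)"
  by (simp add: zc_def path_def mean_x_const[of i t])

lemma z_meas [measurable]: "z i t \<in> borel_measurable M"
  unfolding zc_def[abs_def] by measurable

text \<open>\<open>B1\<close> bounds the p-th moments of \<open>z\<close>, of \<open>eps\<close>
  times \<open>z\<close> and of \<open>eps\<close>. The factor 2^p comes from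
  \<open>powr_add_le\<close>, (1 + B)^p from the mean of \<open>x\<close>, and the last 1 + B
  dominates both the constant 1 and the moment of \<open>eps\<close>. \<open>K4 c\<close> is the
  resulting fourth-moment constant for linear forms with coefficient norm at most
  \<open>c\<close>.\<close>

definition B1 :: real where "B1 = 2 powr p * (B + (1 + B) powr p * (1 + B))"
definition K4 :: "real \<Rightarrow> real" where "K4 c = 48 * moment4_const (c powr p * B1) C"

lemma B1: "B1 \<ge> 0" "B \<le> B1"
proof -
  show "B1 \<ge> 0" using B by (simp add: B1_def)
  have "1 * B \<le> 2 powr p * (B + (1 + B) powr p * (1 + B))"
    using B p by (intro mult_mono) (auto intro: ge_one_powr_ge_zero)
  then show "B \<le> B1" by (simp add: B1_def)
qed

lemma K4_nonneg: "K4 c \<ge> 0"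
  using B1 C by (simp add: K4_def moment4_const_def)

lemma z_mom: "integrable M (\<lambda>\<omega>. norm (z i t \<omega>) powr p)" "expectation (\<lambda>\<omega>. norm (z i t \<omega>) powr p) \<le> B1"
proof -
  let ?g = "\<lambda>\<omega>. 2 powr p * (norm (x i t \<omega>) powr p + (1 + B) powr p)"
  have le: "norm (z i t \<omega>) powr p \<le> ?g \<omega>" for \<omega>
  proof -
    have "norm (z i t \<omega>) \<le> norm (x i t \<omega>) + (1 + B)"
      unfolding zc_def using norm_triangle_ineq4[of "x i t \<omega>" "expectation (x i t)"] norm_mean_x[of i t] by linarith
    then have "norm (z i t \<omega>) powr p \<le> (norm (x i t \<omega>) + (1 + B)) powr p" using p by (intro powr_mono2) auto
    also have "\<dots> \<le> ?g \<omega>" using p B by (intro powr_add_le) auto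
    finally show ?thesis .
  qed
  have ig: "integrable M ?g" using x_mom by auto
  show i: "integrable M (\<lambda>\<omega>. norm (z i t \<omega>) powr p)"
    by (rule Bochner_Integration.integrable_bound[OF ig]) (use le in \<open>auto intro!: AE_I2 intro: order_trans[OF _ abs_ge_self]\<close>)
  have "expectation (\<lambda>\<omega>. norm (z i t \<omega>) powr p) \<le> expectation ?g" using i ig le by (intro integral_mono) auto
  also have "\<dots> \<le> 2 powr p * (B + (1 + B) powr p)" using x_mom[of i t] by (simp add: prob_space)
  also have "\<dots> \<le> B1" unfolding B1_def using B by (intro mult_left_mono add_left_mono) (auto simp: mult_le_cancel_left1)
  finally show "expectation (\<lambda>\<omega>. norm (z i t \<omega>) powr p) \<le> B1" .
qed

lemma ez_mom: "integrable M (\<lambda>\<omega>. norm (eps i t \<omega> *\<^sub>R z i t \<omega>) powr p)"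
  "expectation (\<lambda>\<omega>. norm (eps i t \<omega> *\<^sub>R z i t \<omega>) powr p) \<le> B1"
proof -
  let ?g = "\<lambda>\<omega>. 2 powr p * (norm (eps i t \<omega> *\<^sub>R x i t \<omega>) powr p + (1 + B) powr p * \<bar>eps i t \<omega>\<bar> powr p)"
  have le: "norm (eps i t \<omega> *\<^sub>R z i t \<omega>) powr p \<le> ?g \<omega>" for \<omega>
  proof -
    have "norm (eps i t \<omega> *\<^sub>R z i t \<omega>) \<le> norm (eps i t \<omega> *\<^sub>R x i t \<omega>) + norm (eps i t \<omega> *\<^sub>R expectation (x i t))"
      unfolding zc_def scaleR_diff_right by (rule norm_triangle_ineq4)
    also have "norm (eps i t \<omega> *\<^sub>R expectation (x i t)) \<le> (1 + B) * \<bar>eps i t \<omega>\<bar>"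
      using mult_left_mono[OF norm_mean_x[of i t], of "\<bar>eps i t \<omega>\<bar>"] by (simp add: mult.commute)
    finally have "norm (eps i t \<omega> *\<^sub>R z i t \<omega>) powr p \<le> (norm (eps i t \<omega> *\<^sub>R x i t \<omega>) + (1 + B) * \<bar>eps i t \<omega>\<bar>) powr p"
      using p by (intro powr_mono2) auto
    also have "\<dots> \<le> 2 powr p * (norm (eps i t \<omega> *\<^sub>R x i t \<omega>) powr p + ((1 + B) * \<bar>eps i t \<omega>\<bar>) powr p)"
      using p B by (intro powr_add_le) auto
    also have "((1 + B) * \<bar>eps i t \<omega>\<bar>) powr p = (1 + B) powr p * \<bar>eps i t \<omega>\<bar> powr p"
      using B by (simp add: powr_mult)
    finally show ?thesis .
  qed
  have ig: "integrable M ?g" using ex_mom eps_mom by auto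
  show i: "integrable M (\<lambda>\<omega>. norm (eps i t \<omega> *\<^sub>R z i t \<omega>) powr p)"
    by (rule Bochner_Integration.integrable_bound[OF ig]) (use le in \<open>auto intro!: AE_I2 intro: order_trans[OF _ abs_ge_self] simp del: norm_scaleR\<close>)
  have "expectation (\<lambda>\<omega>. norm (eps i t \<omega> *\<^sub>R z i t \<omega>) powr p) \<le> expectation ?g" using i ig le by (intro integral_mono) auto
  also have "\<dots> = 2 powr p * (expectation (\<lambda>\<omega>. norm (eps i t \<omega> *\<^sub>R x i t \<omega>) powr p)
      + (1 + B) powr p * expectation (\<lambda>\<omega>. \<bar>eps i t \<omega>\<bar> powr p))"
    using ex_mom[of i t] eps_mom[of i t] by (simp del: norm_scaleR)
  also have "\<dots> \<le> 2 powr p * (B + (1 + B) powr p * (1 + B))"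
    using ex_mom[of i t] eps_mom[of i t] B by (intro mult_left_mono add_mono) (auto simp del: norm_scaleR)
  finally show "expectation (\<lambda>\<omega>. norm (eps i t \<omega> *\<^sub>R z i t \<omega>) powr p) \<le> B1" by (simp add: B1_def)
qed

text \<open>Functions of single coordinates of the path belong to its past or its future. Isolating
  the first time puts one variable in the past and three in the future; isolating the last reverses
  the roles, which needs the symmetry of \<open>mix_bound\<close>.\<close>

lemma process_fourth_moment:
  assumes f [measurable]: "f \<in> borel_measurable borel" and B': "B' \<ge> 0"
    and int: "\<And>t. integrable M (\<lambda>\<omega>. \<bar>f (path i \<omega> t)\<bar> powr p)"
    and mom: "\<And>t. expectation (\<lambda>\<omega>. \<bar>f (path i \<omega> t)\<bar> powr p) \<le> B'"
    and mean: "\<And>t. expectation (\<lambda>\<omega>. f (path i \<omega> t)) = 0"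
  shows "integrable M (\<lambda>\<omega>. (\<Sum>t<m. f (path i \<omega> t)) ^ 4)"
    and "expectation (\<lambda>\<omega>. (\<Sum>t<m. f (path i \<omega> t)) ^ 4) \<le> 48 * moment4_const B' C * (real m)\<^sup>2"
proof -
  have meas: "(\<lambda>\<omega>. f (path i \<omega> t)) \<in> borel_measurable M" for t by measurable
  have comp: "(\<lambda>h. f (h u)) \<in> borel_measurable (PiM S (\<lambda>_. borel))" if "u \<in> S" for u :: nat and S
    by (rule measurable_compose[OF measurable_component_singleton[OF that] f])
  have mixF: "mix_bound M (C * real g powr (- s)) (\<lambda>\<omega>. f (path i \<omega> t)) (\<lambda>\<omega>. f (path i \<omega> a) * f (path i \<omega> b) * f (path i \<omega> c))"
    if "g \<ge> 1" "t + g \<le> a" "t + g \<le> b" "t + g \<le> c" for t g a b c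
  proof -
    have m1: "(\<lambda>h. f (h t)) \<in> borel_measurable (PiM {..t} (\<lambda>_. borel))" by (intro comp) simp
    have m2: "(\<lambda>h. f (h a) * f (h b) * f (h c)) \<in> borel_measurable (PiM {t + g..} (\<lambda>_. borel))"
      using that by (intro borel_measurable_times comp) auto
    have "mix_bound M (alpha_mixing_coef M (\<lambda>t \<omega>. (x i t \<omega>, eps i t \<omega>)) g) (\<lambda>\<omega>. f (path i \<omega> t)) (\<lambda>\<omega>. f (path i \<omega> a) * f (path i \<omega> b) * f (path i \<omega> c))"
      using alpha_mixing_coef_mix_bound[OF m1 m2, of "\<lambda>t \<omega>. (x i t \<omega>, eps i t \<omega>)"] that by (simp add: path_def)
    then show ?thesis by (rule mix_bound_mono) (use mixing that in auto)
  qed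
  have mixP: "mix_bound M (C * real g powr (- s)) (\<lambda>\<omega>. f (path i \<omega> (t + g))) (\<lambda>\<omega>. f (path i \<omega> a) * f (path i \<omega> b) * f (path i \<omega> c))"
    if "g \<ge> 1" "a \<le> t" "b \<le> t" "c \<le> t" for t g a b c
  proof -
    have m2: "(\<lambda>h. f (h (t + g))) \<in> borel_measurable (PiM {t + g..} (\<lambda>_. borel))" by (intro comp) simp
    have m1: "(\<lambda>h. f (h a) * f (h b) * f (h c)) \<in> borel_measurable (PiM {..t} (\<lambda>_. borel))"
      using that by (intro borel_measurable_times comp) auto
    have "mix_bound M (alpha_mixing_coef M (\<lambda>t \<omega>. (x i t \<omega>, eps i t \<omega>)) g) (\<lambda>\<omega>. f (path i \<omega> a) * f (path i \<omega> b) * f (path i \<omega> c)) (\<lambda>\<omega>. f (path i \<omega> (t + g)))"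
      using alpha_mixing_coef_mix_bound[OF m1 m2, of "\<lambda>t \<omega>. (x i t \<omega>, eps i t \<omega>)"] that by (simp add: path_def)
    then show ?thesis by (rule mix_bound_mono[OF mix_bound_sym]) (use mixing that in auto)
  qed
  show "integrable M (\<lambda>\<omega>. (\<Sum>t<m. f (path i \<omega> t)) ^ 4)"
    by (rule fourth_moment_sum(1)[where w="\<lambda>t \<omega>. f (path i \<omega> t)", OF meas p s B' C int mom mean]) (fact mixF mixP)+
  show "expectation (\<lambda>\<omega>. (\<Sum>t<m. f (path i \<omega> t)) ^ 4) \<le> 48 * moment4_const B' C * (real m)\<^sup>2"
    by (rule fourth_moment_sum(2)[where w="\<lambda>t \<omega>. f (path i \<omega> t)", OF meas p s B' C int mom mean]) (fact mixF mixP)+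
qed

definition Zs :: "nat \<Rightarrow> nat \<Rightarrow> 'a \<Rightarrow> real^'k" where "Zs m i \<omega> = (\<Sum>t<m. z i t \<omega>)"
definition Es :: "nat \<Rightarrow> nat \<Rightarrow> 'a \<Rightarrow> real" where "Es m i \<omega> = (\<Sum>t<m. eps i t \<omega>)"
definition Us :: "nat \<Rightarrow> nat \<Rightarrow> 'a \<Rightarrow> real^'k" where "Us m i \<omega> = (\<Sum>t<m. eps i t \<omega> *\<^sub>R z i t \<omega>)"

lemma sums_meas [measurable]:
  "Zs m i \<in> borel_measurable M" "Es m i \<in> borel_measurable M" "Us m i \<in> borel_measurable M"
  unfolding Zs_def[abs_def] Es_def[abs_def] Us_def[abs_def] by measurable

lemma eps_integrable: "integrable M (eps i t)"
  by (rule Bochner_Integration.integrable_bound[where f="\<lambda>\<omega>. 2 + \<bar>eps i t \<omega>\<bar> powr p"])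
    (use eps_mom p in \<open>auto intro!: AE_I2 order_trans[OF abs_le_pow4] order_trans[OF add_left_mono[OF pow4_le_powr[OF p]]]\<close>)

lemma ez_integrable: "integrable M (\<lambda>\<omega>. eps i t \<omega> *\<^sub>R z i t \<omega>)"
  and ez_mean: "(\<integral>\<omega>. eps i t \<omega> *\<^sub>R z i t \<omega> \<partial>M) = 0"
proof -
  have n: "integrable M (\<lambda>\<omega>. norm (eps i t \<omega> *\<^sub>R x i t \<omega>))"
    by (rule Bochner_Integration.integrable_bound[where f="\<lambda>\<omega>. 2 + norm (eps i t \<omega> *\<^sub>R x i t \<omega>) powr p"])
      (use ex_mom p in \<open>auto intro!: AE_I2 order_trans[OF abs_le_pow4[of "norm _", simplified]] order_trans[OF add_left_mono[OF pow4_le_powr[OF p]]] simp del: norm_scaleR\<close>)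
  have i: "integrable M (\<lambda>\<omega>. eps i t \<omega> *\<^sub>R x i t \<omega>)" by (rule integrable_norm_cancel) (use n in auto)
  show "integrable M (\<lambda>\<omega>. eps i t \<omega> *\<^sub>R z i t \<omega>)"
    unfolding zc_def scaleR_diff_right using i eps_integrable by (intro Bochner_Integration.integrable_diff integrable_scaleR_left) auto
  show "(\<integral>\<omega>. eps i t \<omega> *\<^sub>R z i t \<omega> \<partial>M) = 0"
    unfolding zc_def scaleR_diff_right using i eps_integrable by (simp add: orth mean_eps)
qed

lemma z_mean: "(\<integral>\<omega>. z i t \<omega> \<partial>M) = 0"
  unfolding zc_def using x_integrable by (simp add: prob_space)

lemma z_integrable: "integrable M (z i t)"
  unfolding zc_def[abs_def] using x_integrable by simp

lemma inner_powr_le: "\<bar>(v::real^'k) \<bullet> u\<bar> powr p \<le> norm v powr p * norm u powr p"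
proof -
  have "\<bar>v \<bullet> u\<bar> powr p \<le> (norm v * norm u) powr p"
    using p Cauchy_Schwarz_ineq2[of v u] by (intro powr_mono2) auto
  then show ?thesis by (simp add: powr_mult)
qed

lemma Es_mom4: "integrable M (\<lambda>\<omega>. Es m i \<omega> ^ 4)" "expectation (\<lambda>\<omega>. Es m i \<omega> ^ 4) \<le> K4 1 * (real m)\<^sup>2"
proof -
  have "expectation (\<lambda>\<omega>. \<bar>eps i t \<omega>\<bar> powr p) \<le> B1" for t using eps_mom[of i t] B1 by linarith
  then show "integrable M (\<lambda>\<omega>. Es m i \<omega> ^ 4)" "expectation (\<lambda>\<omega>. Es m i \<omega> ^ 4) \<le> K4 1 * (real m)\<^sup>2"
    using process_fourth_moment[of snd B1 i m] eps_mom B1 mean_eps unfolding Es_def K4_def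
    by (simp_all add: path_def)
qed

text \<open>Uniform over \<open>norm v \<le> c\<close> instead of for one fixed \<open>v\<close>:
  the central limit bound is applied in the direction \<Sigma>^(-1) u, which moves with n and m but
  stays bounded.\<close>

lemma inner_Us_mom4:
  assumes c: "norm v \<le> c"
  shows "integrable M (\<lambda>\<omega>. (v \<bullet> Us m i \<omega>) ^ 4)" "expectation (\<lambda>\<omega>. (v \<bullet> Us m i \<omega>) ^ 4) \<le> K4 c * (real m)\<^sup>2"
proof -
  define f where "f q = v \<bullet> (snd q *\<^sub>R (fst q - expectation (x i 0)))" for q :: "(real^'k) \<times> real"
  have f: "f \<in> borel_measurable borel" unfolding f_def by measurable
  have fp: "f (path i \<omega> t) = v \<bullet> (eps i t \<omega> *\<^sub>R z i t \<omega>)" for \<omega> t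
    unfolding f_def zc_path by (simp add: path_def)
  have le: "\<bar>f (path i \<omega> t)\<bar> powr p \<le> c powr p * norm (eps i t \<omega> *\<^sub>R z i t \<omega>) powr p" for \<omega> t
  proof -
    have "norm v powr p \<le> c powr p" using c p by (intro powr_mono2) auto
    then show ?thesis unfolding fp
      by (intro order_trans[OF inner_powr_le] mult_right_mono) auto
  qed
  have ig: "integrable M (\<lambda>\<omega>. c powr p * norm (eps i t \<omega> *\<^sub>R z i t \<omega>) powr p)" for t
    using ez_mom by (simp del: norm_scaleR)
  have meas: "(\<lambda>\<omega>. f (path i \<omega> t)) \<in> borel_measurable M" for t unfolding fp by measurable
  have i: "integrable M (\<lambda>\<omega>. \<bar>f (path i \<omega> t)\<bar> powr p)" for t
    by (rule Bochner_Integration.integrable_bound[OF ig[of t]])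
      (use le meas in \<open>auto intro!: AE_I2 intro: order_trans[OF _ abs_ge_self] simp del: norm_scaleR\<close>)
  have mom: "expectation (\<lambda>\<omega>. \<bar>f (path i \<omega> t)\<bar> powr p) \<le> c powr p * B1" for t
  proof -
    have "expectation (\<lambda>\<omega>. \<bar>f (path i \<omega> t)\<bar> powr p) \<le> expectation (\<lambda>\<omega>. c powr p * norm (eps i t \<omega> *\<^sub>R z i t \<omega>) powr p)"
      using i ig le by (intro integral_mono)
    also have "\<dots> \<le> c powr p * B1" using ez_mom by (simp add: mult_left_mono del: norm_scaleR)
    finally show ?thesis .
  qed
  have mean: "expectation (\<lambda>\<omega>. f (path i \<omega> t)) = 0" for t
    unfolding fp using ez_integrable[of i t] ez_mean[of i t] by (simp del: inner_scaleR_right)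
  have "c powr p * B1 \<ge> 0" using B1 by simp
  note process_fourth_moment[OF f this i mom mean, of m]
  moreover have "(\<Sum>t<m. f (path i \<omega> t)) = v \<bullet> Us m i \<omega>" for \<omega>
    unfolding fp Us_def inner_sum_right ..
  ultimately show "integrable M (\<lambda>\<omega>. (v \<bullet> Us m i \<omega>) ^ 4)" "expectation (\<lambda>\<omega>. (v \<bullet> Us m i \<omega>) ^ 4) \<le> K4 c * (real m)\<^sup>2"
    unfolding K4_def by simp_all
qed

lemma Us_mom4: "integrable M (\<lambda>\<omega>. (Us m i \<omega> $ a) ^ 4)" "expectation (\<lambda>\<omega>. (Us m i \<omega> $ a) ^ 4) \<le> K4 1 * (real m)\<^sup>2"
  using inner_Us_mom4[of "axis a 1" 1 m i] by (simp_all add: inner_axis')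

lemma z_comp_powr: "\<bar>z i t \<omega> $ a\<bar> powr p \<le> norm (z i t \<omega>) powr p"
  using p component_le_norm_cart[of "z i t \<omega>" a] by (intro powr_mono2) auto

lemma z_comp_mom: "integrable M (\<lambda>\<omega>. \<bar>z i t \<omega> $ a\<bar> powr p)" "expectation (\<lambda>\<omega>. \<bar>z i t \<omega> $ a\<bar> powr p) \<le> B1"
proof -
  show i: "integrable M (\<lambda>\<omega>. \<bar>z i t \<omega> $ a\<bar> powr p)"
    by (rule Bochner_Integration.integrable_bound[OF z_mom(1)[of i t]]) (use z_comp_powr in auto)
  have "expectation (\<lambda>\<omega>. \<bar>z i t \<omega> $ a\<bar> powr p) \<le> expectation (\<lambda>\<omega>. norm (z i t \<omega>) powr p)"
    using i z_mom z_comp_powr by (intro integral_mono) auto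
  then show "expectation (\<lambda>\<omega>. \<bar>z i t \<omega> $ a\<bar> powr p) \<le> B1" using z_mom(2)[of i t] by linarith
qed

lemma z_mom4: "integrable M (\<lambda>\<omega>. (z i t \<omega> $ a) ^ 4)" "expectation (\<lambda>\<omega>. (z i t \<omega> $ a) ^ 4) \<le> 1 + B1"
proof -
  show i: "integrable M (\<lambda>\<omega>. (z i t \<omega> $ a) ^ 4)"
    by (rule Bochner_Integration.integrable_bound[where f="\<lambda>\<omega>. 1 + \<bar>z i t \<omega> $ a\<bar> powr p"])
      (use z_comp_mom pow4_le_powr[OF p] in auto)
  have "expectation (\<lambda>\<omega>. (z i t \<omega> $ a) ^ 4) \<le> expectation (\<lambda>\<omega>. 1 + \<bar>z i t \<omega> $ a\<bar> powr p)"
    using i z_comp_mom pow4_le_powr[OF p] by (intro integral_mono) auto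
  then show "expectation (\<lambda>\<omega>. (z i t \<omega> $ a) ^ 4) \<le> 1 + B1"
    using z_comp_mom[of i t a] by (simp add: prob_space)
qed

lemma eps_mom4: "integrable M (\<lambda>\<omega>. (eps i t \<omega>) ^ 4)" "expectation (\<lambda>\<omega>. (eps i t \<omega>) ^ 4) \<le> 1 + B1"
proof -
  show i: "integrable M (\<lambda>\<omega>. (eps i t \<omega>) ^ 4)"
    by (rule Bochner_Integration.integrable_bound[where f="\<lambda>\<omega>. 1 + \<bar>eps i t \<omega>\<bar> powr p"])
      (use eps_mom pow4_le_powr[OF p] in auto)
  have "expectation (\<lambda>\<omega>. (eps i t \<omega>) ^ 4) \<le> expectation (\<lambda>\<omega>. 1 + \<bar>eps i t \<omega>\<bar> powr p)"
    using i eps_mom pow4_le_powr[OF p] by (intro integral_mono) auto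
  then show "expectation (\<lambda>\<omega>. (eps i t \<omega>) ^ 4) \<le> 1 + B1"
    using eps_mom[of i t] B1 by (simp add: prob_space)
qed

lemma Zs_mom4: "integrable M (\<lambda>\<omega>. (Zs m i \<omega> $ a) ^ 4)" "expectation (\<lambda>\<omega>. (Zs m i \<omega> $ a) ^ 4) \<le> K4 1 * (real m)\<^sup>2"
proof -
  define f where "f q = (fst q - expectation (x i 0)) $ a" for q :: "(real^'k) \<times> real"
  have f: "f \<in> borel_measurable borel" unfolding f_def by measurable
  have fp: "f (path i \<omega> t) = z i t \<omega> $ a" for \<omega> t unfolding f_def zc_path ..
  have mean: "expectation (\<lambda>\<omega>. z i t \<omega> $ a) = 0" for t
  proof -
    have "expectation (\<lambda>\<omega>. z i t \<omega> \<bullet> axis a 1) = 0"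
      using z_integrable[of i t] by (simp add: z_mean)
    then show ?thesis by (simp add: inner_axis)
  qed
  note process_fourth_moment[OF f B1(1), of i m, unfolded fp, OF z_comp_mom(1) z_comp_mom(2) mean]
  then show "integrable M (\<lambda>\<omega>. (Zs m i \<omega> $ a) ^ 4)" "expectation (\<lambda>\<omega>. (Zs m i \<omega> $ a) ^ 4) \<le> K4 1 * (real m)\<^sup>2"
    by (simp_all add: Zs_def K4_def)
qed

end

subsection \<open>Bias and long-run variance\<close>

text \<open>Enlarging the square by one row and one column adds every lag once on each side and one
  more diagonal entry. Positive and negative lags are kept apart because \<open>g\<close> need not
  be symmetric.\<close>

lemma double_sum_stationary:
  fixes g :: "nat \<Rightarrow> nat \<Rightarrow> real"
  assumes P: "\<And>t \<tau>. g t (t + \<tau>) = P \<tau>" and Q: "\<And>t \<tau>. g (t + \<tau>) t = Q \<tau>"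
  shows "(\<Sum>s<m. \<Sum>t<m. g s t) = real m * P 0 + (\<Sum>\<tau>\<in>{1..<m}. real (m - \<tau>) * (P \<tau> + Q \<tau>))"
proof (induction m)
  case (Suc m)
  have r: "(\<Sum>s<m. h (m - s)) = (\<Sum>\<tau>\<in>{1..<Suc m}. h \<tau>)" for h :: "nat \<Rightarrow> real"
    by (rule sum.reindex_bij_witness[of _ "\<lambda>\<tau>. m - \<tau>" "\<lambda>s. m - s"]) auto
  have p: "g s m = P (m - s)" "g m s = Q (m - s)" if "s < m" for s
    using P[of s "m - s"] Q[of s "m - s"] that by auto
  have "(\<Sum>s<Suc m. \<Sum>t<Suc m. g s t) = (\<Sum>s<m. \<Sum>t<m. g s t) + (\<Sum>s<m. g s m) + (\<Sum>s<m. g m s) + g m m"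
    by (simp add: sum.distrib)
  also have "(\<Sum>s<m. g s m) = (\<Sum>\<tau>\<in>{1..<Suc m}. P \<tau>)" using p r[of P] by simp
  also have "(\<Sum>s<m. g m s) = (\<Sum>\<tau>\<in>{1..<Suc m}. Q \<tau>)" using p r[of Q] by simp
  also have "g m m = P 0" using P[of m 0] by simp
  finally have 1: "(\<Sum>s<Suc m. \<Sum>t<Suc m. g s t) = real (Suc m) * P 0 + (\<Sum>\<tau>\<in>{1..<m}. real (m - \<tau>) * (P \<tau> + Q \<tau>))
     + (\<Sum>\<tau>\<in>{1..<Suc m}. P \<tau> + Q \<tau>)"
    unfolding Suc sum.distrib by (simp add: algebra_simps)
  have "(\<Sum>\<tau>\<in>{1..<Suc m}. real (Suc m - \<tau>) * (P \<tau> + Q \<tau>))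
     = (\<Sum>\<tau>\<in>{1..<Suc m}. real (m - \<tau>) * (P \<tau> + Q \<tau>) + (P \<tau> + Q \<tau>))"
    by (intro sum.cong) (auto simp: of_nat_diff algebra_simps)
  also have "\<dots> = (\<Sum>\<tau>\<in>{1..<Suc m}. real (m - \<tau>) * (P \<tau> + Q \<tau>)) + (\<Sum>\<tau>\<in>{1..<Suc m}. P \<tau> + Q \<tau>)"
    by (rule sum.distrib)
  \<comment> \<open>The added lag \<open>\<tau> = m\<close> has weight 0.\<close>
  also have "(\<Sum>\<tau>\<in>{1..<Suc m}. real (m - \<tau>) * (P \<tau> + Q \<tau>)) = (\<Sum>\<tau>\<in>{1..<m}. real (m - \<tau>) * (P \<tau> + Q \<tau>))"
    by (rule sum.mono_neutral_right) (auto simp: less_Suc_eq)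
  finally show ?case using 1 by simp
qed simp

text \<open>Entries may lie in any Euclidean space, so two applications cover matrices.\<close>

lemma integrable_vecI:
  fixes f :: "'a \<Rightarrow> ('b::euclidean_space)^'k"
  assumes "\<And>a. integrable M (\<lambda>\<omega>. f \<omega> $ a)"
  shows "integrable M f"
proof -
  have "bounded_linear (axis a :: 'b \<Rightarrow> 'b^'k)" for a
    by (intro linear_conv_bounded_linear[THEN iffD1] linearI) (auto simp: axis_def vec_eq_iff)
  then have "integrable M (\<lambda>\<omega>. axis a (f \<omega> $ a))" for a
    using assms by (rule integrable_bounded_linear)
  then have "integrable M (\<lambda>\<omega>. \<Sum>a\<in>UNIV. axis a (f \<omega> $ a))" by (intro Bochner_Integration.integrable_sum)
  moreover have "(\<Sum>a\<in>UNIV. axis a (f \<omega> $ a)) = f \<omega>" for \<omega>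
    by (simp add: vec_eq_iff axis_def if_distrib sum.delta cong: if_cong)
  ultimately show ?thesis by simp
qed

lemma integral_vec_nth:
  fixes f :: "'a \<Rightarrow> ('b::euclidean_space)^'k"
  assumes "\<And>a. integrable M (\<lambda>\<omega>. f \<omega> $ a)"
  shows "(\<integral>\<omega>. f \<omega> \<partial>M) $ a = (\<integral>\<omega>. f \<omega> $ a \<partial>M)"
  using integral_bounded_linear[OF bounded_linear_vec_nth integrable_vecI[OF assms], of a] by simp

lemma integral_mat_nth:
  fixes f :: "'a \<Rightarrow> real^'k^'k"
  assumes "\<And>a b. integrable M (\<lambda>\<omega>. f \<omega> $ a $ b)"
  shows "(\<integral>\<omega>. f \<omega> \<partial>M) $ a $ b = (\<integral>\<omega>. f \<omega> $ a $ b \<partial>M)"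
  using assms by (simp add: integral_vec_nth integrable_vecI)

lemma outer_nth [simp]: "outer u v $ a $ b = u $ a * v $ b"
  by (simp add: outer_def)

lemma outer_mult: "outer u w *v v = (w \<bullet> v) *\<^sub>R u"
  by (simp add: vec_eq_iff matrix_vector_mult_def inner_vec_def sum_distrib_left mult_ac)

lemma bounded_linear_quadratic_form: "bounded_linear (\<lambda>A. v \<bullet> (A *v (v::real^'k)))"
  unfolding inner_matrix_sum
  by (intro bounded_linear_sum bounded_linear_mult_left[THEN bounded_linear_compose]
      bounded_linear_vec_nth[THEN bounded_linear_compose] bounded_linear_vec_nth)

lemma (in prob_space) integrable_mult_of_pow4:
  fixes X Y :: "'a \<Rightarrow> real"
  assumes [measurable]: "X \<in> borel_measurable M" "Y \<in> borel_measurable M"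
    and i: "integrable M (\<lambda>\<omega>. X \<omega> ^ 4)" "integrable M (\<lambda>\<omega>. Y \<omega> ^ 4)"
  shows "integrable M (\<lambda>\<omega>. X \<omega> * Y \<omega>)"
proof (rule square_integrable_imp_integrable)
  show "integrable M (\<lambda>\<omega>. (X \<omega> * Y \<omega>)\<^sup>2)"
    by (rule Bochner_Integration.integrable_bound[where f="\<lambda>\<omega>. (X \<omega> ^ 4 + Y \<omega> ^ 4) / 2"])
      (use i square_mult_le_pow4 in auto)
qed measurable

context panel
begin

lemma ez_cross_integrable: "integrable M (\<lambda>\<omega>. eps i t \<omega> * z i u \<omega> $ a)"
  by (rule integrable_mult_of_pow4) (auto intro: eps_mom4 z_mom4)

lemma zz_integrable: "integrable M (\<lambda>\<omega>. z i t \<omega> $ a * z i t \<omega> $ b)"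
  by (rule integrable_mult_of_pow4) (auto intro: z_mom4)

lemma ez_mom4: "integrable M (\<lambda>\<omega>. (eps i t \<omega> * z i t \<omega> $ a) ^ 4)"
proof -
  have pw: "\<bar>eps i t \<omega> * z i t \<omega> $ a\<bar> powr p \<le> norm (eps i t \<omega> *\<^sub>R z i t \<omega>) powr p" for \<omega>
    using component_le_norm_cart[of "eps i t \<omega> *\<^sub>R z i t \<omega>" a] p by (intro powr_mono2) auto
  have le: "(eps i t \<omega> * z i t \<omega> $ a) ^ 4 \<le> 1 + norm (eps i t \<omega> *\<^sub>R z i t \<omega>) powr p" for \<omega>
    using pow4_le_powr[OF p, of "eps i t \<omega> * z i t \<omega> $ a"] pw[of \<omega>] by linarith
  show ?thesis
  proof (rule Bochner_Integration.integrable_bound[where f="\<lambda>\<omega>. 1 + norm (eps i t \<omega> *\<^sub>R z i t \<omega>) powr p"])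
    show "integrable M (\<lambda>\<omega>. 1 + norm (eps i t \<omega> *\<^sub>R z i t \<omega>) powr p)"
      by (intro Bochner_Integration.integrable_add ez_mom) simp
    have e: "\<bar>u ^ 4\<bar> = u ^ 4" for u :: real by simp
    show "AE \<omega> in M. norm ((eps i t \<omega> * z i t \<omega> $ a) ^ 4) \<le> norm (1 + norm (eps i t \<omega> *\<^sub>R z i t \<omega>) powr p)"
      unfolding real_norm_def e by (intro AE_I2 order_trans[OF le abs_ge_self])
  qed measurable
qed

lemma ezez_integrable: "integrable M (\<lambda>\<omega>. (eps i t \<omega> * z i t \<omega> $ a) * (eps i u \<omega> * z i u \<omega> $ b))"
  by (rule integrable_mult_of_pow4) (auto intro: ez_mom4)

lemma component_measurable: "(\<lambda>h. h t) \<in> borel_measurable (PiM UNIV (\<lambda>_. borel :: ((real^'k) \<times> real) measure))"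
  by (rule measurable_component_singleton) simp

lemma ez_cross_shift:
  "expectation (\<lambda>\<omega>. eps i (t + h) \<omega> * z i (u + h) \<omega> $ a) = expectation (\<lambda>\<omega>. eps i t \<omega> * z i u \<omega> $ a)"
proof -
  note component_measurable[measurable]
  have "(\<lambda>h. snd (h t) * (fst (h u) - expectation (x i 0)) $ a) \<in> borel_measurable (PiM UNIV (\<lambda>_. borel))"
    by measurable
  from expectation_shift[OF this, of i h] show ?thesis by (simp add: zc_path) (simp add: path_def)
qed

lemma ezez_shift:
  "expectation (\<lambda>\<omega>. (v \<bullet> (eps i (t + h) \<omega> *\<^sub>R z i (t + h) \<omega>)) * (v \<bullet> (eps i (u + h) \<omega> *\<^sub>R z i (u + h) \<omega>)))
   = expectation (\<lambda>\<omega>. (v \<bullet> (eps i t \<omega> *\<^sub>R z i t \<omega>)) * (v \<bullet> (eps i u \<omega> *\<^sub>R z i u \<omega>)))"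
proof -
  note component_measurable[measurable]
  have "(\<lambda>h. (v \<bullet> (snd (h t) *\<^sub>R (fst (h t) - expectation (x i 0)))) * (v \<bullet> (snd (h u) *\<^sub>R (fst (h u) - expectation (x i 0)))))
     \<in> borel_measurable (PiM UNIV (\<lambda>_. borel))"
    by measurable
  from expectation_shift[OF this, of i h] show ?thesis by (simp add: zc_path) (simp add: path_def)
qed

text \<open>Contemporaneous terms vanish by orthogonality of regressor and error. By stationarity
  the others depend on the lag alone, and each lag \<tau> occurs m - \<tau> times on either side of
  the diagonal.\<close>

lemma EsZs_bias:
  assumes m: "m \<ge> 1" and n: "n \<ge> 1"
  shows "(\<Sum>i<n. expectation (\<lambda>\<omega>. Es m i \<omega> * Zs m i \<omega> $ a)) = - (real n * real m * bNM M x eps n m $ a)"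
proof -
  define G where "G i t u = expectation (\<lambda>\<omega>. eps i t \<omega> * z i u \<omega> $ a)" for i t u
  have G0: "G i t t = 0" for i t
  proof -
    have "(\<integral>\<omega>. eps i t \<omega> *\<^sub>R z i t \<omega> \<partial>M) $ a = G i t t"
      unfolding G_def by (subst integral_vec_nth) (auto simp: ez_cross_integrable)
    then show ?thesis by (simp add: ez_mean)
  qed
  have GP: "G i t (t + \<tau>) = G i 0 \<tau>" "G i (t + \<tau>) t = G i \<tau> 0" for i t \<tau>
    using ez_cross_shift[of i 0 t \<tau> a] ez_cross_shift[of i \<tau> t 0 a] by (simp_all add: G_def add.commute)
  have E: "expectation (\<lambda>\<omega>. Es m i \<omega> * Zs m i \<omega> $ a) = (\<Sum>\<tau>\<in>{1..<m}. real (m - \<tau>) * (G i \<tau> 0 + G i 0 \<tau>))" for i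
  proof -
    have "expectation (\<lambda>\<omega>. Es m i \<omega> * Zs m i \<omega> $ a) = (\<Sum>t<m. \<Sum>u<m. G i t u)"
      unfolding Es_def Zs_def sum_component sum_product G_def
      by (simp add: Bochner_Integration.integral_sum ez_cross_integrable)
    also have "\<dots> = (\<Sum>\<tau>\<in>{1..<m}. real (m - \<tau>) * (G i \<tau> 0 + G i 0 \<tau>))"
      using double_sum_stationary[of "G i" "\<lambda>\<tau>. G i 0 \<tau>" "\<lambda>\<tau>. G i \<tau> 0" m] GP G0
      by (simp add: add.commute)
    finally show ?thesis .
  qed
  have c: "(\<integral>\<omega>. eps i t \<omega> *\<^sub>R z i u \<omega> \<partial>M) $ a = G i t u" for i t u
    unfolding G_def by (subst integral_vec_nth) (auto simp: ez_cross_integrable)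
  have "bNM M x eps n m $ a = - (1 / real n * (\<Sum>i<n. \<Sum>\<tau>\<in>{1..<m}. real (m - \<tau>) / real m * (G i \<tau> 0 + G i 0 \<tau>)))"
    unfolding bNM_def by (simp add: sum_component c)
  also have "(\<Sum>i<n. \<Sum>\<tau>\<in>{1..<m}. real (m - \<tau>) / real m * (G i \<tau> 0 + G i 0 \<tau>))
      = (\<Sum>i<n. expectation (\<lambda>\<omega>. Es m i \<omega> * Zs m i \<omega> $ a)) / real m"
    unfolding E by (simp add: sum_divide_distrib)
  finally show ?thesis using m n by simp
qed

text \<open>The same count of lags shows that \<Omega> is the exact variance of the normalised
  score, with no asymptotic error. Thus the Gaussian approximation later involves \<Upsilon>
  itself.\<close>

lemma Omega_quadratic_form:
  assumes m: "m \<ge> 1" and n: "n \<ge> 1"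
  shows "v \<bullet> (OmegaNM M x eps n m *v v) = (\<Sum>i<n. expectation (\<lambda>\<omega>. (v \<bullet> Us m i \<omega>)\<^sup>2)) / (real n * real m)"
proof -
  define q where "q A = v \<bullet> (A *v v)" for A :: "real^'k^'k"
  interpret q: bounded_linear q unfolding q_def by (rule bounded_linear_quadratic_form)
  define w where "w i t \<omega> = v \<bullet> (eps i t \<omega> *\<^sub>R z i t \<omega>)" for i t \<omega>
  define G where "G i t u = expectation (\<lambda>\<omega>. w i t \<omega> * w i u \<omega>)" for i t u
  have q_outer: "q (c *\<^sub>R outer u u') = c * ((v \<bullet> u) * (v \<bullet> u'))" for c u u'
    by (simp add: q.scaleR) (simp add: q_def outer_mult inner_commute)
  have ww: "integrable M (\<lambda>\<omega>. w i t \<omega> * w i u \<omega>)" for i t u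
  proof -
    have e: "w i t \<omega> * w i u \<omega> = (\<Sum>a\<in>UNIV. \<Sum>b\<in>UNIV. (v $ a * v $ b) * ((eps i t \<omega> * z i t \<omega> $ a) * (eps i u \<omega> * z i u \<omega> $ b)))" for \<omega>
      unfolding w_def inner_vec_def sum_product by (intro sum.cong) (auto simp: mult_ac)
    have "integrable M (\<lambda>\<omega>. (v $ a * v $ b) * ((eps i t \<omega> * z i t \<omega> $ a) * (eps i u \<omega> * z i u \<omega> $ b)))" for a b
      by (rule integrable_mult_right) (rule ezez_integrable)
    then have "integrable M (\<lambda>\<omega>. \<Sum>a\<in>UNIV. \<Sum>b\<in>UNIV. (v $ a * v $ b) * ((eps i t \<omega> * z i t \<omega> $ a) * (eps i u \<omega> * z i u \<omega> $ b)))"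
      by (intro Bochner_Integration.integrable_sum) blast
    then show ?thesis by (simp only: e)
  qed
  have GP: "G i t (t + \<tau>) = G i 0 \<tau>" "G i (t + \<tau>) t = G i \<tau> 0" for i t \<tau>
    using ezez_shift[of v i 0 t \<tau>] ezez_shift[of v i \<tau> t 0] by (simp_all add: G_def w_def add.commute)
  have t1: "q (\<integral>\<omega>. (eps i t \<omega>)\<^sup>2 *\<^sub>R outer (z i t \<omega>) (z i t \<omega>) \<partial>M) = G i 0 0" for i t
  proof -
    have "integrable M (\<lambda>\<omega>. (eps i t \<omega>)\<^sup>2 *\<^sub>R outer (z i t \<omega>) (z i t \<omega>))"
      using ezez_integrable[of i t _ t] by (intro integrable_vecI) (simp add: power2_eq_square mult_ac)
    then have "q (\<integral>\<omega>. (eps i t \<omega>)\<^sup>2 *\<^sub>R outer (z i t \<omega>) (z i t \<omega>) \<partial>M)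
      = expectation (\<lambda>\<omega>. q ((eps i t \<omega>)\<^sup>2 *\<^sub>R outer (z i t \<omega>) (z i t \<omega>)))"
      by (rule integral_bounded_linear[OF q.bounded_linear_axioms, symmetric])
    also have "\<dots> = G i t t" unfolding q_outer G_def w_def by (simp add: power2_eq_square mult_ac)
    also have "\<dots> = G i 0 0" using GP(1)[of i t 0] by simp
    finally show ?thesis .
  qed
  have t2: "q (\<integral>\<omega>. (eps i t \<omega> * eps i (t + \<tau>) \<omega>) *\<^sub>R
               (outer (z i t \<omega>) (z i (t + \<tau>) \<omega>) + outer (z i (t + \<tau>) \<omega>) (z i t \<omega>)) \<partial>M) = G i 0 \<tau> + G i \<tau> 0" for i t \<tau>
  proof -
    have "integrable M (\<lambda>\<omega>. (eps i t \<omega> * eps i (t + \<tau>) \<omega>) *\<^sub>R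
               (outer (z i t \<omega>) (z i (t + \<tau>) \<omega>) + outer (z i (t + \<tau>) \<omega>) (z i t \<omega>)))"
      using ezez_integrable[of i t _ "t + \<tau>"]
      by (intro integrable_vecI) (simp add: distrib_left mult_ac)
    then have "q (\<integral>\<omega>. (eps i t \<omega> * eps i (t + \<tau>) \<omega>) *\<^sub>R
               (outer (z i t \<omega>) (z i (t + \<tau>) \<omega>) + outer (z i (t + \<tau>) \<omega>) (z i t \<omega>)) \<partial>M)
      = expectation (\<lambda>\<omega>. q ((eps i t \<omega> * eps i (t + \<tau>) \<omega>) *\<^sub>R
               (outer (z i t \<omega>) (z i (t + \<tau>) \<omega>) + outer (z i (t + \<tau>) \<omega>) (z i t \<omega>))))"
      by (rule integral_bounded_linear[OF q.bounded_linear_axioms, symmetric])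
    also have "\<dots> = expectation (\<lambda>\<omega>. w i t \<omega> * w i (t + \<tau>) \<omega> + w i (t + \<tau>) \<omega> * w i t \<omega>)"
      unfolding scaleR_add_right q.add q_outer w_def by (simp add: mult_ac)
    also have "\<dots> = G i t (t + \<tau>) + G i (t + \<tau>) t"
      unfolding G_def by (rule Bochner_Integration.integral_add[OF ww ww])
    finally show ?thesis by (simp add: GP)
  qed
  have E: "expectation (\<lambda>\<omega>. (v \<bullet> Us m i \<omega>)\<^sup>2) = real m * G i 0 0 + (\<Sum>\<tau>\<in>{1..<m}. real (m - \<tau>) * (G i 0 \<tau> + G i \<tau> 0))" for i
  proof -
    have "expectation (\<lambda>\<omega>. (v \<bullet> Us m i \<omega>)\<^sup>2) = (\<Sum>t<m. \<Sum>u<m. G i t u)"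
      unfolding Us_def inner_sum_right power2_eq_square sum_product w_def[symmetric] G_def
      by (simp add: Bochner_Integration.integral_sum ww)
    also have "\<dots> = real m * G i 0 0 + (\<Sum>\<tau>\<in>{1..<m}. real (m - \<tau>) * (G i 0 \<tau> + G i \<tau> 0))"
      by (rule double_sum_stationary) (simp_all add: GP)
    finally show ?thesis .
  qed
  have "v \<bullet> (OmegaNM M x eps n m *v v) = 1 / real (n * m) * (\<Sum>i<n. \<Sum>t<m. G i 0 0
      + (\<Sum>\<tau>\<in>{1..<m}. real (m - \<tau>) / real m * (G i 0 \<tau> + G i \<tau> 0)))"
    unfolding q_def[symmetric] OmegaNM_def by (simp add: q.scaleR q.sum q.add t1 t2)
  also have "(\<Sum>i<n. \<Sum>t<m. G i 0 0 + (\<Sum>\<tau>\<in>{1..<m}. real (m - \<tau>) / real m * (G i 0 \<tau> + G i \<tau> 0)))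
     = (\<Sum>i<n. expectation (\<lambda>\<omega>. (v \<bullet> Us m i \<omega>)\<^sup>2))"
    unfolding E using m by (intro sum.cong) (simp_all add: distrib_left sum_distrib_left)
  finally show ?thesis by simp
qed

lemma Sigma_nth: "SigmaNM M x n m $ a $ b = (\<Sum>i<n. \<Sum>t<m. expectation (\<lambda>\<omega>. z i t \<omega> $ a * z i t \<omega> $ b)) / (real n * real m)"
proof -
  have "(\<integral>\<omega>. outer (z i t \<omega>) (z i t \<omega>) \<partial>M) $ a $ b = expectation (\<lambda>\<omega>. z i t \<omega> $ a * z i t \<omega> $ b)" for i t
    by (subst integral_mat_nth) (simp_all add: zz_integrable)
  then show ?thesis unfolding SigmaNM_def by (simp add: sum_component)
qed

lemma Sigma_sym: "transpose (SigmaNM M x n m) = SigmaNM M x n m"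
  by (simp add: vec_eq_iff transpose_def Sigma_nth mult.commute)

lemma Omega_sym: "transpose (OmegaNM M x eps n m) = OmegaNM M x eps n m"
proof -
  have t1: "(\<integral>\<omega>. (eps i t \<omega>)\<^sup>2 *\<^sub>R outer (z i t \<omega>) (z i t \<omega>) \<partial>M) $ a $ b
      = expectation (\<lambda>\<omega>. (eps i t \<omega> * z i t \<omega> $ a) * (eps i t \<omega> * z i t \<omega> $ b))" for i t a b
    using ezez_integrable[of i t _ t] by (subst integral_mat_nth) (simp_all add: power2_eq_square mult_ac)
  have t2: "(\<integral>\<omega>. (eps i t \<omega> * eps i (t + \<tau>) \<omega>) *\<^sub>R
               (outer (z i t \<omega>) (z i (t + \<tau>) \<omega>) + outer (z i (t + \<tau>) \<omega>) (z i t \<omega>)) \<partial>M) $ a $ b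
      = expectation (\<lambda>\<omega>. (eps i t \<omega> * z i t \<omega> $ a) * (eps i (t + \<tau>) \<omega> * z i (t + \<tau>) \<omega> $ b)
       + (eps i t \<omega> * z i t \<omega> $ b) * (eps i (t + \<tau>) \<omega> * z i (t + \<tau>) \<omega> $ a))" for i t \<tau> a b
    using ezez_integrable[of i t _ "t + \<tau>"] by (subst integral_mat_nth) (simp_all add: distrib_left mult_ac)
  show ?thesis
    by (simp add: vec_eq_iff transpose_def OmegaNM_def sum_component t1 t2)
       (simp add: mult.commute add.commute)
qed

text \<open>An upper bound on \<Sigma> keeps its inverse from shrinking vectors, which is what the
  uniform lower bound on \<Upsilon> requires.\<close>

lemma Sigma_nth_le:
  assumes "m \<ge> 1" "n \<ge> 1"
  shows "\<bar>SigmaNM M x n m $ a $ b\<bar> \<le> 2 + B1"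
proof -
  have e: "\<bar>expectation (\<lambda>\<omega>. z i t \<omega> $ a * z i t \<omega> $ b)\<bar> \<le> 2 + B1" for i t
  proof -
    have le: "\<bar>u\<bar> \<le> 1 + u\<^sup>2" for u :: real
    proof -
      have "0 \<le> (\<bar>u\<bar> - 1)\<^sup>2" "0 \<le> u\<^sup>2" by auto
      then show ?thesis by (simp add: power2_diff)
    qed
    have 2: "integrable M (\<lambda>\<omega>. (z i t \<omega> $ a * z i t \<omega> $ b)\<^sup>2)" "expectation (\<lambda>\<omega>. (z i t \<omega> $ a * z i t \<omega> $ b)\<^sup>2) \<le> 1 + B1"
      by (rule product_second_moment; (rule z_mom4 | measurable))+
    have "\<bar>expectation (\<lambda>\<omega>. z i t \<omega> $ a * z i t \<omega> $ b)\<bar> \<le> expectation (\<lambda>\<omega>. 1 + (z i t \<omega> $ a * z i t \<omega> $ b)\<^sup>2)"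
      using 2 zz_integrable le by (intro order_trans[OF integral_abs_bound] integral_mono) auto
    also have "\<dots> \<le> 2 + B1" using 2 by (simp add: prob_space)
    finally show ?thesis .
  qed
  have "\<bar>SigmaNM M x n m $ a $ b\<bar> \<le> (\<Sum>i<n. \<Sum>t<m. 2 + B1) / (real n * real m)"
    unfolding Sigma_nth abs_divide abs_mult abs_of_nat
    by (intro divide_right_mono order_trans[OF sum_abs] sum_mono e) auto
  also have "\<dots> = 2 + B1" using assms by simp
  finally show ?thesis .
qed

end

subsection \<open>Moments of the remainder terms\<close>

lemma (in prob_space) expectation_abs_le:
  fixes X :: "'a \<Rightarrow> real"
  assumes [measurable]: "X \<in> borel_measurable M"
    and i: "integrable M (\<lambda>\<omega>. (X \<omega>)\<^sup>2)" and K: "expectation (\<lambda>\<omega>. (X \<omega>)\<^sup>2) \<le> K * \<eta>\<^sup>2" and \<eta>: "\<eta> > 0"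
  shows "integrable M (\<lambda>\<omega>. \<bar>X \<omega>\<bar>)" and "expectation (\<lambda>\<omega>. \<bar>X \<omega>\<bar>) \<le> (1 + K) * \<eta>"
proof -
  have le: "\<bar>u\<bar> \<le> \<eta> + u\<^sup>2 / \<eta>" for u
  proof -
    have "0 \<le> (\<bar>u\<bar> - \<eta>)\<^sup>2" "0 \<le> \<bar>u\<bar> * \<eta>" using \<eta> by auto
    then have "\<bar>u\<bar> * \<eta> \<le> \<eta>\<^sup>2 + u\<^sup>2" by (simp add: power2_diff; linarith)
    then have "\<bar>u\<bar> \<le> (\<eta>\<^sup>2 + u\<^sup>2) / \<eta>" using \<eta> by (simp only: pos_le_divide_eq)
    then show ?thesis using \<eta> by (simp add: add_divide_distrib power2_eq_square)
  qed
  show 1: "integrable M (\<lambda>\<omega>. \<bar>X \<omega>\<bar>)"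
    by (rule integrable_abs[OF square_integrable_imp_integrable[OF assms(1) i]])
  have "expectation (\<lambda>\<omega>. \<bar>X \<omega>\<bar>) \<le> expectation (\<lambda>\<omega>. \<eta> + (X \<omega>)\<^sup>2 / \<eta>)"
    using 1 i le by (intro integral_mono) auto
  also have "\<dots> = \<eta> + expectation (\<lambda>\<omega>. (X \<omega>)\<^sup>2) / \<eta>" using i by (simp add: prob_space)
  also have "\<dots> \<le> \<eta> + K * \<eta>\<^sup>2 / \<eta>" using K \<eta> by (intro add_left_mono divide_right_mono) auto
  also have "\<dots> = (1 + K) * \<eta>" using \<eta> by (simp add: power2_eq_square field_simps)
  finally show "expectation (\<lambda>\<omega>. \<bar>X \<omega>\<bar>) \<le> (1 + K) * \<eta>" .
qed

text \<open>From |uv| <= u^2/\<eta> + \<eta> v^2: a factor that is small in mean square times one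
  that is merely bounded in mean square is still of order \<eta>.\<close>

lemma (in prob_space) expectation_abs_mult_le:
  fixes X Y :: "'a \<Rightarrow> real"
  assumes [measurable]: "X \<in> borel_measurable M" "Y \<in> borel_measurable M"
    and iX: "integrable M (\<lambda>\<omega>. (X \<omega>)\<^sup>2)" and KX: "expectation (\<lambda>\<omega>. (X \<omega>)\<^sup>2) \<le> K * \<eta>\<^sup>2" and \<eta>: "\<eta> > 0"
    and iY: "integrable M (\<lambda>\<omega>. (Y \<omega>)\<^sup>2)" and KY: "expectation (\<lambda>\<omega>. (Y \<omega>)\<^sup>2) \<le> L"
  shows "integrable M (\<lambda>\<omega>. \<bar>X \<omega>\<bar> * \<bar>Y \<omega>\<bar>)" and "expectation (\<lambda>\<omega>. \<bar>X \<omega>\<bar> * \<bar>Y \<omega>\<bar>) \<le> (K + L) * \<eta>"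
proof -
  have le: "\<bar>u\<bar> * \<bar>v\<bar> \<le> u\<^sup>2 / \<eta> + \<eta> * v\<^sup>2" for u v
  proof -
    have "0 \<le> (\<bar>u\<bar> - \<eta> * \<bar>v\<bar>)\<^sup>2" "0 \<le> \<bar>u\<bar> * (\<eta> * \<bar>v\<bar>)" using \<eta> by auto
    then have "(\<bar>u\<bar> * \<bar>v\<bar>) * \<eta> \<le> u\<^sup>2 + \<eta>\<^sup>2 * v\<^sup>2"
      by (simp add: power2_diff power_mult_distrib mult_ac; linarith)
    then have "\<bar>u\<bar> * \<bar>v\<bar> \<le> (u\<^sup>2 + \<eta>\<^sup>2 * v\<^sup>2) / \<eta>" using \<eta> by (simp only: pos_le_divide_eq)
    then show ?thesis using \<eta> by (simp add: add_divide_distrib power2_eq_square)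
  qed
  have ir: "integrable M (\<lambda>\<omega>. (X \<omega>)\<^sup>2 / \<eta> + \<eta> * (Y \<omega>)\<^sup>2)" using iX iY by simp
  show 1: "integrable M (\<lambda>\<omega>. \<bar>X \<omega>\<bar> * \<bar>Y \<omega>\<bar>)"
    by (rule Bochner_Integration.integrable_bound[OF ir])
      (auto intro!: AE_I2 intro: order_trans[OF le abs_ge_self] simp: abs_mult)
  have "expectation (\<lambda>\<omega>. \<bar>X \<omega>\<bar> * \<bar>Y \<omega>\<bar>) \<le> expectation (\<lambda>\<omega>. (X \<omega>)\<^sup>2 / \<eta> + \<eta> * (Y \<omega>)\<^sup>2)"
    using 1 ir le by (intro integral_mono) auto
  also have "\<dots> = expectation (\<lambda>\<omega>. (X \<omega>)\<^sup>2) / \<eta> + \<eta> * expectation (\<lambda>\<omega>. (Y \<omega>)\<^sup>2)" using iX iY by simp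
  also have "\<dots> \<le> K * \<eta>\<^sup>2 / \<eta> + \<eta> * L" using KX KY \<eta> by (intro add_mono divide_right_mono mult_left_mono) auto
  also have "\<dots> = (K + L) * \<eta>" using \<eta> by (simp add: power2_eq_square field_simps)
  finally show "expectation (\<lambda>\<omega>. \<bar>X \<omega>\<bar> * \<bar>Y \<omega>\<bar>) \<le> (K + L) * \<eta>" .
qed

section \<open>Stability of coercive linear systems\<close>

definition l1_norm :: "real^'k^'k \<Rightarrow> real" where
  "l1_norm A = (\<Sum>a\<in>UNIV. \<Sum>b\<in>UNIV. \<bar>A $ a $ b\<bar>)"

lemma norm_matrix_vector_le: "norm (A *v v) \<le> l1_norm A * norm (v::real^'k)"
proof -
  have "norm (A *v v) \<le> (\<Sum>a\<in>UNIV. \<bar>(A *v v) $ a\<bar>)" by (rule norm_le_l1_cart)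
  also have "\<dots> \<le> (\<Sum>a\<in>UNIV. \<Sum>b\<in>UNIV. \<bar>A $ a $ b\<bar> * norm v)"
    unfolding matrix_vector_mult_def
    by (auto simp: abs_mult intro!: sum_mono order_trans[OF sum_abs] mult_left_mono component_le_norm_cart)
  finally show ?thesis by (simp add: l1_norm_def sum_distrib_right)
qed

lemma matrix_inv_cancel:
  fixes A :: "real^'k^'k" assumes "invertible A"
  shows "A *v (matrix_inv A *v v) = v" "matrix_inv A *v (A *v v) = v"
  using matrix_inv_mul[OF assms] by (simp_all add: matrix_vector_mul_assoc)

text \<open>Cauchy-Schwarz turns the quadratic lower bound into l |v| <= |A v|. Inverses are thus
  controlled by the quadratic form alone.\<close>

lemma coercive_norm_le:
  fixes A :: "real^'k^'k"
  assumes l: "l > 0" and A: "\<And>v. v \<bullet> (A *v v) \<ge> l * (norm v)\<^sup>2"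
  shows "invertible A" and "norm v \<le> norm (A *v v) / l"
proof -
  show "invertible A"
  proof (rule posdef_invertible)
    fix v :: "real^'k" assume "v \<noteq> 0"
    then have "0 < l * (norm v)\<^sup>2" using l by simp
    then show "v \<bullet> (A *v v) > 0" using A[of v] by linarith
  qed
  have "l * (norm v)\<^sup>2 \<le> norm v * norm (A *v v)" using A[of v] norm_cauchy_schwarz[of v "A *v v"] by linarith
  then have "norm v * (l * norm v) \<le> norm v * norm (A *v v)" by (simp add: power2_eq_square mult_ac)
  then have "l * norm v \<le> norm (A *v v)" by (cases "v = 0") auto
  then show "norm v \<le> norm (A *v v) / l" using l by (simp add: field_simps)
qed

lemma perturbed_coercive:
  fixes S A :: "real^'k^'k"
  assumes l: "l > 0" and S: "\<And>v. v \<bullet> (S *v v) \<ge> l * (norm v)\<^sup>2" and e: "l1_norm (A - S) \<le> l / 2"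
  shows "v \<bullet> (A *v v) \<ge> l / 2 * (norm v)\<^sup>2"
proof -
  have "\<bar>v \<bullet> ((A - S) *v v)\<bar> \<le> norm v * (l1_norm (A - S) * norm v)"
    using Cauchy_Schwarz_ineq2[of v "(A - S) *v v"] norm_matrix_vector_le[of "A - S" v]
    by (meson mult_left_mono norm_ge_zero order_trans)
  also have "\<dots> \<le> norm v * (l / 2 * norm v)" using e by (intro mult_left_mono mult_right_mono) auto
  finally have "\<bar>v \<bullet> ((A - S) *v v)\<bar> \<le> l / 2 * (norm v)\<^sup>2" by (simp add: power2_eq_square mult_ac)
  moreover have "v \<bullet> (A *v v) = v \<bullet> (S *v v) + v \<bullet> ((A - S) *v v)"
    by (simp add: matrix_vector_mult_diff_rdistrib inner_diff_right)
  ultimately show ?thesis using S[of v] by (simp add: abs_le_iff field_simps)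
qed

text \<open>The error solves \<open>A D = - R + (S - A) S\<^sup>-\<^sup>1 (W + q b)\<close>.\<close>
lemma perturbed_solution_bound:
  fixes S A :: "real^'k^'k"
  assumes l: "l > 0" and S: "\<And>v. v \<bullet> (S *v v) \<ge> l * (norm v)\<^sup>2"
    and e: "l1_norm (A - S) \<le> l / 2"
    and d: "A *v T = W - R + g - A *v (matrix_inv S *v g)"
  shows "norm (T - matrix_inv S *v W) \<le> 2 / l * (norm R + l1_norm (A - S) * (norm W + norm g) / l)"
proof -
  let ?D = "T - matrix_inv S *v W"
  define y where "y = matrix_inv S *v (W + g)"
  have Sy: "S *v y = W + g" unfolding y_def by (rule matrix_inv_cancel(1)[OF coercive_norm_le(1)[OF l S]])
  have ny: "norm y \<le> (norm W + norm g) / l"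
    using coercive_norm_le(2)[OF l S, of y] norm_triangle_ineq[of W g] l unfolding Sy
    by (meson divide_right_mono less_imp_le order_trans)
  have "A *v ?D = - R - (A - S) *v y"
    unfolding matrix_vector_mult_diff_distrib d matrix_vector_mult_diff_rdistrib Sy
    by (simp add: y_def matrix_vector_right_distrib algebra_simps)
  then have "norm (A *v ?D) \<le> norm R + norm ((A - S) *v y)"
    by (metis norm_minus_cancel norm_triangle_ineq4)
  also have "norm ((A - S) *v y) \<le> l1_norm (A - S) * ((norm W + norm g) / l)"
    by (intro order_trans[OF norm_matrix_vector_le] mult_left_mono ny) (auto simp: l1_norm_def intro!: sum_nonneg)
  finally have "norm (A *v ?D) / (l / 2) \<le> (norm R + l1_norm (A - S) * ((norm W + norm g) / l)) / (l / 2)"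
    using l by (intro divide_right_mono) auto
  \<comment> \<open>The perturbed matrix keeps coercivity l/2, whence the factor 2/l.\<close>
  moreover have "norm ?D \<le> norm (A *v ?D) / (l / 2)" using l by (intro coercive_norm_le(2) perturbed_coercive[OF l S e]) auto
  ultimately show ?thesis by (simp add: field_simps)
qed

section \<open>Measurability of solutions of random linear systems\<close>

lemma borel_measurable_vecI:
  fixes f :: "'a \<Rightarrow> real^'k"
  assumes "\<And>a. (\<lambda>\<omega>. f \<omega> $ a) \<in> borel_measurable M"
  shows "f \<in> borel_measurable M"
proof -
  have "(\<lambda>\<omega>. \<Sum>a\<in>UNIV. f \<omega> $ a *\<^sub>R (axis a 1 :: real^'k)) \<in> borel_measurable M"
    using assms by (intro borel_measurable_sum borel_measurable_scaleR) auto
  moreover have "(\<Sum>a\<in>UNIV. f \<omega> $ a *\<^sub>R (axis a 1 :: real^'k)) = f \<omega>" for \<omega>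
    by (simp add: vec_eq_iff axis_def if_distrib sum.delta cong: if_cong)
  ultimately show ?thesis by simp
qed

lemma borel_measurable_det:
  fixes A :: "'a \<Rightarrow> real^'k^'k"
  assumes "\<And>a b. (\<lambda>\<omega>. A \<omega> $ a $ b) \<in> borel_measurable M"
  shows "(\<lambda>\<omega>. det (A \<omega>)) \<in> borel_measurable M"
  unfolding det_def using assms by (intro borel_measurable_sum borel_measurable_times borel_measurable_prod) auto

text \<open>Cramer's rule expresses the solution by determinants where the matrix is invertible. On
  the remaining event \<open>matrix_inv\<close> still has a value, and that case must be measurable
  too.\<close>

lemma borel_measurable_matrix_inv_vector:
  fixes A :: "'a \<Rightarrow> real^'k^'k" and v :: "'a \<Rightarrow> real^'k"
  assumes A: "\<And>a b. (\<lambda>\<omega>. A \<omega> $ a $ b) \<in> borel_measurable M" and v: "\<And>a. (\<lambda>\<omega>. v \<omega> $ a) \<in> borel_measurable M"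
  shows "(\<lambda>\<omega>. matrix_inv (A \<omega>) *v v \<omega>) \<in> borel_measurable M"
proof (rule borel_measurable_vecI)
  fix k
  \<comment> \<open>For every singular matrix the choice in \<open>matrix_inv\<close> ranges over
    the same empty predicate, so it returns one and the same matrix; the zero matrix is a
    representative.\<close>
  let ?C = "matrix_inv (0::real^'k^'k)"
  have e: "(matrix_inv (A \<omega>) *v v \<omega>) $ k =
    (if det (A \<omega>) = 0 then (\<Sum>j\<in>UNIV. ?C $ k $ j * v \<omega> $ j)
     else det (\<chi> i j. if j = k then v \<omega> $ i else A \<omega> $ i $ j) / det (A \<omega>))" for \<omega>
  proof (cases "det (A \<omega>) = 0")
    case True
    have "det (0::real^'k^'k) = 0"
      by (rule det_zero_row) (simp add: row_def vec_eq_iff)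
    then have "\<not> invertible (A \<omega>)" "\<not> invertible (0::real^'k^'k)"
      using True by (simp_all add: invertible_det_nz)
    then have "matrix_inv (A \<omega>) = ?C" unfolding matrix_inv_def invertible_def by (metis (no_types, lifting))
    then show ?thesis using True by (simp add: matrix_vector_mult_def)
  next
    case False
    then have "A \<omega> *v (matrix_inv (A \<omega>) *v v \<omega>) = v \<omega>"
      by (intro matrix_inv_cancel) (simp add: invertible_det_nz)
    then show ?thesis using cramer[OF False] False by simp
  qed
  have 1: "(\<lambda>\<omega>. det (A \<omega>)) \<in> borel_measurable M" using A by (rule borel_measurable_det)
  have 2: "(\<lambda>\<omega>. det (\<chi> i j. if j = k then v \<omega> $ i else A \<omega> $ i $ j)) \<in> borel_measurable M"
    by (rule borel_measurable_det) (use A v in auto)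
  have 3: "(\<lambda>\<omega>. \<Sum>j\<in>UNIV. ?C $ k $ j * v \<omega> $ j) \<in> borel_measurable M"
    using v by (intro borel_measurable_sum borel_measurable_times) auto
  show "(\<lambda>\<omega>. (matrix_inv (A \<omega>) *v v \<omega>) $ k) \<in> borel_measurable M"
    unfolding e using 1 2 3 by (intro measurable_If borel_measurable_divide) simp_all
qed

lemma sum_demeaned_product:
  fixes f g :: "nat \<Rightarrow> real"
  assumes m: "m \<ge> 1"
  shows "(\<Sum>t<m. (f t - sum f {..<m} / real m) * (g t - sum g {..<m} / real m))
     = (\<Sum>t<m. f t * g t) - sum f {..<m} * sum g {..<m} / real m"
proof -
  define F where "F = sum f {..<m}"
  define G where "G = sum g {..<m}"
  have "(\<Sum>t<m. (f t - F / real m) * (g t - G / real m))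
     = (\<Sum>t<m. f t * g t - (F / real m) * g t - (G / real m) * f t + F * G / (real m * real m))"
    by (intro sum.cong) (auto simp: algebra_simps)
  also have "\<dots> = (\<Sum>t<m. f t * g t) - (F / real m) * G - (G / real m) * F + real m * (F * G / (real m * real m))"
    by (simp only: sum.distrib sum_subtractf sum_constant card_lessThan F_def G_def flip: sum_distrib_left)
  also have "\<dots> = (\<Sum>t<m. f t * g t) - F * G / real m" using m by (simp add: field_simps)
  finally show ?thesis unfolding F_def G_def .
qed

section \<open>Mean-square bounds for the score, the remainder and the sample second-moment
  matrix\<close>

context panel
begin

definition W :: "nat \<Rightarrow> nat \<Rightarrow> 'a \<Rightarrow> real^'k" where
  "W n m \<omega> = (1 / sqrt (real n * real m)) *\<^sub>R (\<Sum>i<n. Us m i \<omega>)"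

text \<open>The second summand cancels the mean of the first, by \<open>EsZs_bias\<close>; so
  \<open>R\<close> is a centred sum of independent terms.\<close>

definition R :: "nat \<Rightarrow> nat \<Rightarrow> 'a \<Rightarrow> real^'k" where
  "R n m \<omega> = (1 / (real m * sqrt (real n * real m))) *\<^sub>R (\<Sum>i<n. Es m i \<omega> *\<^sub>R Zs m i \<omega>)
     + sqrt (real n / real m) *\<^sub>R bNM M x eps n m"

definition Shat :: "nat \<Rightarrow> nat \<Rightarrow> 'a \<Rightarrow> real^'k^'k" where
  "Shat n m \<omega> = (1 / (real n * real m)) *\<^sub>R
     (\<Sum>i<n. \<Sum>t<m. outer (x i t \<omega> - xbar x i m \<omega>) (x i t \<omega> - xbar x i m \<omega>))"

text \<open>All remainders are \<open>O(\<eta>)\<close> in mean: a second moment of order \<open>\<eta>\<^sup>2\<close> suffices, as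
  \<open>\<bar>X\<bar> \<le> \<eta> + X\<^sup>2 / \<eta>\<close>.\<close>
definition \<eta> :: "nat \<Rightarrow> nat \<Rightarrow> real" where "\<eta> n m = sqrt (1 / real n + 1 / real m)"

lemma \<eta>_sq: "(\<eta> n m)\<^sup>2 = 1 / real n + 1 / real m"
  by (simp add: \<eta>_def)

lemma \<eta>_pos: "n \<ge> 1 \<Longrightarrow> \<eta> n m > 0"
  by (simp add: \<eta>_def add_pos_nonneg)

lemma WR_measurable [measurable]: "W n m \<in> borel_measurable M" "R n m \<in> borel_measurable M"
  unfolding W_def[abs_def] R_def[abs_def] by measurable

text \<open>The three unit sums are handled jointly because the score uses the first and the
  remainder uses a product of the other two.\<close>

lemma sums_indep:
  assumes "\<And>i. f i \<in> borel_measurable (borel :: ((real^'k) \<times> real \<times> (real^'k)) measure)"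
  shows "indep_vars (\<lambda>_. borel) (\<lambda>i \<omega>. (f i (Us m i \<omega>, Es m i \<omega>, Zs m i \<omega>) :: real)) I"
proof -
  note component_measurable[measurable] assms[measurable]
  define F where "F i h = ((\<Sum>t<m. snd (h t) *\<^sub>R (fst (h t) - expectation (x i 0))), (\<Sum>t<m. snd (h t)),
     (\<Sum>t<m. fst (h t) - expectation (x i 0)))" for i and h :: "nat \<Rightarrow> (real^'k) \<times> real"
  have F: "F i \<in> borel_measurable (PiM UNIV (\<lambda>_. borel))" for i
    unfolding F_def by (intro borel_measurable_Pair) measurable
  have "indep_vars (\<lambda>_. borel) (\<lambda>i \<omega>. f i (F i (path i \<omega>))) I"
    by (rule path_indep) (rule measurable_compose[OF F assms])
  moreover have "F i (path i \<omega>) = (Us m i \<omega>, Es m i \<omega>, Zs m i \<omega>)" for i \<omega>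
    by (simp add: F_def Us_def Es_def Zs_def zc_path) (simp add: path_def)
  ultimately show ?thesis by simp
qed

lemma Us_second_moment: "integrable M (\<lambda>\<omega>. (Us m i \<omega> $ a)\<^sup>2)"
  "m \<ge> 1 \<Longrightarrow> expectation (\<lambda>\<omega>. (Us m i \<omega> $ a)\<^sup>2) \<le> real m * (1 + K4 1)"
proof -
  show i: "integrable M (\<lambda>\<omega>. (Us m i \<omega> $ a)\<^sup>2)"
    by (rule Bochner_Integration.integrable_bound[where f="\<lambda>\<omega>. 1 + (Us m i \<omega> $ a) ^ 4"])
      (use Us_mom4 square_le_pow4 in auto)
  assume m: "m \<ge> 1"
  \<comment> \<open>Weighting by \<open>m\<close> converts a fourth moment of order m^2 into a
    second moment of order m.\<close>
  have le: "u\<^sup>2 \<le> real m + u ^ 4 / real m" for u :: real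
  proof -
    have "0 \<le> (u\<^sup>2 - real m)\<^sup>2" "0 \<le> u\<^sup>2 * real m" by auto
    then have "u\<^sup>2 * real m \<le> (real m)\<^sup>2 + u ^ 4" by (simp add: power2_diff flip: power_mult; linarith)
    then have "u\<^sup>2 \<le> ((real m)\<^sup>2 + u ^ 4) / real m" using m by (simp add: pos_le_divide_eq)
    then show ?thesis using m by (simp add: add_divide_distrib power2_eq_square)
  qed
  have "expectation (\<lambda>\<omega>. (Us m i \<omega> $ a)\<^sup>2) \<le> expectation (\<lambda>\<omega>. real m + (Us m i \<omega> $ a) ^ 4 / real m)"
    using i Us_mom4 le by (intro integral_mono) auto
  also have "\<dots> = real m + expectation (\<lambda>\<omega>. (Us m i \<omega> $ a) ^ 4) / real m" using Us_mom4 by (simp add: prob_space)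
  also have "\<dots> \<le> real m + K4 1 * (real m)\<^sup>2 / real m"
    using Us_mom4(2)[of m i a] by (intro add_left_mono divide_right_mono) auto
  also have "\<dots> = real m * (1 + K4 1)" using m by (simp add: power2_eq_square field_simps)
  finally show "expectation (\<lambda>\<omega>. (Us m i \<omega> $ a)\<^sup>2) \<le> real m * (1 + K4 1)" .
qed

lemma Us_mean: "expectation (\<lambda>\<omega>. v \<bullet> Us m i \<omega>) = 0"
proof -
  have "integrable M (Us m i)" unfolding Us_def[abs_def] using ez_integrable by auto
  moreover have "expectation (Us m i) = 0"
    unfolding Us_def using ez_integrable ez_mean by (simp add: Bochner_Integration.integral_sum)
  ultimately show ?thesis by simp
qed

lemma Us_comp_mean: "expectation (\<lambda>\<omega>. Us m i \<omega> $ a) = 0"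
  using Us_mean[of "axis a 1" m i] by (simp add: inner_axis')

lemma W_second_moment:
  assumes n: "n \<ge> 1" and m: "m \<ge> 1"
  shows "integrable M (\<lambda>\<omega>. (W n m \<omega> $ a)\<^sup>2)" "expectation (\<lambda>\<omega>. (W n m \<omega> $ a)\<^sup>2) \<le> 1 + K4 1"
proof -
  have ind: "indep_vars (\<lambda>_. borel) (\<lambda>i \<omega>. Us m i \<omega> $ a) {..<n}"
    using sums_indep[of "\<lambda>i q. fst q $ a" m "{..<n}"] by simp
  have e: "(W n m \<omega> $ a)\<^sup>2 = (\<Sum>i<n. Us m i \<omega> $ a)\<^sup>2 / (real n * real m)" for \<omega>
    by (simp add: W_def sum_component power_divide)
  have i: "integrable M (\<lambda>\<omega>. (\<Sum>i<n. Us m i \<omega> $ a)\<^sup>2)"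
    by (rule square_sum_indep(1)[OF ind]) (simp_all add: Us_second_moment Us_comp_mean)
  then show "integrable M (\<lambda>\<omega>. (W n m \<omega> $ a)\<^sup>2)" unfolding e by simp
  have "expectation (\<lambda>\<omega>. (\<Sum>i<n. Us m i \<omega> $ a)\<^sup>2) = (\<Sum>i<n. expectation (\<lambda>\<omega>. (Us m i \<omega> $ a)\<^sup>2))"
    by (rule square_sum_indep(2)[OF ind]) (simp_all add: Us_second_moment Us_comp_mean)
  also have "\<dots> \<le> (\<Sum>i<n. real m * (1 + K4 1))" using Us_second_moment(2)[OF m] by (intro sum_mono)
  finally have "expectation (\<lambda>\<omega>. (\<Sum>i<n. Us m i \<omega> $ a)\<^sup>2) / (real n * real m) \<le> real n * (real m * (1 + K4 1)) / (real n * real m)"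
    by (intro divide_right_mono) auto
  then show "expectation (\<lambda>\<omega>. (W n m \<omega> $ a)\<^sup>2) \<le> 1 + K4 1" unfolding e using n m by simp
qed

lemma EsZs_second_moment:
  "integrable M (\<lambda>\<omega>. (Es m i \<omega> * Zs m i \<omega> $ a)\<^sup>2)" "expectation (\<lambda>\<omega>. (Es m i \<omega> * Zs m i \<omega> $ a)\<^sup>2) \<le> K4 1 * (real m)\<^sup>2"
  by (rule product_second_moment; (rule Es_mom4 Zs_mom4 | measurable))+

lemma ZsZs_second_moment:
  "integrable M (\<lambda>\<omega>. (Zs m i \<omega> $ a * Zs m i \<omega> $ b)\<^sup>2)" "expectation (\<lambda>\<omega>. (Zs m i \<omega> $ a * Zs m i \<omega> $ b)\<^sup>2) \<le> K4 1 * (real m)\<^sup>2"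
  by (rule product_second_moment; (rule Zs_mom4 | measurable))+

text \<open>Variances add over the n independent units, each at most of order m^2; the squared
  normalisation n m^3 leaves the order 1/m.\<close>

lemma R_second_moment:
  assumes n: "n \<ge> 1" and m: "m \<ge> 1"
  shows "integrable M (\<lambda>\<omega>. (R n m \<omega> $ a)\<^sup>2)" "expectation (\<lambda>\<omega>. (R n m \<omega> $ a)\<^sup>2) \<le> K4 1 * (\<eta> n m)\<^sup>2"
proof -
  define Y where "Y i \<omega> = Es m i \<omega> * Zs m i \<omega> $ a" for i \<omega>
  let ?k = "real m * sqrt (real n * real m)"
  have k: "?k > 0" using n m by simp
  have ind: "indep_vars (\<lambda>_. borel) Y {..<n}"
    using sums_indep[of "\<lambda>i q. fst (snd q) * snd (snd q) $ a" m "{..<n}"] unfolding Y_def by simp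
  have bias: "sqrt (real n / real m) * bNM M x eps n m $ a = - (\<Sum>i<n. expectation (Y i)) / ?k"
  proof -
    have "sqrt (real n / real m) * ?k = real n * real m"
      using n m by (simp add: real_sqrt_divide real_sqrt_mult field_simps)
    then have "sqrt (real n / real m) = real n * real m / ?k"
      by (rule eq_divide_imp[rotated]) (use n m in simp)
    then show ?thesis using EsZs_bias[OF m n, of a] unfolding Y_def by simp
  qed
  have e0: "R n m \<omega> $ a = (\<Sum>i<n. Y i \<omega> - expectation (Y i)) / ?k" for \<omega>
    unfolding R_def using bias by (simp add: sum_component Y_def sum_subtractf diff_divide_distrib)
  have e: "(R n m \<omega> $ a)\<^sup>2 = (\<Sum>i<n. Y i \<omega> - expectation (Y i))\<^sup>2 / ((real m)\<^sup>2 * (real n * real m))" for \<omega>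
    unfolding e0 by (simp add: power_divide power_mult_distrib)
  have Y2: "integrable M (\<lambda>\<omega>. (Y i \<omega>)\<^sup>2)" "expectation (\<lambda>\<omega>. (Y i \<omega>)\<^sup>2) \<le> K4 1 * (real m)\<^sup>2" for i
    unfolding Y_def by (rule EsZs_second_moment)+
  note 1 = square_sum_centered_le[OF ind Y2]
  show "integrable M (\<lambda>\<omega>. (R n m \<omega> $ a)\<^sup>2)" unfolding e using 1 by simp
  have "expectation (\<lambda>\<omega>. (R n m \<omega> $ a)\<^sup>2) \<le> real n * (K4 1 * (real m)\<^sup>2) / ((real m)\<^sup>2 * (real n * real m))"
    unfolding e integral_divide_zero by (intro divide_right_mono 1) simp
  also have "\<dots> = K4 1 * (1 / real m)" using n m by simp
  also have "\<dots> \<le> K4 1 * (\<eta> n m)\<^sup>2" unfolding \<eta>_sq using K4_nonneg by (intro mult_left_mono) auto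
  finally show "expectation (\<lambda>\<omega>. (R n m \<omega> $ a)\<^sup>2) \<le> K4 1 * (\<eta> n m)\<^sup>2" .
qed

text \<open>Instead of summing autocovariances, \<open>EsZs_bias\<close> is read backwards: the
  second moment of E Z is of order m^2, so its mean is of order m.\<close>

lemma bNM_bound:
  assumes n: "n \<ge> 1" and m: "m \<ge> 1"
  shows "\<bar>bNM M x eps n m $ a\<bar> \<le> 1 + K4 1"
proof -
  have E: "\<bar>expectation (\<lambda>\<omega>. Es m i \<omega> * Zs m i \<omega> $ a)\<bar> \<le> (1 + K4 1) * real m" for i
  proof -
    have "expectation (\<lambda>\<omega>. \<bar>Es m i \<omega> * Zs m i \<omega> $ a\<bar>) \<le> (1 + K4 1) * real m"
      by (rule expectation_abs_le(2)) (use EsZs_second_moment m in auto)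
    then show ?thesis using integral_abs_bound[of M "\<lambda>\<omega>. Es m i \<omega> * Zs m i \<omega> $ a"] by linarith
  qed
  have "real n * real m * \<bar>bNM M x eps n m $ a\<bar> = \<bar>\<Sum>i<n. expectation (\<lambda>\<omega>. Es m i \<omega> * Zs m i \<omega> $ a)\<bar>"
    unfolding EsZs_bias[OF m n] by (simp add: abs_mult)
  also have "\<dots> \<le> (\<Sum>i<n. (1 + K4 1) * real m)" by (intro order_trans[OF sum_abs] sum_mono E)
  also have "\<dots> = real n * real m * (1 + K4 1)" by simp
  finally show ?thesis using n m by (simp add: mult_le_cancel_left_pos)
qed

text \<open>The mean of \<open>x\<close> is constant in time by stationarity and disappears on
  demeaning, so \<open>x\<close> may be replaced by \<open>z\<close>.\<close>

lemma demeaned: "m \<ge> 1 \<Longrightarrow> x i t \<omega> - xbar x i m \<omega> = z i t \<omega> - (1 / real m) *\<^sub>R Zs m i \<omega>"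
proof -
  assume m: "m \<ge> 1"
  have "Zs m i \<omega> = (\<Sum>t<m. x i t \<omega>) - real m *\<^sub>R expectation (x i 0)"
    unfolding Zs_def zc_path by (simp add: path_def sum_subtractf scaleR_conv_of_real sum_constant_scaleR)
  then show ?thesis using m
    by (simp add: xbar_def zc_path path_def scaleR_diff_right)
qed

lemma Shat_nth:
  assumes n: "n \<ge> 1" and m: "m \<ge> 1"
  shows "Shat n m \<omega> $ a $ b = (\<Sum>i<n. (\<Sum>t<m. z i t \<omega> $ a * z i t \<omega> $ b) - Zs m i \<omega> $ a * Zs m i \<omega> $ b / real m) / (real n * real m)"
proof -
  have "(\<Sum>t<m. (z i t \<omega> - (1 / real m) *\<^sub>R Zs m i \<omega>) $ a * (z i t \<omega> - (1 / real m) *\<^sub>R Zs m i \<omega>) $ b)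
     = (\<Sum>t<m. z i t \<omega> $ a * z i t \<omega> $ b) - Zs m i \<omega> $ a * Zs m i \<omega> $ b / real m" for i
    using sum_demeaned_product[OF m, of "\<lambda>t. z i t \<omega> $ a" "\<lambda>t. z i t \<omega> $ b"]
    by (simp add: Zs_def)
  then show ?thesis unfolding Shat_def demeaned[OF m] by (simp add: sum_component)
qed

text \<open>The two summands are the constants of the 1/n and the 1/m part of the error in the
  second-moment matrix, doubled by (u - v)^2 <= 2u^2 + 2v^2.\<close>

definition Ke :: real where "Ke = 2 * (1 + B1) + 2 * K4 1"

text \<open>The error splits into a centred average over independent units, of variance order 1/n,
  and the demeaning correction built from products of the sums \<open>Zs\<close>, controlled at
  order 1/m by their fourth moments.\<close>

lemma Shat_error:
  assumes n: "n \<ge> 1" and m: "m \<ge> 1"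
  shows "integrable M (\<lambda>\<omega>. ((Shat n m \<omega> - SigmaNM M x n m) $ a $ b)\<^sup>2)"
    "expectation (\<lambda>\<omega>. ((Shat n m \<omega> - SigmaNM M x n m) $ a $ b)\<^sup>2) \<le> Ke * (\<eta> n m)\<^sup>2"
    "(\<lambda>\<omega>. (Shat n m \<omega> - SigmaNM M x n m) $ a $ b) \<in> borel_measurable M"
proof -
  define Q where "Q i \<omega> = (\<Sum>t<m. z i t \<omega> $ a * z i t \<omega> $ b)" for i \<omega>
  define P where "P i \<omega> = Zs m i \<omega> $ a * Zs m i \<omega> $ b" for i \<omega>
  have [measurable]: "Q i \<in> borel_measurable M" "P i \<in> borel_measurable M" for i
    unfolding Q_def[abs_def] P_def[abs_def] by measurable
  have EQ: "expectation (Q i) = (\<Sum>t<m. expectation (\<lambda>\<omega>. z i t \<omega> $ a * z i t \<omega> $ b))" for i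
    unfolding Q_def by (simp add: Bochner_Integration.integral_sum zz_integrable)
  let ?F = "\<lambda>\<omega>. (\<Sum>i<n. Q i \<omega> - expectation (Q i)) / (real n * real m)"
  let ?G = "\<lambda>\<omega>. (\<Sum>i<n. P i \<omega>) / (real n * (real m)\<^sup>2)"
  have e: "(Shat n m \<omega> - SigmaNM M x n m) $ a $ b = ?F \<omega> - ?G \<omega>" for \<omega>
    by (simp add: Shat_nth[OF n m] Sigma_nth EQ Q_def P_def sum_subtractf diff_divide_distrib power2_eq_square
        flip: sum_divide_distrib)
  show meas: "(\<lambda>\<omega>. (Shat n m \<omega> - SigmaNM M x n m) $ a $ b) \<in> borel_measurable M"
    unfolding e by measurable
  \<comment> \<open>Cauchy-Schwarz over time loses the cancellation between periods, but order m^2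
    is good enough: the average over units supplies the decay.\<close>
  have Q2: "integrable M (\<lambda>\<omega>. (Q i \<omega>)\<^sup>2)" "expectation (\<lambda>\<omega>. (Q i \<omega>)\<^sup>2) \<le> (real m)\<^sup>2 * (1 + B1)" for i
  proof -
    have zz: "integrable M (\<lambda>\<omega>. (z i t \<omega> $ a * z i t \<omega> $ b)\<^sup>2)" "expectation (\<lambda>\<omega>. (z i t \<omega> $ a * z i t \<omega> $ b)\<^sup>2) \<le> 1 + B1" for t
      by (rule product_second_moment; (rule z_mom4 | measurable))+
    have le: "(Q i \<omega>)\<^sup>2 \<le> real m * (\<Sum>t<m. (z i t \<omega> $ a * z i t \<omega> $ b)\<^sup>2)" for \<omega>
      unfolding Q_def using sum_squared_le_sum_of_squares[of "\<lambda>t. z i t \<omega> $ a * z i t \<omega> $ b" "{..<m}"]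
      by (simp only: card_lessThan mult.commute)
    have ir: "integrable M (\<lambda>\<omega>. real m * (\<Sum>t<m. (z i t \<omega> $ a * z i t \<omega> $ b)\<^sup>2))" using zz by auto
    show 1: "integrable M (\<lambda>\<omega>. (Q i \<omega>)\<^sup>2)"
      by (rule Bochner_Integration.integrable_bound[OF ir]) (auto intro!: AE_I2 order_trans[OF le] abs_ge_self)
    have "expectation (\<lambda>\<omega>. (Q i \<omega>)\<^sup>2) \<le> expectation (\<lambda>\<omega>. real m * (\<Sum>t<m. (z i t \<omega> $ a * z i t \<omega> $ b)\<^sup>2))"
      using 1 ir le by (intro integral_mono)
    also have "\<dots> = real m * (\<Sum>t<m. expectation (\<lambda>\<omega>. (z i t \<omega> $ a * z i t \<omega> $ b)\<^sup>2))"
      using zz by (simp add: Bochner_Integration.integral_sum)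
    also have "\<dots> \<le> real m * (\<Sum>t<m. 1 + B1)" using zz by (intro mult_left_mono sum_mono) auto
    finally show "expectation (\<lambda>\<omega>. (Q i \<omega>)\<^sup>2) \<le> (real m)\<^sup>2 * (1 + B1)" by (simp add: power2_eq_square mult_ac)
  qed
  have ind: "indep_vars (\<lambda>_. borel) Q {..<n}"
  proof -
    note component_measurable[measurable]
    have "(\<lambda>h. \<Sum>t<m. (fst (h t) - expectation (x i 0)) $ a * (fst (h t) - expectation (x i 0)) $ b)
       \<in> borel_measurable (PiM UNIV (\<lambda>_. borel))" for i by measurable
    from path_indep[OF this, where I="{..<n}"] show ?thesis unfolding Q_def[abs_def] zc_path .
  qed
  have F: "integrable M (\<lambda>\<omega>. (?F \<omega>)\<^sup>2)" "expectation (\<lambda>\<omega>. (?F \<omega>)\<^sup>2) \<le> (1 + B1) / real n"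
  proof -
    note 1 = square_sum_centered_le[OF ind Q2]
    show "integrable M (\<lambda>\<omega>. (?F \<omega>)\<^sup>2)" using 1 by (simp add: power_divide)
    have "expectation (\<lambda>\<omega>. (?F \<omega>)\<^sup>2) \<le> real n * ((real m)\<^sup>2 * (1 + B1)) / (real n * real m)\<^sup>2"
      unfolding power_divide using 1 by (simp add: divide_right_mono)
    also have "\<dots> = (1 + B1) / real n" using n m by (simp add: power2_eq_square field_simps)
    finally show "expectation (\<lambda>\<omega>. (?F \<omega>)\<^sup>2) \<le> (1 + B1) / real n" .
  qed
  have G: "integrable M (\<lambda>\<omega>. (?G \<omega>)\<^sup>2)" "expectation (\<lambda>\<omega>. (?G \<omega>)\<^sup>2) \<le> K4 1 / real m"
  proof -
    have PP: "integrable M (\<lambda>\<omega>. (P i \<omega>)\<^sup>2)" "expectation (\<lambda>\<omega>. (P i \<omega>)\<^sup>2) \<le> K4 1 * (real m)\<^sup>2" for i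
      unfolding P_def by (rule ZsZs_second_moment)+
    have le: "(\<Sum>i<n. P i \<omega>)\<^sup>2 \<le> real n * (\<Sum>i<n. (P i \<omega>)\<^sup>2)" for \<omega>
      using sum_squared_le_sum_of_squares[of "\<lambda>i. P i \<omega>" "{..<n}"]
      by (simp only: card_lessThan mult.commute)
    have ir: "integrable M (\<lambda>\<omega>. real n * (\<Sum>i<n. (P i \<omega>)\<^sup>2))" using PP by auto
    have 1: "integrable M (\<lambda>\<omega>. (\<Sum>i<n. P i \<omega>)\<^sup>2)"
      by (rule Bochner_Integration.integrable_bound[OF ir]) (auto intro!: AE_I2 order_trans[OF le] abs_ge_self)
    then show "integrable M (\<lambda>\<omega>. (?G \<omega>)\<^sup>2)" by (simp add: power_divide)
    have "expectation (\<lambda>\<omega>. (\<Sum>i<n. P i \<omega>)\<^sup>2) \<le> expectation (\<lambda>\<omega>. real n * (\<Sum>i<n. (P i \<omega>)\<^sup>2))"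
      using 1 ir le by (intro integral_mono)
    also have "\<dots> = real n * (\<Sum>i<n. expectation (\<lambda>\<omega>. (P i \<omega>)\<^sup>2))"
      using PP by (simp add: Bochner_Integration.integral_sum)
    also have "\<dots> \<le> real n * (\<Sum>i<n. K4 1 * (real m)\<^sup>2)" using PP by (intro mult_left_mono sum_mono) auto
    finally have "expectation (\<lambda>\<omega>. (\<Sum>i<n. P i \<omega>)\<^sup>2) / (real n * (real m)\<^sup>2)\<^sup>2 \<le> real n * (\<Sum>i<n. K4 1 * (real m)\<^sup>2) / (real n * (real m)\<^sup>2)\<^sup>2"
      by (intro divide_right_mono) auto
    also have "\<dots> = K4 1 / (real m)\<^sup>2" using n m by (simp add: power2_eq_square field_simps)
    also have "\<dots> \<le> K4 1 / real m"
      using m K4_nonneg by (intro divide_left_mono) (auto simp: power2_eq_square)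
    finally show "expectation (\<lambda>\<omega>. (?G \<omega>)\<^sup>2) \<le> K4 1 / real m" by (simp add: power_divide)
  qed
  have le: "(u - v)\<^sup>2 \<le> 2 * u\<^sup>2 + 2 * v\<^sup>2" for u v :: real
    using zero_le_power2[of "u + v"] by (simp add: power2_diff power2_sum)
  have ir: "integrable M (\<lambda>\<omega>. 2 * (?F \<omega>)\<^sup>2 + 2 * (?G \<omega>)\<^sup>2)"
    by (intro Bochner_Integration.integrable_add integrable_mult_right F G)
  show 1: "integrable M (\<lambda>\<omega>. ((Shat n m \<omega> - SigmaNM M x n m) $ a $ b)\<^sup>2)"
  proof (rule Bochner_Integration.integrable_bound[OF ir])
    show "(\<lambda>\<omega>. ((Shat n m \<omega> - SigmaNM M x n m) $ a $ b)\<^sup>2) \<in> borel_measurable M" using meas by measurable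
    show "AE \<omega> in M. norm (((Shat n m \<omega> - SigmaNM M x n m) $ a $ b)\<^sup>2) \<le> norm (2 * (?F \<omega>)\<^sup>2 + 2 * (?G \<omega>)\<^sup>2)"
      unfolding e real_norm_def abs_power2 by (intro AE_I2 order_trans[OF le abs_ge_self])
  qed
  have "expectation (\<lambda>\<omega>. ((Shat n m \<omega> - SigmaNM M x n m) $ a $ b)\<^sup>2) \<le> expectation (\<lambda>\<omega>. 2 * (?F \<omega>)\<^sup>2 + 2 * (?G \<omega>)\<^sup>2)"
    using 1 ir unfolding e by (intro integral_mono le)
  also have "\<dots> = 2 * expectation (\<lambda>\<omega>. (?F \<omega>)\<^sup>2) + 2 * expectation (\<lambda>\<omega>. (?G \<omega>)\<^sup>2)"
    using F(1) G(1) by (subst Bochner_Integration.integral_add) auto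
  also have "\<dots> \<le> 2 * ((1 + B1) / real n) + 2 * (K4 1 / real m)" using F G by (intro add_mono mult_left_mono) auto
  also have "\<dots> \<le> Ke * (1 / real n) + Ke * (1 / real m)"
  proof (intro add_mono)
    have "2 * (1 + B1) * (1 / real n) \<le> Ke * (1 / real n)"
      using K4_nonneg by (intro mult_right_mono) (auto simp: Ke_def)
    then show "2 * ((1 + B1) / real n) \<le> Ke * (1 / real n)" by simp
    have "2 * K4 1 * (1 / real m) \<le> Ke * (1 / real m)"
      using B1 by (intro mult_right_mono) (auto simp: Ke_def)
    then show "2 * (K4 1 / real m) \<le> Ke * (1 / real m)" by simp
  qed
  finally show "expectation (\<lambda>\<omega>. ((Shat n m \<omega> - SigmaNM M x n m) $ a $ b)\<^sup>2) \<le> Ke * (\<eta> n m)\<^sup>2"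
    unfolding \<eta>_sq by (simp add: distrib_left)
qed

text \<open>Dividing a unit's score by sqrt(m) gives independent centred variables with fourth
  moments bounded by \<open>K4 c\<close> uniformly in m, as the Lyapunov bound asks.\<close>

lemma W_char_bound:
  assumes n: "n \<ge> 1" and m: "m \<ge> 1" and v: "norm v \<le> c"
  shows "\<bar>expectation (\<lambda>\<omega>. cos (v \<bullet> W n m \<omega> + b)) - cos b * exp (- (v \<bullet> (OmegaNM M x eps n m *v v)) / 2)\<bar>
     \<le> (1 + K4 c)\<^sup>2 / sqrt (real n)"
proof -
  define X where "X i \<omega> = (v \<bullet> Us m i \<omega>) / sqrt (real m)" for i \<omega>
  have ind: "indep_vars (\<lambda>_. borel) X {..<n}"
    using sums_indep[of "\<lambda>i q. (v \<bullet> fst q) / sqrt (real m)" m "{..<n}"] unfolding X_def[abs_def] by simp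
  have X4: "X i \<omega> ^ 4 = (v \<bullet> Us m i \<omega>) ^ 4 / (real m)\<^sup>2" for i \<omega>
  proof -
    have "sqrt (real m) ^ 4 = (real m)\<^sup>2" using power_mult[of "sqrt (real m)" 2 2] by simp
    then show ?thesis by (simp add: X_def power_divide)
  qed
  have i4: "integrable M (\<lambda>\<omega>. X i \<omega> ^ 4)" for i unfolding X4 using inner_Us_mom4[OF v] by simp
  have K: "expectation (\<lambda>\<omega>. X i \<omega> ^ 4) \<le> K4 c" for i
    unfolding X4 using inner_Us_mom4[OF v, of m i] m by (simp add: divide_le_eq)
  have mean: "expectation (X i) = 0" for i unfolding X_def by (simp add: Us_mean)
  have Wv: "(\<Sum>i<n. X i \<omega>) / sqrt (real n) = v \<bullet> W n m \<omega>" for \<omega>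
    by (simp add: X_def W_def inner_sum_right real_sqrt_mult mult.commute flip: sum_divide_distrib)
  have V: "(\<Sum>i<n. expectation (\<lambda>\<omega>. (X i \<omega>)\<^sup>2)) / real n = v \<bullet> (OmegaNM M x eps n m *v v)"
    unfolding Omega_quadratic_form[OF m n]
    by (simp add: X_def power_divide mult.commute flip: sum_divide_distrib)
  show ?thesis
    using lyapunov_char_bound[OF ind n i4 mean K, of b] unfolding Wv V by simp
qed

end

subsection \<open>The within-group estimation error\<close>

lemma sum_matrix_vector_mult: "(\<Sum>i\<in>I. A i) *v v = (\<Sum>i\<in>I. (A i :: real^'k^'k) *v v)"
  by (induction I rule: infinite_finite_induct) (simp_all add: matrix_vector_mult_add_rdistrib)

lemma scaleR_matrix_vector_mult: "(c *\<^sub>R A) *v v = c *\<^sub>R ((A :: real^'k^'k) *v v)"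
  by (simp add: vec_eq_iff matrix_vector_mult_def sum_distrib_left mult.assoc)

lemma invertible_scaleR:
  fixes A :: "real^'k^'k" assumes "invertible A" "c \<noteq> 0" shows "invertible (c *\<^sub>R A)"
proof -
  obtain A' where A': "A ** A' = mat 1" "A' ** A = mat 1" using assms unfolding invertible_def by auto
  have "(c *\<^sub>R A) ** ((1 / c) *\<^sub>R A') = A ** A'" "((1 / c) *\<^sub>R A') ** (c *\<^sub>R A) = A' ** A"
    using assms(2) by (simp_all add: matrix_matrix_mult_def vec_eq_iff)
  then show ?thesis using A' unfolding invertible_def by metis
qed

lemma transpose_matrix_inv:
  fixes A :: "real^'k^'k" assumes A: "invertible A" and sym: "transpose A = A"
  shows "transpose (matrix_inv A) = matrix_inv A"
proof -
  have "transpose (matrix_inv A) ** A = mat 1"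
    using matrix_inv_mul(1)[OF A] sym by (metis matrix_transpose_mul transpose_mat)
  then have "transpose (matrix_inv A) ** (A ** matrix_inv A) = matrix_inv A"
    by (simp add: matrix_mul_assoc)
  then show ?thesis by (simp add: matrix_inv_mul(1)[OF A])
qed

lemma abs_cos_diff_le: "\<bar>cos a - cos b\<bar> \<le> \<bar>a - (b::real)\<bar>"
proof -
  have "\<bar>cos a - cos b\<bar> = 2 * (\<bar>sin ((a + b) / 2)\<bar> * \<bar>sin ((b - a) / 2)\<bar>)"
    by (simp add: cos_diff_cos abs_mult)
  also have "\<dots> \<le> 2 * (1 * \<bar>(b - a) / 2\<bar>)"
    by (intro mult_left_mono mult_mono abs_sin_x_le_abs_x) auto
  finally show ?thesis by (simp add: abs_minus_commute)
qed

lemma (in prob_space) markov_le: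
  assumes i: "integrable M X" and X: "\<And>\<omega>. X \<omega> \<ge> 0" and c: "c > 0"
  shows "measure M {\<omega>\<in>space M. X \<omega> > c} \<le> expectation X / c"
proof -
  have [measurable]: "X \<in> borel_measurable M" using i by auto
  have "measure M {\<omega>\<in>space M. X \<omega> > c} \<le> measure M {\<omega>\<in>space M. X \<omega> \<ge> c}"
    by (intro finite_measure_mono) auto
  also have "\<dots> \<le> expectation X / c"
    by (rule integral_Markov_inequality_measure[where A="{}"]) (use i X c in auto)
  finally show ?thesis .
qed

lemma panel_limit_tendsto:
  "filterlim fst at_top (panel_limit c)" "filterlim snd at_top (panel_limit c)"
  "((\<lambda>(n, m). real n / real m) \<longlongrightarrow> c) (panel_limit c)"
proof -
  show "filterlim fst at_top (panel_limit c)"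
    unfolding panel_limit_def by (rule filterlim_mono[OF filterlim_fst order_refl]) (rule inf_le1)
  show "filterlim snd at_top (panel_limit c)"
    unfolding panel_limit_def by (rule filterlim_mono[OF filterlim_snd order_refl]) (rule inf_le1)
  show "((\<lambda>(n, m). real n / real m) \<longlongrightarrow> c) (panel_limit c)"
    unfolding panel_limit_def by (rule filterlim_mono[OF filterlim_filtercomap order_refl]) simp
qed

context panel
begin

abbreviation "\<Sigma> \<equiv> SigmaNM M x"
abbreviation "\<Omega> \<equiv> OmegaNM M x eps"
abbreviation "bias \<equiv> bNM M x eps"

definition est_error :: "(nat \<Rightarrow> nat \<Rightarrow> 'a \<Rightarrow> real) \<Rightarrow> real^'k \<Rightarrow> nat \<Rightarrow> nat \<Rightarrow> 'a \<Rightarrow> real^'k" where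
  "est_error y bet n m \<omega> = sqrt (real (n * m)) *\<^sub>R
     (within_est x y n m \<omega> - bet - (1 / real m) *\<^sub>R (matrix_inv (\<Sigma> n m) *v bias n m))"

lemma est_error_measurable:
  assumes model: "\<And>i t \<omega>. \<omega> \<in> space M \<Longrightarrow> y i t \<omega> = alpha i + x i t \<omega> \<bullet> bet + eps i t \<omega>"
  shows "est_error y bet n m \<in> borel_measurable M"
proof -
  \<comment> \<open>Measurability of \<open>y\<close> is inherited from the model equation, which
    holds on \<open>space M\<close>.\<close>
  have y [measurable]: "y i t \<in> borel_measurable M" for i t
  proof -
    have "(\<lambda>\<omega>. alpha i + x i t \<omega> \<bullet> bet + eps i t \<omega>) \<in> borel_measurable M" by measurable
    then show ?thesis using model by (subst measurable_cong) auto
  qed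
  have [measurable]: "xbar x i m \<in> borel_measurable M" "ybar y i m \<in> borel_measurable M" for i
    unfolding xbar_def[abs_def] ybar_def[abs_def] by measurable
  have "within_est x y n m \<in> borel_measurable M"
    unfolding within_est_def[abs_def]
    by (rule borel_measurable_matrix_inv_vector) (simp_all add: sum_component)
  then show ?thesis unfolding est_error_def[abs_def] by measurable
qed

text \<open>Demeaning eliminates the fixed effects. The bias enters with the sample matrix applied
  to \<Sigma>^(-1) b, so sqrt(n/m) b is added and subtracted to reach the form expected by
  \<open>perturbed_solution_bound\<close>.\<close>

lemma normal_equations:
  assumes n: "n \<ge> 1" and m: "m \<ge> 1" and \<omega>: "\<omega> \<in> space M" and inv: "invertible (Shat n m \<omega>)"
    and model: "\<And>i t \<omega>. \<omega> \<in> space M \<Longrightarrow> y i t \<omega> = alpha i + x i t \<omega> \<bullet> bet + eps i t \<omega>"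
  shows "Shat n m \<omega> *v est_error y bet n m \<omega> = W n m \<omega> - R n m \<omega> + sqrt (real n / real m) *\<^sub>R bias n m
     - Shat n m \<omega> *v (matrix_inv (\<Sigma> n m) *v (sqrt (real n / real m) *\<^sub>R bias n m))"
proof -
  define d where "d i t = x i t \<omega> - xbar x i m \<omega>" for i t
  define Sm where "Sm = (\<Sum>i<n. \<Sum>t<m. outer (d i t) (d i t))"
  define N where "N = (\<Sum>i<n. Us m i \<omega> - (1 / real m) *\<^sub>R (Es m i \<omega> *\<^sub>R Zs m i \<omega>))"
  let ?S = "Shat n m \<omega>" and ?q = "sqrt (real n / real m)" and ?k = "sqrt (real n * real m)"
  have k: "?k > 0" "?k * ?k = real n * real m" using n m by auto
  have Shat: "?S = (1 / (real n * real m)) *\<^sub>R Sm" by (simp add: Shat_def Sm_def d_def)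
  then have Sm: "Sm = (real n * real m) *\<^sub>R ?S" using n m by simp
  have yd: "y i t \<omega> - ybar y i m \<omega> = d i t \<bullet> bet + (eps i t \<omega> - Es m i \<omega> / real m)" for i t
  proof -
    have "ybar y i m \<omega> = alpha i + xbar x i m \<omega> \<bullet> bet + Es m i \<omega> / real m"
      using m by (simp add: ybar_def xbar_def model[OF \<omega>] Es_def sum.distrib inner_sum_left add_divide_distrib)
    then show ?thesis by (simp add: d_def model[OF \<omega>] inner_diff_left)
  qed
  have ed: "(\<Sum>t<m. (eps i t \<omega> - Es m i \<omega> / real m) *\<^sub>R d i t) = Us m i \<omega> - (1 / real m) *\<^sub>R (Es m i \<omega> *\<^sub>R Zs m i \<omega>)" for i
  proof -
    have "(\<Sum>t<m. (eps i t \<omega> - Es m i \<omega> / real m) * d i t $ a) = Us m i \<omega> $ a - Es m i \<omega> * Zs m i \<omega> $ a / real m" for a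
      using sum_demeaned_product[OF m, of "\<lambda>t. eps i t \<omega>" "\<lambda>t. z i t \<omega> $ a"]
      unfolding d_def demeaned[OF m] by (simp add: Es_def Zs_def Us_def)
    then show ?thesis by (simp add: vec_eq_iff)
  qed
  have num: "(\<Sum>i<n. \<Sum>t<m. (y i t \<omega> - ybar y i m \<omega>) *\<^sub>R (x i t \<omega> - xbar x i m \<omega>)) = Sm *v bet + N"
    unfolding d_def[symmetric] yd scaleR_add_left sum.distrib ed N_def[symmetric] Sm_def sum_matrix_vector_mult outer_mult ..
  have "invertible Sm" unfolding Sm using inv n m by (intro invertible_scaleR) auto
  then have "Sm *v within_est x y n m \<omega> = Sm *v bet + N"
    unfolding within_est_def num unfolding d_def[symmetric] Sm_def[symmetric] by (rule matrix_inv_cancel(1))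
  then have "(1 / (real n * real m)) *\<^sub>R (Sm *v within_est x y n m \<omega>) = (1 / (real n * real m)) *\<^sub>R (Sm *v bet + N)" by simp
  then have Sw: "?S *v within_est x y n m \<omega> = ?S *v bet + (1 / (real n * real m)) *\<^sub>R N"
    unfolding Shat scaleR_matrix_vector_mult scaleR_add_right .
  have q: "?k / real m = ?q"
    using m by (simp add: real_sqrt_divide real_sqrt_mult field_simps)
  \<comment> \<open>\<open>R\<close> already contains sqrt(n/m) b, which is therefore added
    back.\<close>
  have kN: "(?k / (real n * real m)) *\<^sub>R N = W n m \<omega> - R n m \<omega> + ?q *\<^sub>R bias n m"
  proof -
    have "?k / (real n * real m) = 1 / ?k" using k by (metis divide_divide_eq_right nonzero_mult_div_cancel_right less_irrefl divide_self_if mult.commute times_divide_eq_left)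
    moreover have "N = (\<Sum>i<n. Us m i \<omega>) - (1 / real m) *\<^sub>R (\<Sum>i<n. Es m i \<omega> *\<^sub>R Zs m i \<omega>)"
      by (simp only: N_def sum_subtractf scaleR_sum_right)
    ultimately show ?thesis by (simp add: W_def R_def scaleR_diff_right mult.commute)
  qed
  have "?S *v est_error y bet n m \<omega> = ?k *\<^sub>R (?S *v within_est x y n m \<omega> - ?S *v bet)
     - (?k / real m) *\<^sub>R (?S *v (matrix_inv (\<Sigma> n m) *v bias n m))"
    by (simp add: est_error_def matrix_vector_mult_scaleR matrix_vector_mult_diff_distrib scaleR_diff_right)
  also have "\<dots> = (?k / (real n * real m)) *\<^sub>R N - ?q *\<^sub>R (?S *v (matrix_inv (\<Sigma> n m) *v bias n m))"
    unfolding Sw q by simp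
  finally show ?thesis unfolding kN by (simp add: matrix_vector_mult_scaleR)
qed

abbreviation e1 :: "nat \<Rightarrow> nat \<Rightarrow> 'a \<Rightarrow> real" where "e1 n m \<omega> \<equiv> l1_norm (Shat n m \<omega> - \<Sigma> n m)"
definition w1 :: "nat \<Rightarrow> nat \<Rightarrow> 'a \<Rightarrow> real" where "w1 n m \<omega> = (\<Sum>a\<in>UNIV. \<bar>W n m \<omega> $ a\<bar>)"
definition r1 :: "nat \<Rightarrow> nat \<Rightarrow> 'a \<Rightarrow> real" where "r1 n m \<omega> = (\<Sum>a\<in>UNIV. \<bar>R n m \<omega> $ a\<bar>)"

lemma l1_nonneg: "e1 n m \<omega> \<ge> 0" "w1 n m \<omega> \<ge> 0" "r1 n m \<omega> \<ge> 0"
  by (auto simp: l1_norm_def w1_def r1_def intro!: sum_nonneg)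

definition kk :: real where "kk = real CARD('k)"

lemma r1_bound:
  assumes n: "n \<ge> 1" and m: "m \<ge> 1"
  shows "integrable M (r1 n m)" "expectation (r1 n m) \<le> kk * (1 + K4 1) * \<eta> n m"
proof -
  have m': "(\<lambda>\<omega>. R n m \<omega> $ a) \<in> borel_measurable M" for a by measurable
  note b = expectation_abs_le[OF m' R_second_moment[OF n m] \<eta>_pos[OF n]]
  show "integrable M (r1 n m)" unfolding r1_def[abs_def] using b(1) by (intro Bochner_Integration.integrable_sum)
  have "expectation (r1 n m) = (\<Sum>a\<in>UNIV. expectation (\<lambda>\<omega>. \<bar>R n m \<omega> $ a\<bar>))"
    unfolding r1_def[abs_def] using b(1) by (intro Bochner_Integration.integral_sum)
  also have "\<dots> \<le> (\<Sum>a\<in>(UNIV::'k set). (1 + K4 1) * \<eta> n m)" using b(2) by (intro sum_mono)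
  finally show "expectation (r1 n m) \<le> kk * (1 + K4 1) * \<eta> n m" by (simp add: kk_def)
qed

lemma w1_bound:
  assumes n: "n \<ge> 1" and m: "m \<ge> 1"
  shows "integrable M (w1 n m)" "expectation (w1 n m) \<le> kk * (2 + K4 1)"
proof -
  have m': "(\<lambda>\<omega>. W n m \<omega> $ a) \<in> borel_measurable M" for a by measurable
  have b: "integrable M (\<lambda>\<omega>. \<bar>W n m \<omega> $ a\<bar>)" "expectation (\<lambda>\<omega>. \<bar>W n m \<omega> $ a\<bar>) \<le> 2 + K4 1" for a
    using expectation_abs_le[OF m' W_second_moment(1)[OF n m], of a "1 + K4 1" 1] W_second_moment(2)[OF n m, of a] by auto
  show "integrable M (w1 n m)" unfolding w1_def[abs_def] using b(1) by (intro Bochner_Integration.integrable_sum)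
  have "expectation (w1 n m) = (\<Sum>a\<in>UNIV. expectation (\<lambda>\<omega>. \<bar>W n m \<omega> $ a\<bar>))"
    unfolding w1_def[abs_def] using b(1) by (intro Bochner_Integration.integral_sum)
  also have "\<dots> \<le> (\<Sum>a\<in>(UNIV::'k set). 2 + K4 1)" using b(2) by (intro sum_mono)
  finally show "expectation (w1 n m) \<le> kk * (2 + K4 1)" by (simp add: kk_def)
qed

text \<open>The entrywise norm is convenient here: its expectation splits into mean absolute errors
  of single entries.\<close>

lemma e1_bound:
  assumes n: "n \<ge> 1" and m: "m \<ge> 1"
  shows "integrable M (e1 n m)" "expectation (e1 n m) \<le> kk * kk * (1 + Ke) * \<eta> n m"
proof -
  note b = expectation_abs_le[OF Shat_error(3)[OF n m] Shat_error(1,2)[OF n m] \<eta>_pos[OF n]]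
  show "integrable M (e1 n m)" unfolding l1_norm_def using b(1) by (intro Bochner_Integration.integrable_sum)
  have "expectation (e1 n m) = (\<Sum>a\<in>UNIV. \<Sum>b\<in>UNIV. expectation (\<lambda>\<omega>. \<bar>(Shat n m \<omega> - \<Sigma> n m) $ a $ b\<bar>))"
    unfolding l1_norm_def using b(1) by (simp add: Bochner_Integration.integral_sum del: vector_minus_component)
  also have "\<dots> \<le> (\<Sum>a\<in>(UNIV::'k set). \<Sum>b\<in>(UNIV::'k set). (1 + Ke) * \<eta> n m)" using b(2) by (intro sum_mono)
  finally show "expectation (e1 n m) \<le> kk * kk * (1 + Ke) * \<eta> n m" by (simp add: kk_def)
qed

text \<open>The product is estimated as a whole from two second moments, one of order \<eta>^2 and
  one bounded; no higher moments of either factor are called for.\<close>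

lemma e1w1_bound:
  assumes n: "n \<ge> 1" and m: "m \<ge> 1"
  shows "integrable M (\<lambda>\<omega>. e1 n m \<omega> * w1 n m \<omega>)"
    "expectation (\<lambda>\<omega>. e1 n m \<omega> * w1 n m \<omega>) \<le> kk * kk * kk * (Ke + (1 + K4 1)) * \<eta> n m"
proof -
  have m': "(\<lambda>\<omega>. W n m \<omega> $ a) \<in> borel_measurable M" for a by measurable
  let ?f = "\<lambda>a b c \<omega>. \<bar>(Shat n m \<omega> - \<Sigma> n m) $ a $ b\<bar> * \<bar>W n m \<omega> $ c\<bar>"
  have b: "integrable M (?f a b c)" "expectation (?f a b c) \<le> (Ke + (1 + K4 1)) * \<eta> n m" for a b c
    by (rule expectation_abs_mult_le[OF Shat_error(3)[OF n m] m' Shat_error(1,2)[OF n m] \<eta>_pos[OF n] W_second_moment[OF n m]])+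
  have e: "e1 n m \<omega> * w1 n m \<omega> = (\<Sum>a\<in>UNIV. \<Sum>b\<in>UNIV. \<Sum>c\<in>UNIV. ?f a b c \<omega>)" for \<omega>
    unfolding l1_norm_def w1_def by (simp only: sum_distrib_right) (simp only: sum_distrib_left)
  show "integrable M (\<lambda>\<omega>. e1 n m \<omega> * w1 n m \<omega>)" unfolding e using b(1) by (intro Bochner_Integration.integrable_sum)
  have "expectation (\<lambda>\<omega>. e1 n m \<omega> * w1 n m \<omega>) = (\<Sum>a\<in>UNIV. \<Sum>b\<in>UNIV. \<Sum>c\<in>UNIV. expectation (?f a b c))"
    unfolding e using b(1) by (simp add: Bochner_Integration.integral_sum del: vector_minus_component)
  also have "\<dots> \<le> (\<Sum>a\<in>(UNIV::'k set). \<Sum>b\<in>(UNIV::'k set). \<Sum>c\<in>(UNIV::'k set). (Ke + (1 + K4 1)) * \<eta> n m)"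
    using b(2) by (intro sum_mono)
  finally show "expectation (\<lambda>\<omega>. e1 n m \<omega> * w1 n m \<omega>) \<le> kk * kk * kk * (Ke + (1 + K4 1)) * \<eta> n m" by (simp add: kk_def)
qed

lemma Ke_nonneg: "Ke \<ge> 0" using B1 K4_nonneg by (simp add: Ke_def)

lemma norm_bias_le: "n \<ge> 1 \<Longrightarrow> m \<ge> 1 \<Longrightarrow> norm (bias n m) \<le> kk * (1 + K4 1)"
  using norm_le_l1_cart[of "bias n m"] sum_mono[of UNIV "\<lambda>a. \<bar>bias n m $ a\<bar>" "\<lambda>_. 1 + K4 1"] bNM_bound[of n m]
  by (simp add: kk_def)

end

section \<open>Expansion, tightness and limit law of the estimation error\<close>

locale panel_posdef = panel M x eps p s B C
  for M :: "'a measure" and x :: "nat \<Rightarrow> nat \<Rightarrow> 'a \<Rightarrow> real^'k" and eps p s B C +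
  fixes lam :: real and y :: "nat \<Rightarrow> nat \<Rightarrow> 'a \<Rightarrow> real" and alpha :: "nat \<Rightarrow> real" and bet :: "real^'k"
  assumes lam: "lam > 0"
    and Sigma_pd: "\<And>n m v. n \<ge> 1 \<Longrightarrow> m \<ge> 1 \<Longrightarrow> v \<bullet> (SigmaNM M x n m *v v) \<ge> lam * (norm v)\<^sup>2"
    and Omega_pd: "\<And>n m v. n \<ge> 1 \<Longrightarrow> m \<ge> 1 \<Longrightarrow> v \<bullet> (OmegaNM M x eps n m *v v) \<ge> lam * (norm v)\<^sup>2"
    and model: "\<And>i t \<omega>. \<omega> \<in> space M \<Longrightarrow> y i t \<omega> = alpha i + x i t \<omega> \<bullet> bet + eps i t \<omega>"
begin

abbreviation T :: "nat \<Rightarrow> nat \<Rightarrow> 'a \<Rightarrow> real^'k" where "T \<equiv> est_error y bet"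

lemma T_measurable [measurable]: "T n m \<in> borel_measurable M"
  using model by (rule est_error_measurable)

lemma Sigma_invertible: "n \<ge> 1 \<Longrightarrow> m \<ge> 1 \<Longrightarrow> invertible (\<Sigma> n m)"
  using coercive_norm_le(1)[OF lam Sigma_pd] by blast

lemma Sigma_inv_norm:
  assumes "n \<ge> 1" "m \<ge> 1"
  shows "norm (matrix_inv (\<Sigma> n m) *v v) \<le> norm v / lam"
  using coercive_norm_le(2)[OF lam Sigma_pd[OF assms], of "matrix_inv (\<Sigma> n m) *v v"]
  by (simp add: matrix_inv_cancel(1)[OF Sigma_invertible[OF assms]])

lemma Sigma_inv_inner:
  assumes "n \<ge> 1" "m \<ge> 1"
  shows "u \<bullet> (matrix_inv (\<Sigma> n m) *v w) = (matrix_inv (\<Sigma> n m) *v u) \<bullet> w"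
  using symmetric_inner[OF transpose_matrix_inv[OF Sigma_invertible[OF assms] Sigma_sym], of u w]
  by (simp add: inner_commute)

text \<open>The right-hand side of \<open>perturbed_solution_bound\<close> with norms replaced by
  sums of absolute entries, and with the bound on \<open>bias\<close> inserted; this form has a
  computable expectation.\<close>

definition Dbd :: "nat \<Rightarrow> nat \<Rightarrow> 'a \<Rightarrow> real" where
  "Dbd n m \<omega> = 2 / lam * (r1 n m \<omega> + (e1 n m \<omega> * w1 n m \<omega>
     + sqrt (real n / real m) * (kk * (1 + K4 1)) * e1 n m \<omega>) / lam)"

lemma kk_nonneg: "kk \<ge> 0" by (simp add: kk_def)

lemma Dbd_nonneg: "Dbd n m \<omega> \<ge> 0"
  unfolding Dbd_def using lam l1_nonneg K4_nonneg kk_nonneg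
  by (intro mult_nonneg_nonneg add_nonneg_nonneg divide_nonneg_nonneg) auto

text \<open>On the event that the sample matrix is within lam/2 of \<Sigma> it is still coercive, so
  the estimator truly solves its equations. Off this event \<open>matrix_inv\<close> may be
  arbitrary and only the probability is used.\<close>

lemma T_expansion:
  assumes n: "n \<ge> 1" and m: "m \<ge> 1" and \<omega>: "\<omega> \<in> space M" and e: "e1 n m \<omega> \<le> lam / 2"
  shows "norm (T n m \<omega> - matrix_inv (\<Sigma> n m) *v W n m \<omega>) \<le> Dbd n m \<omega>"
proof -
  let ?g = "sqrt (real n / real m) *\<^sub>R bias n m"
  have inv: "invertible (Shat n m \<omega>)"
  proof (rule coercive_norm_le(1))
    show "lam / 2 > 0" using lam by simp
    show "v \<bullet> (Shat n m \<omega> *v v) \<ge> lam / 2 * (norm v)\<^sup>2" for v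
      by (rule perturbed_coercive[OF lam Sigma_pd[OF n m] e])
  qed
  have "norm (T n m \<omega> - matrix_inv (\<Sigma> n m) *v W n m \<omega>)
     \<le> 2 / lam * (norm (R n m \<omega>) + e1 n m \<omega> * (norm (W n m \<omega>) + norm ?g) / lam)"
    by (rule perturbed_solution_bound[OF lam Sigma_pd[OF n m] e normal_equations[OF n m \<omega> inv model]])
  also have "\<dots> \<le> 2 / lam * (r1 n m \<omega> + e1 n m \<omega> * (w1 n m \<omega> + sqrt (real n / real m) * (kk * (1 + K4 1))) / lam)"
  proof -
    have "norm (R n m \<omega>) \<le> r1 n m \<omega>" "norm (W n m \<omega>) \<le> w1 n m \<omega>"
      unfolding r1_def w1_def by (rule norm_le_l1_cart)+
    moreover have "norm ?g \<le> sqrt (real n / real m) * (kk * (1 + K4 1))"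
      using norm_bias_le[OF n m] by (simp add: mult_left_mono)
    ultimately show ?thesis
      using lam l1_nonneg by (intro mult_left_mono add_mono divide_right_mono) auto
  qed
  also have "\<dots> = Dbd n m \<omega>" by (simp add: Dbd_def algebra_simps)
  finally show ?thesis .
qed

text \<open>\<open>c1\<close> is the Markov constant for the event that the sample matrix is far
  from \<Sigma>; \<open>c2\<close> collects the constants of \<open>r1_bound\<close>,
  \<open>e1w1_bound\<close> and \<open>e1_bound\<close> in the mean of \<open>Dbd\<close>.\<close>

definition c1 :: real where "c1 = 2 / lam * (kk * kk * (1 + Ke))"
definition c2 :: real where
  "c2 = 2 / lam * (kk * (1 + K4 1) + (kk * kk * kk * (Ke + (1 + K4 1)) + kk * (1 + K4 1) * (kk * kk * (1 + Ke))) / lam)"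

lemma bad_prob:
  assumes n: "n \<ge> 1" and m: "m \<ge> 1"
  shows "measure M {\<omega>\<in>space M. e1 n m \<omega> > lam / 2} \<le> c1 * \<eta> n m"
proof -
  have "measure M {\<omega>\<in>space M. e1 n m \<omega> > lam / 2} \<le> expectation (e1 n m) / (lam / 2)"
    by (rule markov_le[OF e1_bound(1)[OF n m] l1_nonneg(1)]) (use lam in auto)
  also have "\<dots> \<le> (kk * kk * (1 + Ke) * \<eta> n m) / (lam / 2)"
    using lam e1_bound(2)[OF n m] by (intro divide_right_mono) auto
  also have "\<dots> = c1 * \<eta> n m" by (simp add: c1_def)
  finally show ?thesis .
qed

lemma Dbd_bound:
  assumes n: "n \<ge> 1" and m: "m \<ge> 1"
  shows "integrable M (Dbd n m)" "expectation (Dbd n m) \<le> c2 * (1 + sqrt (real n / real m)) * \<eta> n m"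
proof -
  let ?q = "sqrt (real n / real m)"
  note i = r1_bound(1)[OF n m] e1w1_bound(1)[OF n m] e1_bound(1)[OF n m]
  show "integrable M (Dbd n m)" unfolding Dbd_def[abs_def] using i by simp
  let ?a = "kk * (1 + K4 1)" and ?b = "kk * kk * kk * (Ke + (1 + K4 1))" and ?d = "kk * kk * (1 + Ke)"
  have nn: "?a \<ge> 0" "?b \<ge> 0" "?d \<ge> 0" using kk_nonneg K4_nonneg Ke_nonneg by simp_all
  have \<eta>: "\<eta> n m \<ge> 0" using \<eta>_pos[OF n] by (simp add: less_imp_le)
  have "expectation (Dbd n m) = 2 / lam * (expectation (r1 n m) + (expectation (\<lambda>\<omega>. e1 n m \<omega> * w1 n m \<omega>)
     + ?q * ?a * expectation (e1 n m)) / lam)"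
    unfolding Dbd_def[abs_def] using i by simp
  also have "\<dots> \<le> 2 / lam * (?a * \<eta> n m + (?b * \<eta> n m + ?q * ?a * (?d * \<eta> n m)) / lam)"
    using lam nn r1_bound(2)[OF n m] e1w1_bound(2)[OF n m] e1_bound(2)[OF n m]
    by (intro mult_left_mono add_mono divide_right_mono) auto
  \<comment> \<open>Every term is enlarged by the common factor 1 + sqrt(n/m), so that a single
    constant can be pulled out.\<close>
  also have "\<dots> \<le> 2 / lam * (?a * \<eta> n m * (1 + ?q) + (?b * \<eta> n m * (1 + ?q) + ?a * ?d * \<eta> n m * (1 + ?q)) / lam)"
  proof -
    have "u \<le> u * (1 + ?q)" if "u \<ge> 0" for u using that by (simp add: distrib_left)
    moreover have "?q * ?a * (?d * \<eta> n m) \<le> ?a * ?d * \<eta> n m * (1 + ?q)"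
    proof -
      have "?q * ?a * (?d * \<eta> n m) = ?a * ?d * \<eta> n m * ?q" by simp
      also have "\<dots> \<le> ?a * ?d * \<eta> n m * (1 + ?q)" using nn \<eta> by (intro mult_left_mono) auto
      finally show ?thesis .
    qed
    ultimately show ?thesis using lam nn \<eta>
      by (intro mult_left_mono add_mono divide_right_mono) auto
  qed
  also have "\<dots> = c2 * (1 + ?q) * \<eta> n m" unfolding c2_def by (simp add: algebra_simps add_divide_distrib)
  finally show "expectation (Dbd n m) \<le> c2 * (1 + sqrt (real n / real m)) * \<eta> n m" .
qed

lemma e1_measurable: "n \<ge> 1 \<Longrightarrow> m \<ge> 1 \<Longrightarrow> e1 n m \<in> borel_measurable M"
  using e1_bound(1) by auto

text \<open>Cosine is 1-Lipschitz with values in [-1, 1]: the bad event costs twice its probability,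
  the good one costs \<open>norm u\<close> times the mean of \<open>Dbd\<close>. What remains is the
  score in direction v = \<Sigma>^(-1) u, with v . \<Omega> v = u . \<Upsilon> u.\<close>

lemma T_cos_bound:
  assumes n: "n \<ge> 1" and m: "m \<ge> 1"
  shows "\<bar>expectation (\<lambda>\<omega>. cos (u \<bullet> T n m \<omega> + b)) - cos b * exp (- (u \<bullet> (UpsilonNM M x eps n m *v u)) / 2)\<bar>
    \<le> (2 * c1 + norm u * c2 * (1 + sqrt (real n / real m))) * \<eta> n m + (1 + K4 (norm u / lam))\<^sup>2 / sqrt (real n)"
proof -
  define v where "v = matrix_inv (\<Sigma> n m) *v u"
  have ups: "v \<bullet> (\<Omega> n m *v v) = u \<bullet> (UpsilonNM M x eps n m *v u)"
    unfolding UpsilonNM_def matrix_vector_mul_assoc[symmetric] Sigma_inv_inner[OF n m] v_def ..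
  let ?A = "{\<omega>\<in>space M. e1 n m \<omega> > lam / 2}"
  have em [measurable]: "e1 n m \<in> borel_measurable M" by (rule e1_measurable[OF n m])
  have A [measurable]: "?A \<in> sets M" by measurable
  have i: "integrable M (\<lambda>\<omega>. cos (u \<bullet> T n m \<omega> + b))" "integrable M (\<lambda>\<omega>. cos (v \<bullet> W n m \<omega> + b))"
    by (auto intro!: integrable_const_bound[where B=1])
  have "\<bar>expectation (\<lambda>\<omega>. cos (u \<bullet> T n m \<omega> + b)) - expectation (\<lambda>\<omega>. cos (v \<bullet> W n m \<omega> + b))\<bar>
    = \<bar>expectation (\<lambda>\<omega>. cos (u \<bullet> T n m \<omega> + b) - cos (v \<bullet> W n m \<omega> + b))\<bar>" using i by simp
  also have "\<dots> \<le> expectation (\<lambda>\<omega>. 2 * indicator ?A \<omega> + norm u * Dbd n m \<omega>)"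
  proof (rule order_trans[OF integral_abs_bound integral_mono])
    fix \<omega> assume \<omega>: "\<omega> \<in> space M"
    show "\<bar>cos (u \<bullet> T n m \<omega> + b) - cos (v \<bullet> W n m \<omega> + b)\<bar> \<le> 2 * indicator ?A \<omega> + norm u * Dbd n m \<omega>"
    proof (cases "\<omega> \<in> ?A")
      case True
      have "\<bar>cos (u \<bullet> T n m \<omega> + b) - cos (v \<bullet> W n m \<omega> + b)\<bar> \<le> 2"
        using abs_cos_le_one[of "u \<bullet> T n m \<omega> + b"] abs_cos_le_one[of "v \<bullet> W n m \<omega> + b"] by linarith
      moreover have "0 \<le> norm u * Dbd n m \<omega>" using Dbd_nonneg by simp
      ultimately show ?thesis using True by simp
    next
      case False
      then have e: "e1 n m \<omega> \<le> lam / 2" using \<omega> by auto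
      have "\<bar>cos (u \<bullet> T n m \<omega> + b) - cos (v \<bullet> W n m \<omega> + b)\<bar> \<le> \<bar>u \<bullet> T n m \<omega> - v \<bullet> W n m \<omega>\<bar>"
        using abs_cos_diff_le[of "u \<bullet> T n m \<omega> + b" "v \<bullet> W n m \<omega> + b"] by simp
      also have "u \<bullet> T n m \<omega> - v \<bullet> W n m \<omega> = u \<bullet> (T n m \<omega> - matrix_inv (\<Sigma> n m) *v W n m \<omega>)"
        by (simp add: v_def inner_diff_right Sigma_inv_inner[OF n m])
      also have "\<bar>\<dots>\<bar> \<le> norm u * Dbd n m \<omega>"
        using T_expansion[OF n m \<omega> e] by (intro order_trans[OF Cauchy_Schwarz_ineq2] mult_left_mono) auto
      finally show ?thesis using False by simp
    qed
  qed (use i Dbd_bound(1)[OF n m] in \<open>auto simp: emeasure_eq_measure\<close>)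
  also have "\<dots> = 2 * measure M ?A + norm u * expectation (Dbd n m)"
    using Dbd_bound(1)[OF n m] A by (simp add: emeasure_eq_measure)
  also have "\<dots> \<le> 2 * (c1 * \<eta> n m) + norm u * (c2 * (1 + sqrt (real n / real m)) * \<eta> n m)"
    using bad_prob[OF n m] Dbd_bound(2)[OF n m] by (intro add_mono mult_left_mono) auto
  also have "\<dots> = (2 * c1 + norm u * c2 * (1 + sqrt (real n / real m))) * \<eta> n m" by (simp add: algebra_simps)
  finally have 1: "\<bar>expectation (\<lambda>\<omega>. cos (u \<bullet> T n m \<omega> + b)) - expectation (\<lambda>\<omega>. cos (v \<bullet> W n m \<omega> + b))\<bar>
     \<le> (2 * c1 + norm u * c2 * (1 + sqrt (real n / real m))) * \<eta> n m" .
  have "norm v \<le> norm u / lam" unfolding v_def by (rule Sigma_inv_norm[OF n m])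
  from W_char_bound[OF n m this, of b] 1 show ?thesis unfolding ups by linarith
qed

text \<open>Source of tightness: as \<eta> tends to 0 only the contribution of the score survives,
  and it is of order 1/L.\<close>

lemma T_tail:
  assumes n: "n \<ge> 1" and m: "m \<ge> 1" and L: "L > 0"
  shows "measure M {\<omega>\<in>space M. norm (T n m \<omega>) > L}
    \<le> c1 * \<eta> n m + (c2 * (1 + sqrt (real n / real m)) * \<eta> n m + kk * (2 + K4 1) / lam) / L"
proof -
  let ?A = "{\<omega>\<in>space M. e1 n m \<omega> > lam / 2}" and ?X = "\<lambda>\<omega>. Dbd n m \<omega> + w1 n m \<omega> / lam"
  have [measurable]: "e1 n m \<in> borel_measurable M" "Dbd n m \<in> borel_measurable M" "w1 n m \<in> borel_measurable M"
    using e1_measurable[OF n m] Dbd_bound(1)[OF n m] w1_bound(1)[OF n m] by auto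
  have i: "integrable M ?X" using Dbd_bound(1)[OF n m] w1_bound(1)[OF n m] by simp
  have sub: "{\<omega>\<in>space M. norm (T n m \<omega>) > L} \<subseteq> ?A \<union> {\<omega>\<in>space M. ?X \<omega> > L}"
  proof
    fix \<omega> assume \<omega>: "\<omega> \<in> {\<omega>\<in>space M. norm (T n m \<omega>) > L}"
    show "\<omega> \<in> ?A \<union> {\<omega>\<in>space M. ?X \<omega> > L}"
    proof (cases "\<omega> \<in> ?A")
      case False
      then have "norm (T n m \<omega> - matrix_inv (\<Sigma> n m) *v W n m \<omega>) \<le> Dbd n m \<omega>"
        using \<omega> by (intro T_expansion[OF n m]) auto
      moreover have "norm (matrix_inv (\<Sigma> n m) *v W n m \<omega>) \<le> w1 n m \<omega> / lam"
      proof -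
        have "norm (W n m \<omega>) \<le> w1 n m \<omega>" unfolding w1_def by (rule norm_le_l1_cart)
        then have "norm (W n m \<omega>) / lam \<le> w1 n m \<omega> / lam" using lam by (intro divide_right_mono) auto
        then show ?thesis using Sigma_inv_norm[OF n m, of "W n m \<omega>"] by linarith
      qed
      moreover have "norm (T n m \<omega>) \<le> norm (T n m \<omega> - matrix_inv (\<Sigma> n m) *v W n m \<omega>) + norm (matrix_inv (\<Sigma> n m) *v W n m \<omega>)"
        using norm_triangle_ineq[of "T n m \<omega> - matrix_inv (\<Sigma> n m) *v W n m \<omega>" "matrix_inv (\<Sigma> n m) *v W n m \<omega>"] by simp
      ultimately show ?thesis using \<omega> by auto
    qed simp
  qed
  have "measure M {\<omega>\<in>space M. norm (T n m \<omega>) > L} \<le> measure M (?A \<union> {\<omega>\<in>space M. ?X \<omega> > L})"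
    by (intro finite_measure_mono sub) measurable
  also have "\<dots> \<le> measure M ?A + measure M {\<omega>\<in>space M. ?X \<omega> > L}"
    by (intro measure_Un_le) measurable
  also have "measure M {\<omega>\<in>space M. ?X \<omega> > L} \<le> expectation ?X / L"
    using lam Dbd_nonneg l1_nonneg by (intro markov_le i L) (simp add: add_nonneg_nonneg)
  also have "expectation ?X = expectation (Dbd n m) + expectation (w1 n m) / lam"
    using Dbd_bound(1)[OF n m] w1_bound(1)[OF n m] by simp
  also have "(\<dots>) / L \<le> (c2 * (1 + sqrt (real n / real m)) * \<eta> n m + kk * (2 + K4 1) / lam) / L"
    using Dbd_bound(2)[OF n m] w1_bound(2)[OF n m] lam L by (intro divide_right_mono add_mono) auto
  finally show ?thesis using bad_prob[OF n m] by linarith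
qed

lemma Upsilon_sym: "n \<ge> 1 \<Longrightarrow> m \<ge> 1 \<Longrightarrow> transpose (UpsilonNM M x eps n m) = UpsilonNM M x eps n m"
  unfolding UpsilonNM_def
  by (simp add: matrix_transpose_mul transpose_matrix_inv Sigma_invertible Sigma_sym Omega_sym matrix_mul_assoc)

text \<open>The denominator is the square of a bound for the entrywise norm of \<Sigma>.\<close>

definition c3 :: real where "c3 = lam / (kk * kk * (2 + B1))\<^sup>2"

lemma c3_pos: "c3 > 0"
  unfolding c3_def kk_def using lam B1 by (intro divide_pos_pos zero_less_power mult_pos_pos) auto

text \<open>Writing u = \<Sigma> v gives |u| <= K |v|, and \<Omega> is coercive at v. The constant
  is the same for all n and m, so positive definiteness survives in the limit and the limiting
  normal law has a density.\<close>

lemma Upsilon_pd: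
  assumes n: "n \<ge> 1" and m: "m \<ge> 1"
  shows "u \<bullet> (UpsilonNM M x eps n m *v u) \<ge> c3 * (norm u)\<^sup>2"
proof -
  define v where "v = matrix_inv (\<Sigma> n m) *v u"
  define K where "K = kk * kk * (2 + B1)"
  have K: "K > 0" unfolding K_def kk_def using B1 by (intro mult_pos_pos) auto
  have ups: "u \<bullet> (UpsilonNM M x eps n m *v u) = v \<bullet> (\<Omega> n m *v v)"
    unfolding UpsilonNM_def matrix_vector_mul_assoc[symmetric] Sigma_inv_inner[OF n m] v_def ..
  have "l1_norm (\<Sigma> n m) \<le> (\<Sum>a\<in>(UNIV::'k set). \<Sum>b\<in>(UNIV::'k set). 2 + B1)"
    unfolding l1_norm_def by (intro sum_mono Sigma_nth_le n m)
  then have l: "l1_norm (\<Sigma> n m) \<le> K" by (simp add: kk_def K_def)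
  have "u = \<Sigma> n m *v v" unfolding v_def by (rule matrix_inv_cancel(1)[OF Sigma_invertible[OF n m], symmetric])
  then have "norm u \<le> l1_norm (\<Sigma> n m) * norm v" using norm_matrix_vector_le[of "\<Sigma> n m" v] by simp
  also have "\<dots> \<le> K * norm v" using l by (intro mult_right_mono) auto
  finally have "(norm u)\<^sup>2 \<le> (K * norm v)\<^sup>2" by (intro power_mono) auto
  then have "(norm u)\<^sup>2 / K\<^sup>2 \<le> (norm v)\<^sup>2" using K by (simp add: power_mult_distrib pos_divide_le_eq mult.commute)
  then have "lam * ((norm u)\<^sup>2 / K\<^sup>2) \<le> lam * (norm v)\<^sup>2" using lam by (intro mult_left_mono) auto
  also have "\<dots> \<le> v \<bullet> (\<Omega> n m *v v)" by (rule Omega_pd[OF n m])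
  finally show ?thesis unfolding ups c3_def K_def[symmetric] by simp
qed

lemma est_error_conv:
  assumes lim: "((\<lambda>(n, m). UpsilonNM M x eps n m) \<longlongrightarrow> Ups) (panel_limit c)"
  shows "conv_in_distr (panel_limit c) M (\<lambda>(n, m). T n m) (mvnormal Ups)"
proof (cases "panel_limit c = bot")
  \<comment> \<open>Along the trivial filter every convergence holds; uniqueness of limits, used
    below, requires the other case.\<close>
  case True
  then show ?thesis by (simp add: conv_in_distr_def)
next
  case nb: False
  let ?F = "panel_limit c"
  let ?q = "\<lambda>k. sqrt (real (fst k) / real (snd k))" and ?n = "\<lambda>k. \<eta> (fst k) (snd k)"
  let ?U = "\<lambda>k. UpsilonNM M x eps (fst k) (snd k)"
  have ge1: "\<forall>\<^sub>F k in ?F. fst k \<ge> 1 \<and> snd k \<ge> 1"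
    using panel_limit_tendsto(1,2)[of c] by (simp add: filterlim_at_top eventually_conj)
  have limU: "(?U \<longlongrightarrow> Ups) ?F" using lim by (simp add: case_prod_unfold)
  have qlim: "(?q \<longlongrightarrow> sqrt c) ?F"
    using panel_limit_tendsto(3)[of c] by (intro tendsto_real_sqrt) (simp add: case_prod_unfold)
  have f0: "((\<lambda>k. 1 / real (fst k)) \<longlongrightarrow> 0) ?F" "((\<lambda>k. 1 / real (snd k)) \<longlongrightarrow> 0) ?F"
    using filterlim_compose[OF lim_1_over_n panel_limit_tendsto(1)[of c]]
      filterlim_compose[OF lim_1_over_n panel_limit_tendsto(2)[of c]] by simp_all
  have nlim: "(?n \<longlongrightarrow> 0) ?F"
    using tendsto_real_sqrt[OF tendsto_add[OF f0]] by (simp add: \<eta>_def)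
  have slim: "((\<lambda>k. 1 / sqrt (real (fst k))) \<longlongrightarrow> 0) ?F"
    using tendsto_real_sqrt[OF f0(1)] by (simp add: real_sqrt_divide)
  have quad: "((\<lambda>k. u \<bullet> (?U k *v u)) \<longlongrightarrow> u \<bullet> (Ups *v u)) ?F" for u
    by (rule bounded_linear.tendsto[OF bounded_linear_quadratic_form limU])
  \<comment> \<open>Symmetry and positivity of \<open>Ups\<close> are not assumed; they are
    inherited from the matrices converging to it.\<close>
  have sym: "transpose Ups = Ups"
  proof -
    have "Ups $ b $ a = Ups $ a $ b" for a b
    proof (rule tendsto_unique[OF nb])
      show "((\<lambda>k. ?U k $ b $ a) \<longlongrightarrow> Ups $ b $ a) ?F" by (intro tendsto_vec_nth limU)
      have ev: "\<forall>\<^sub>F k in ?F. ?U k $ a $ b = ?U k $ b $ a"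
        using ge1
      proof eventually_elim
        case (elim k)
        then have "transpose (?U k) $ b $ a = ?U k $ b $ a" by (simp add: Upsilon_sym)
        then show ?case by (simp add: transpose_def)
      qed
      have "((\<lambda>k. ?U k $ a $ b) \<longlongrightarrow> Ups $ a $ b) ?F" by (intro tendsto_vec_nth limU)
      then show "((\<lambda>k. ?U k $ b $ a) \<longlongrightarrow> Ups $ a $ b) ?F" by (rule Lim_transform_eventually[OF _ ev])
    qed
    then show ?thesis by (simp add: vec_eq_iff transpose_def)
  qed
  have pos: "u \<bullet> (Ups *v u) > 0" if "u \<noteq> 0" for u
  proof -
    have "\<forall>\<^sub>F k in ?F. c3 * (norm u)\<^sup>2 \<le> u \<bullet> (?U k *v u)"
      using ge1 by eventually_elim (simp add: Upsilon_pd)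
    then have "c3 * (norm u)\<^sup>2 \<le> u \<bullet> (Ups *v u)" by (rule tendsto_lowerbound[OF quad _ nb])
    moreover have "0 < c3 * (norm u)\<^sup>2" using that c3_pos by simp
    ultimately show ?thesis by linarith
  qed
  have Tk: "(\<lambda>(n, m). T n m) k = T (fst k) (snd k)" for k by (simp add: case_prod_unfold)
  show ?thesis
  proof (rule conv_in_distr_charI)
    show "prob_space M" by (rule prob_space_axioms)
    show "prob_space (mvnormal Ups)" using sym pos by (rule prob_space_mvnormal)
    show "sets (mvnormal Ups) = sets borel" by (simp add: mvnormal_def)
    show "(\<lambda>(n, m). T n m) k \<in> borel_measurable M" for k unfolding Tk by measurable
  next
    fix u b
    let ?E = "\<lambda>k. expectation (\<lambda>\<omega>. cos (u \<bullet> T (fst k) (snd k) \<omega> + b))"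
    let ?G = "\<lambda>k. cos b * exp (- (u \<bullet> (?U k *v u)) / 2)"
    have Glim: "(?G \<longlongrightarrow> cos b * exp (- (u \<bullet> (Ups *v u)) / 2)) ?F"
      by (intro tendsto_intros quad) simp
    have mc: "(\<integral>x. cos (u \<bullet> x + b) \<partial>mvnormal Ups) = cos b * exp (- (u \<bullet> (Ups *v u)) / 2)"
      using sym pos by (rule mvnormal_cos)
    let ?Z = "\<lambda>k. (2 * c1 + norm u * c2 * (1 + ?q k)) * ?n k + (1 + K4 (norm u / lam))\<^sup>2 * (1 / sqrt (real (fst k)))"
    have "(?Z \<longlongrightarrow> (2 * c1 + norm u * c2 * (1 + sqrt c)) * 0 + (1 + K4 (norm u / lam))\<^sup>2 * 0) ?F"
      by (intro tendsto_intros qlim nlim slim)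
    then have Z: "(?Z \<longlongrightarrow> 0) ?F" by simp
    have "((\<lambda>k. ?E k - ?G k) \<longlongrightarrow> 0) ?F"
    proof (rule Lim_null_comparison[OF _ Z])
      show "\<forall>\<^sub>F k in ?F. norm (?E k - ?G k) \<le> ?Z k"
        using ge1
      proof eventually_elim
        case (elim k)
        then show ?case using T_cos_bound[of "fst k" "snd k" u b] by simp
      qed
    qed
    from tendsto_add[OF this Glim] have "(?E \<longlongrightarrow> cos b * exp (- (u \<bullet> (Ups *v u)) / 2)) ?F" by simp
    then show "((\<lambda>k. expectation (\<lambda>\<omega>. cos (u \<bullet> (\<lambda>(n, m). T n m) k \<omega> + b))) \<longlongrightarrow> (\<integral>x. cos (u \<bullet> x + b) \<partial>mvnormal Ups)) ?F"
      unfolding Tk mc .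
  next
    fix e :: real assume e: "e > 0"
    let ?H = "\<lambda>L k. c1 * ?n k + (c2 * (1 + ?q k) * ?n k + kk * (2 + K4 1) / lam) / L"
    \<comment> \<open>With w = kk (2 + K4 1) / lam, the tail bound tends to w/L. The choice gives e
      L = 2 (w + 1) > w, hence w/L < e, also when w = 0.\<close>
    define L where "L = 2 * (kk * (2 + K4 1) / lam + 1) / e"
    have L: "L > 0" unfolding L_def using e lam kk_nonneg K4_nonneg[of 1]
      by (intro divide_pos_pos mult_pos_pos add_nonneg_pos divide_nonneg_nonneg mult_nonneg_nonneg) auto
    have "(?H L \<longlongrightarrow> c1 * 0 + (c2 * (1 + sqrt c) * 0 + kk * (2 + K4 1) / lam) / L) ?F"
      using L by (intro tendsto_intros qlim nlim) auto
    moreover have "c1 * 0 + (c2 * (1 + sqrt c) * 0 + kk * (2 + K4 1) / lam) / L < e"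
    proof -
      let ?w = "kk * (2 + K4 1) / lam"
      have w: "?w \<ge> 0" using lam kk_nonneg K4_nonneg[of 1] by simp
      have "?w < e * L" using e w by (simp add: L_def)
      then have "?w / L < e" by (simp only: pos_divide_less_eq[OF L])
      then show ?thesis by (simp only: mult_zero_right add_0_left)
    qed
    ultimately have "\<forall>\<^sub>F k in ?F. ?H L k < e" by (rule order_tendstoD(2))
    with ge1 have "\<forall>\<^sub>F k in ?F. measure M {\<omega>\<in>space M. norm ((\<lambda>(n, m). T n m) k \<omega>) > L} \<le> e"
      unfolding Tk
    proof eventually_elim
      case (elim k)
      then show ?case using T_tail[of "fst k" "snd k" L] L by simp
    qed
    then show "\<exists>L. \<forall>\<^sub>F k in ?F. measure M {\<omega>\<in>space M. norm ((\<lambda>(n, m). T n m) k \<omega>) > L} \<le> e" by blast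
  qed
qed

end

text \<open>\<open>ennreal\<close> maps a negative real to 0, so the real bound recovered is
  \<open>max 0 B\<close>.\<close>

lemma nn_integral_le_imp_integrable:
  fixes f :: "'a \<Rightarrow> real"
  assumes [measurable]: "f \<in> borel_measurable M" and nn: "\<And>\<omega>. f \<omega> \<ge> 0"
    and le: "(\<integral>\<^sup>+\<omega>. ennreal (f \<omega>) \<partial>M) \<le> ennreal B"
  shows "integrable M f" and "(\<integral>\<omega>. f \<omega> \<partial>M) \<le> max 0 B"
proof -
  show i: "integrable M f"
    by (rule integrableI_nonneg) (use nn le in \<open>auto intro: le_less_trans\<close>)
  have "ennreal (\<integral>\<omega>. f \<omega> \<partial>M) = (\<integral>\<^sup>+\<omega>. ennreal (f \<omega>) \<partial>M)"
    by (rule nn_integral_eq_integral[symmetric]) (use i nn in auto)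
  also have "\<dots> \<le> ennreal (max 0 B)" using le by (rule order_trans) (auto intro: ennreal_leI)
  finally show "(\<integral>\<omega>. f \<omega> \<partial>M) \<le> max 0 B" by (simp only: ennreal_le_iff max.cobounded1)
qed

theorem theorem1:
  fixes M :: "'a measure"
    and x :: "nat \<Rightarrow> nat \<Rightarrow> 'a \<Rightarrow> real^'k"
    and eps :: "nat \<Rightarrow> nat \<Rightarrow> 'a \<Rightarrow> real"
    and y :: "nat \<Rightarrow> nat \<Rightarrow> 'a \<Rightarrow> real"
    and alpha :: "nat \<Rightarrow> real"
    and beta :: "real^'k"
    and r s c :: real
    and Ups :: "real^'k^'k"
  assumes prob: "prob_space M"
    and meas: "\<forall>i t. x i t \<in> borel_measurable M \<and> eps i t \<in> borel_measurable M"
    and model: "\<forall>i t. \<forall>\<omega>\<in>space M. y i t \<omega> = alpha i + x i t \<omega> \<bullet> beta + eps i t \<omega>"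
    and mean_eps: "\<forall>i t. (\<integral>\<omega>. eps i t \<omega> \<partial>M) = 0"
    and orth: "\<forall>i t. (\<integral>\<omega>. eps i t \<omega> *\<^sub>R x i t \<omega> \<partial>M) = 0"
    and r_gt: "r > 2"
    and A1i: "\<exists>B::real. \<forall>i t.
                (\<integral>\<^sup>+\<omega>. ennreal (norm (x i t \<omega>) powr (2 * r)) \<partial>M) \<le> ennreal B
              \<and> (\<integral>\<^sup>+\<omega>. ennreal (\<bar>eps i t \<omega>\<bar> powr (2 * r)) \<partial>M) \<le> ennreal B"
    and A1ii: "\<exists>B::real. \<forall>i t.
                (\<integral>\<^sup>+\<omega>. ennreal (norm (eps i t \<omega> *\<^sub>R x i t \<omega>) powr (3 * r)) \<partial>M) \<le> ennreal B"
    and A1iii: "prob_space.indep_vars M (\<lambda>_. PiM UNIV (\<lambda>_. borel))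
                  (\<lambda>i \<omega> t. (x i t \<omega>, eps i t \<omega>)) UNIV"
    and stationary: "\<forall>i h. distr M (PiM UNIV (\<lambda>_. borel)) (\<lambda>\<omega> t. (x i (t + h) \<omega>, eps i (t + h) \<omega>))
                          = distr M (PiM UNIV (\<lambda>_. borel)) (\<lambda>\<omega> t. (x i t \<omega>, eps i t \<omega>))"
    and s_gt: "s > 4 * r / (r - 2)"
    and mixing: "\<exists>C. \<forall>i h. h \<ge> 1 \<longrightarrow>
                   alpha_mixing_coef M (\<lambda>t \<omega>. (x i t \<omega>, eps i t \<omega>)) h \<le> C * real h powr (- s)"
    and A2: "\<exists>lam>0. \<forall>n m v. n \<ge> 1 \<and> m \<ge> 1 \<longrightarrow>
                v \<bullet> (SigmaNM M x n m *v v) \<ge> lam * (norm v)\<^sup>2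
              \<and> v \<bullet> (OmegaNM M x eps n m *v v) \<ge> lam * (norm v)\<^sup>2"
    and A3: "c \<ge> 0"
    and Ups_lim: "((\<lambda>(n, m). UpsilonNM M x eps n m) \<longlongrightarrow> Ups) (panel_limit c)"
  shows "conv_in_distr (panel_limit c) M
           (\<lambda>(n, m) \<omega>. sqrt (real (n * m)) *\<^sub>R
              (within_est x y n m \<omega> - beta
               - (1 / real m) *\<^sub>R (matrix_inv (SigmaNM M x n m) *v bNM M x eps n m)))
           (mvnormal Ups)"
proof -
  interpret prob_space M by (rule prob)
  have xm [measurable]: "x i t \<in> borel_measurable M" and em [measurable]: "eps i t \<in> borel_measurable M" for i t
    using meas by auto
  obtain Bx where Bx: "\<And>i t. (\<integral>\<^sup>+\<omega>. ennreal (norm (x i t \<omega>) powr (2 * r)) \<partial>M) \<le> ennreal Bx"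
    "\<And>i t. (\<integral>\<^sup>+\<omega>. ennreal (\<bar>eps i t \<omega>\<bar> powr (2 * r)) \<partial>M) \<le> ennreal Bx"
    using A1i by blast
  obtain Be where Be: "\<And>i t. (\<integral>\<^sup>+\<omega>. ennreal (norm (eps i t \<omega> *\<^sub>R x i t \<omega>) powr (3 * r)) \<partial>M) \<le> ennreal Be"
    using A1ii by blast
  obtain C where C: "\<And>i h. h \<ge> 1 \<Longrightarrow> alpha_mixing_coef M (\<lambda>t \<omega>. (x i t \<omega>, eps i t \<omega>)) h \<le> C * real h powr (- s)"
    using mixing by blast
  obtain lam where lam: "lam > 0" "\<And>n m v. n \<ge> 1 \<Longrightarrow> m \<ge> 1 \<Longrightarrow> v \<bullet> (SigmaNM M x n m *v v) \<ge> lam * (norm v)\<^sup>2"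
    "\<And>n m v. n \<ge> 1 \<Longrightarrow> m \<ge> 1 \<Longrightarrow> v \<bullet> (OmegaNM M x eps n m *v v) \<ge> lam * (norm v)\<^sup>2"
    using A2 by blast
  \<comment> \<open>The 1 comes from u^(2r) <= 1 + u^(3r), which lowers the moment condition on the
    product of error and regressor from order 3r to 2r.\<close>
  define B where "B = max 0 Bx + (1 + max 0 Be)"
  have ex: "integrable M (\<lambda>\<omega>. norm (eps i t \<omega> *\<^sub>R x i t \<omega>) powr (2 * r))
       \<and> expectation (\<lambda>\<omega>. norm (eps i t \<omega> *\<^sub>R x i t \<omega>) powr (2 * r)) \<le> B" for i t
  proof -
    let ?w = "\<lambda>\<omega>. norm (eps i t \<omega> *\<^sub>R x i t \<omega>)"
    have le: "u powr (2 * r) \<le> 1 + u powr (3 * r)" if "u \<ge> 0" for u :: real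
    proof (cases "u \<le> 1")
      case True
      then have "u powr (2 * r) \<le> 1" using that r_gt by (intro powr_le1) auto
      then show ?thesis by (simp add: add_increasing2)
    next
      case False
      then have "u powr (2 * r) \<le> u powr (3 * r)" using r_gt by (intro powr_mono) auto
      then show ?thesis by simp
    qed
    have m3: "(\<lambda>\<omega>. ?w \<omega> powr (3 * r)) \<in> borel_measurable M" by measurable
    note i3 = nn_integral_le_imp_integrable[OF m3 powr_ge_zero Be]
    have i: "integrable M (\<lambda>\<omega>. ?w \<omega> powr (2 * r))"
      by (rule Bochner_Integration.integrable_bound[where f="\<lambda>\<omega>. 1 + ?w \<omega> powr (3 * r)"])
        (use i3 le[of "?w _"] in \<open>auto intro!: AE_I2 simp del: norm_scaleR\<close>)
    have "expectation (\<lambda>\<omega>. ?w \<omega> powr (2 * r)) \<le> expectation (\<lambda>\<omega>. 1 + ?w \<omega> powr (3 * r))"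
      using i i3 by (intro integral_mono le) auto
    also have "\<dots> = 1 + expectation (\<lambda>\<omega>. ?w \<omega> powr (3 * r))"
      using i3 by (simp add: prob_space del: norm_scaleR)
    also have "\<dots> \<le> B" using i3(2) by (simp add: B_def del: norm_scaleR)
    finally show ?thesis using i by blast
  qed
  have x2: "(\<lambda>\<omega>. norm (x i t \<omega>) powr (2 * r)) \<in> borel_measurable M"
    and e2: "(\<lambda>\<omega>. \<bar>eps i t \<omega>\<bar> powr (2 * r)) \<in> borel_measurable M" for i t by measurable
  note xb = nn_integral_le_imp_integrable[OF x2 powr_ge_zero Bx(1)]
  note eb = nn_integral_le_imp_integrable[OF e2 powr_ge_zero Bx(2)]
  have BxB: "max 0 Bx \<le> B" by (simp add: B_def)
  interpret panel_posdef M x eps "2 * r" s B "max 0 C" lam y alpha beta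
  proof
    show "x i t \<in> borel_measurable M" "eps i t \<in> borel_measurable M" for i t by measurable
    show "expectation (eps i t) = 0" "(\<integral>\<omega>. eps i t \<omega> *\<^sub>R x i t \<omega> \<partial>M) = 0" for i t
      using mean_eps orth by auto
    show "2 * r > 4" using r_gt by simp
    \<comment> \<open>With p = 2r the exponent s (p - 4) / p is s (r - 2) / r, so this is the
      assumed mixing rate after clearing denominators.\<close>
    have "4 * r \<le> s * (r - 2)" using s_gt r_gt by (simp add: pos_divide_less_eq)
    then show "4 \<le> s * (2 * r - 4) / (2 * r)" using r_gt by (simp add: pos_le_divide_eq algebra_simps)
    show "0 \<le> B" "0 \<le> max 0 C" by (simp_all add: B_def)
    show "integrable M (\<lambda>\<omega>. norm (x i t \<omega>) powr (2 * r)) \<and> expectation (\<lambda>\<omega>. norm (x i t \<omega>) powr (2 * r)) \<le> B" for i t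
      using xb[of i t] BxB by linarith
    show "integrable M (\<lambda>\<omega>. \<bar>eps i t \<omega>\<bar> powr (2 * r)) \<and> expectation (\<lambda>\<omega>. \<bar>eps i t \<omega>\<bar> powr (2 * r)) \<le> B" for i t
      using eb[of i t] BxB by linarith
    show "integrable M (\<lambda>\<omega>. norm (eps i t \<omega> *\<^sub>R x i t \<omega>) powr (2 * r))
       \<and> expectation (\<lambda>\<omega>. norm (eps i t \<omega> *\<^sub>R x i t \<omega>) powr (2 * r)) \<le> B" for i t by (rule ex)
    show "indep_vars (\<lambda>_. PiM UNIV (\<lambda>_. borel)) (\<lambda>i \<omega> t. (x i t \<omega>, eps i t \<omega>)) UNIV" by (rule A1iii)
    show "distr M (PiM UNIV (\<lambda>_. borel)) (\<lambda>\<omega> t. (x i (t + h) \<omega>, eps i (t + h) \<omega>))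
        = distr M (PiM UNIV (\<lambda>_. borel)) (\<lambda>\<omega> t. (x i t \<omega>, eps i t \<omega>))" for i h
      using stationary by blast
    show "alpha_mixing_coef M (\<lambda>t \<omega>. (x i t \<omega>, eps i t \<omega>)) h \<le> max 0 C * real h powr (- s)" if "h \<ge> 1" for i h
      using C[OF that, of i] mult_right_mono[of C "max 0 C" "real h powr (- s)"] by simp
    show "y i t \<omega> = alpha i + x i t \<omega> \<bullet> beta + eps i t \<omega>" if "\<omega> \<in> space M" for i t \<omega>
      using model that by blast
  qed (use lam in auto)
  show ?thesis
    using est_error_conv[OF Ups_lim] unfolding est_error_def[abs_def] .
qed

end
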